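(* There is a bijective correspondence between Quang 2-rings and AC 2-rings. Explicitly, it is given by the following assignments. To a Quang 2-ring $\mathbb R=(\mathcal R,(+,0,a^+,c,l^+,r^+),(\cdot,1,a^\times,l^\times,r^\times),d,e)$ one assigns the AC 2-ring $\mathbb R_{ac}$ with the same $\mathcal R,+,0,l^+,r^+$, the same monoidal structure $(\cdot,1,a^\times,l^\times,r^\times)$ and the same distributors $d,e$, with $b$ the canonical associo-commutator of $(\mathcal R,+,0,a^+,c,l^+,r^+)$, and with $m_x:0\to x0$ and $n_z:0\to 0z$ the unique zero isomorphisms making $(x\cdot-,d_{x,-,-},m_x)$ and $(-\cdot z,e_{-,-,z},n_z)$ symmetric monoidal endofunctors of $(\mathcal R,+,0,a^+,c,l^+,r^+)$. To an AC 2-ring $\mathbb R'=(\mathcal R,(+,0,b,l^+,r^+),(\cdot,1,a^\times,l^\times,r^\times),(d,m),(e,n))$ one assigns the Quang 2-ring $\mathbb R'_{sm}$ with the same $\mathcal R,+,0,l^+,r^+$, the same monoidal structure and distributors, and with $a^+,c$ the canonical associators and commutators of $(\mathcal R,+,0,b,l^+,r^+)$. These two assignments are well defined and mutually inverse.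
   Context: A monoidal category $(\mathcal C,\otimes,1,a,l,r)$ has associators $a_{x,y,z}:x\otimes(y\otimes z)\to(x\otimes y)\otimes z$ and unitors $l_x:1\otimes x\to x$, $r_x:x\otimes 1\to x$ satisfying the usual pentagon and triangle axioms. Symmetric 2-group $(\mathcal R,+,0,a,c,l,r)$: a groupoid $\mathcal R$ with a symmetric monoidal structure (associators $a_{x,y,z}:x+(y+z)\to(x+y)+z$, commutators $c_{x,y}:x+y\to y+x$, unitors $l_x:0+x\to x$, $r_x:x+0\to x$; usual pentagon, triangle, hexagon and symmetry $c_{y,x}c_{x,y}=\mathrm{id}$ axioms) in which every object $x$ has a weak inverse $\overline x$ for $+$ (that is, $x+\overline x\cong 0\cong \overline x+x$). Its canonical associo-commutator $b(x,y,z,t):(x+y)+(z+t)\to(x+z)+(y+t)$ is $$b(x,y,z,t)=a_{x,z,y+t}\circ(\mathrm{id}_x+a^{-1}_{z,y,t})\circ(\mathrm{id}_x+(c_{y,z}+\mathrm{id}_t))\circ(\mathrm{id}_x+a_{y,z,t})\circ a^{-1}_{x,y,z+t}.$$ AC 2-group $(\mathcal R,+,0,b,l,r)$: a groupoid $\mathcal R$, a functor $+:\mathcal R\times\mathcal R\to\mathcal R$, an object $0$, natural isomorphisms $b(x,y,z,t):(x+y)+(z+t)\to(x+z)+(y+t)$, $l_x:0+x\to x$, $r_x:x+0\to x$, such that every object has a weak inverse for $+$ and, for all objects: (AC1) $(b(x,z,x',z')+b(y,t,y',t'))\circ b(x+z,y+t,x'+z',y'+t')\circ(b(x,y,z,t)+b(x',y',z',t'))=b(x+x',y+y',z+z',t+t')\circ(b(x,y,x',y')+b(z,t,z',t'))\circ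 b(x+y,z+t,x'+y',z'+t')$; (AC2) $r_{x+y}\circ(\mathrm{id}+l_0)\circ b(x,0,y,0)=r_x+r_y$; $\ l_{x+y}\circ(r_0+\mathrm{id})\circ b(0,x,0,y)=l_x+l_y$; $\ (r_x+r_y)\circ b(x,y,0,0)=r_{x+y}\circ(\mathrm{id}+l_0)$; $\ (l_x+l_y)\circ b(0,0,x,y)=l_{x+y}\circ(r_0+\mathrm{id})$; (AC3) $b(x,0,0,y)=\mathrm{id}$. Its canonical associators and commutators are $$a_{x,y,z}=(\mathrm{id}+l_z)\circ b(x,0,y,z)\circ(r_x^{-1}+\mathrm{id}),\qquad c_{x,y}=(l_y+r_x)\circ b(0,x,y,0)\circ(l_x^{-1}+r_y^{-1}).$$ Endofunctors. Consider triples $\mathbb F=(F,F_+,F_0)$ with $F:\mathcal R\to\mathcal R$ a functor, $F_+(x,y):Fx+Fy\to F(x+y)$ natural isomorphisms and $F_0:0\to F0$ an isomorphism (the zero isomorphism). Unit axioms: $F(r_x)\circ F_+(x,0)\circ(\mathrm{id}+F_0)=r_{Fx}$ and $F(l_x)\circ F_+(0,x)\circ(F_0+\mathrm{id})=l_{Fx}$. The triple is a symmetric monoidal endofunctor of a symmetric 2-group if it satisfies the unit axioms and $F(a_{x,y,z})\circ F_+(x,y+z)\circ(\mathrm{id}+F_+(y,z))=F_+(x+y,z)\circ(F_+(x,y)+\mathrm{id})\circ a_{Fx,Fy,Fz}$ and $F(c_{x,y})\circ F_+(x,y)=F_+(y,x)\circ c_{Fx,Fy}$. It is an AC endofunctor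 (endomorphism) of an AC 2-group if it satisfies the unit axioms and $F_+(x+z,y+t)\circ(F_+(x,z)+F_+(y,t))\circ b(Fx,Fy,Fz,Ft)=F(b(x,y,z,t))\circ F_+(x+y,z+t)\circ(F_+(x,y)+F_+(z,t))$. An AC natural isomorphism $\tau:\mathbb F\Rightarrow\mathbb F'$ is a natural isomorphism $\tau:F\Rightarrow F'$ with $\tau_{x+y}\circ F_+(x,y)=F'_+(x,y)\circ(\tau_x+\tau_y)$ and $\tau_0\circ F_0=F'_0$. Composition: $(F'\circ F)_+(x,y)=F'(F_+(x,y))\circ F'_+(Fx,Fy)$ and $(F'\circ F)_0=F'(F_0)\circ F'_0$. Sum: $(F\boxplus F')(-)=F(-)+F'(-)$ on objects and morphisms, $(F\boxplus F')_+(x,y)=(F_+(x,y)+F'_+(x,y))\circ b(Fx,F'x,Fy,F'y)$, $(F\boxplus F')_0=(F_0+F'_0)\circ l_0^{-1}$ (where $l_0=r_0:0+0\to 0$). Quang 2-ring: a tuple $(\mathcal R,(+,0,a^+,c,l^+,r^+),(\cdot,1,a^\times,l^\times,r^\times),d,e)$ with $\mathcal R$ a groupoid, $(+,0,a^+,c,l^+,r^+)$ a symmetric 2-group structure and $(\cdot,1,a^\times,l^\times,r^\times)$ a monoidal structure on $\mathcal R$ (write $xy=x\cdot y$), and natural isomorphisms (distributors) $d_{x,y,z}:xy+xz\to x(y+z)$, $e_{x,y,z}:xz+yz\to(x+y)z$, such that for all objects, with $b$ the canonical associo-commutator: (2R1) $(\mathrm{id}_x\cdot a^+_{y,z,t})\circ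 d_{x,y,z+t}\circ(\mathrm{id}+d_{x,z,t})=d_{x,y+z,t}\circ(d_{x,y,z}+\mathrm{id})\circ a^+_{xy,xz,xt}$; $\ (a^+_{x,y,z}\cdot\mathrm{id}_t)\circ e_{x,y+z,t}\circ(\mathrm{id}+e_{y,z,t})=e_{x+y,z,t}\circ(e_{x,y,t}+\mathrm{id})\circ a^+_{xt,yt,zt}$; $\ (\mathrm{id}_x\cdot c_{y,z})\circ d_{x,y,z}=d_{x,z,y}\circ c_{xy,xz}$; $\ (c_{y,z}\cdot\mathrm{id}_x)\circ e_{y,z,x}=e_{z,y,x}\circ c_{yx,zx}$; (2R2) $d_{x+y,z,t}\circ(e_{x,y,z}+e_{x,y,t})\circ b(xz,xt,yz,yt)=e_{x,y,z+t}\circ(d_{x,z,t}+d_{y,z,t})$; (2R3) $d_{xy,z,t}\circ(a^\times_{x,y,z}+a^\times_{x,y,t})=a^\times_{x,y,z+t}\circ(\mathrm{id}_x\cdot d_{y,z,t})\circ d_{x,yz,yt}$; (2R4) $(d_{x,z,t}\cdot\mathrm{id}_y)\circ e_{xz,xt,y}\circ(a^\times_{x,z,y}+a^\times_{x,t,y})=a^\times_{x,z+t,y}\circ(\mathrm{id}_x\cdot e_{z,t,y})\circ d_{x,zy,ty}$; (2R5) $(e_{t,z,y}\cdot\mathrm{id}_x)\circ e_{ty,zy,x}\circ(a^\times_{t,y,x}+a^\times_{z,y,x})=a^\times_{t+z,y,x}\circ e_{t,z,yx}$; (2R6) $l^\times_{x+y}\circ d_{1,x,y}=l^\times_x+l^\times_y$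 and $r^\times_{x+y}\circ e_{x,y,1}=r^\times_x+r^\times_y$. AC 2-ring: a tuple $(\mathcal R,(+,0,b,l^+,r^+),(\cdot,1,a^\times,l^\times,r^\times),(d,m),(e,n))$ with $\mathcal R$ a groupoid, $\mathcal R_+=(\mathcal R,+,0,b,l^+,r^+)$ an AC 2-group, $(\cdot,1,a^\times,l^\times,r^\times)$ a monoidal structure on $\mathcal R$, isomorphisms $d_{x,y,z}:xy+xz\to x(y+z)$ and $e_{x,y,z}:xz+yz\to(x+y)z$ natural in all three variables, and isomorphisms $m_x:0\to x0$, $n_z:0\to 0z$, such that $\mathbb x\cdot-:=(x\cdot-,d_{x,-,-},m_x)$ and $-\cdot\mathbb z:=(-\cdot z,e_{-,-,z},n_z)$ are AC endofunctors of $\mathcal R_+$ for all objects $x,z$, and for all objects $x,y,z$ the following are AC natural isomorphisms: (2R2)$'$ $e_{x,y,-}:(\mathbb x\cdot-)\boxplus(\mathbb y\cdot-)\Rightarrow(\mathbb x+\mathbb y)\cdot-$ (equivalently $d_{-,y,z}:(-\cdot\mathbb y)\boxplus(-\cdot\mathbb z)\Rightarrow-\cdot(\mathbb y+\mathbb z)$); (2R3)$'$ $a^\times_{x,y,-}:(\mathbb x\cdot-)\circ(\mathbb y\cdot-)\Rightarrow(\mathbb x\mathbb y)\cdot-$; (2R4)$'$ $a^\times_{x,-,z}:(\mathbb x\cdot-)\circ(-\cdot\mathbb z)\Rightarrow(-\cdot\mathbb z)\circ(\mathbb x\cdot-)$; (2R5)$'$ $a^\times_{-,y,z}:-\cdot(\mathbb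 y\mathbb z)\Rightarrow(-\cdot\mathbb z)\circ(-\cdot\mathbb y)$; (2R6)$'$ $l^\times_-:\mathbb 1\cdot-\Rightarrow\mathrm{id}_{\mathcal R_+}$ and $r^\times_-:-\cdot\mathbb 1\Rightarrow\mathrm{id}_{\mathcal R_+}$. Here $(\mathbb x+\mathbb y)\cdot-$, $(\mathbb x\mathbb y)\cdot-$, etc. denote the endofunctors attached to the objects $x+y$, $xy$, etc.; the identity endofunctor carries identity structure isomorphisms. *)

theory Defs
  imports "HOL-Library.FuncSet"
begin

text \<open>
  All structure is relative to a carrier of objects and a carrier of arrows. Every operation is
  required to be extensional (a member of a \<open>\<Pi>\<^sub>E\<close>, hence \<open>undefined\<close> off its domain), so that
  equality of records is equality of the tuples they encode.
\<close>

section \<open>Categories and groupoids\<close>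

record ('o, 'm) cat =
  Obj :: "'o set"
  Arr :: "'m set"
  Dom :: "'m \<Rightarrow> 'o"
  Cod :: "'m \<Rightarrow> 'o"
  Ide :: "'o \<Rightarrow> 'm"
  Comp :: "'m \<Rightarrow> 'm \<Rightarrow> 'm" (infixr "\<bullet>\<index>" 55)

definition hom :: "('o, 'm) cat \<Rightarrow> 'o \<Rightarrow> 'o \<Rightarrow> 'm set" where
  "hom C x y = {f \<in> Arr C. Dom C f = x \<and> Cod C f = y}"

definition iso_hom :: "('o, 'm) cat \<Rightarrow> 'o \<Rightarrow> 'o \<Rightarrow> 'm set" where
  "iso_hom C x y =
    {f \<in> hom C x y. \<exists>g \<in> hom C y x. g \<bullet>\<^bsub>C\<^esub> f = Ide C x \<and> f \<bullet>\<^bsub>C\<^esub> g = Ide C y}"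

definition arr_inv :: "('o, 'm) cat \<Rightarrow> 'm \<Rightarrow> 'm" where
  "arr_inv C f = (THE g. g \<in> hom C (Cod C f) (Dom C f) \<and>
    g \<bullet>\<^bsub>C\<^esub> f = Ide C (Dom C f) \<and> f \<bullet>\<^bsub>C\<^esub> g = Ide C (Cod C f))"

locale category =
  fixes C :: "('o, 'm) cat" (structure)
  assumes Dom_type: "Dom C \<in> Arr C \<rightarrow>\<^sub>E Obj C"
    and Cod_type: "Cod C \<in> Arr C \<rightarrow>\<^sub>E Obj C"
    and Ide_type: "Ide C \<in> (\<Pi>\<^sub>E x\<in>Obj C. hom C x x)"
    and Comp_type: "Comp C \<in> (\<Pi>\<^sub>E g\<in>Arr C. \<Pi>\<^sub>E f\<in>{f \<in> Arr C. Cod C f = Dom C g}.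
      hom C (Dom C f) (Cod C g))"
    and Comp_Ide: "f \<in> Arr C \<Longrightarrow> f \<bullet> Ide C (Dom C f) = f"
    and Ide_Comp: "f \<in> Arr C \<Longrightarrow> Ide C (Cod C f) \<bullet> f = f"
    and Comp_assoc: "\<lbrakk>f \<in> Arr C; g \<in> Arr C; h \<in> Arr C; Cod C f = Dom C g; Cod C g = Dom C h\<rbrakk>
      \<Longrightarrow> h \<bullet> (g \<bullet> f) = (h \<bullet> g) \<bullet> f"
begin

abbreviation ide :: "'o \<Rightarrow> 'm" where
  "ide \<equiv> Ide C"

definition endofunctor :: "('o \<Rightarrow> 'o) \<Rightarrow> ('m \<Rightarrow> 'm) \<Rightarrow> bool" where
  "endofunctor Fo Fa \<longleftrightarrow>
    (\<forall>x\<in>Obj C. Fo x \<in> Obj C) \<and>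
    (\<forall>f\<in>Arr C. Fa f \<in> hom C (Fo (Dom C f)) (Fo (Cod C f))) \<and>
    (\<forall>x\<in>Obj C. Fa (ide x) = ide (Fo x)) \<and>
    (\<forall>g\<in>Arr C. \<forall>f\<in>Arr C. Cod C f = Dom C g \<longrightarrow> Fa (g \<bullet> f) = Fa g \<bullet> Fa f)"

end

locale groupoid = category C for C :: "('o, 'm) cat" (structure) +
  assumes arr_iso: "f \<in> Arr C \<Longrightarrow> f \<in> iso_hom C (Dom C f) (Cod C f)"


section \<open>Monoidal structures\<close>

text \<open>A functor in two variables is given by its action on pairs of objects and of arrows.\<close>

locale bifunctor = category C for C :: "('o, 'm) cat" (structure) +
  fixes tens :: "'o \<Rightarrow> 'o \<Rightarrow> 'o" (infixl "\<otimes>" 70)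
    and tensa :: "'m \<Rightarrow> 'm \<Rightarrow> 'm" (infixl "\<otimes>\<^sub>a" 70)
  assumes tens_type: "(\<otimes>) \<in> Obj C \<rightarrow>\<^sub>E Obj C \<rightarrow>\<^sub>E Obj C"
    and tensa_type: "(\<otimes>\<^sub>a) \<in> (\<Pi>\<^sub>E f\<in>Arr C. \<Pi>\<^sub>E g\<in>Arr C.
      hom C (Dom C f \<otimes> Dom C g) (Cod C f \<otimes> Cod C g))"
    and tensa_Ide: "\<lbrakk>x \<in> Obj C; y \<in> Obj C\<rbrakk> \<Longrightarrow> ide x \<otimes>\<^sub>a ide y = ide (x \<otimes> y)"
    and tensa_Comp: "\<lbrakk>f \<in> Arr C; g \<in> Arr C; f' \<in> Arr C; g' \<in> Arr C;
      Cod C f = Dom C g; Cod C f' = Dom C g'\<rbrakk>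
      \<Longrightarrow> (g \<bullet> f) \<otimes>\<^sub>a (g' \<bullet> f') = (g \<otimes>\<^sub>a g') \<bullet> (f \<otimes>\<^sub>a f')"

locale unital_bifunctor = bifunctor C tens tensa
  for C :: "('o, 'm) cat" (structure)
    and tens (infixl "\<otimes>" 70) and tensa (infixl "\<otimes>\<^sub>a" 70) +
  fixes unit :: 'o ("\<one>")
    and l :: "'o \<Rightarrow> 'm"
    and r :: "'o \<Rightarrow> 'm"
  assumes unit_type: "\<one> \<in> Obj C"
    and l_type: "l \<in> (\<Pi>\<^sub>E x\<in>Obj C. iso_hom C (\<one> \<otimes> x) x)"
    and l_natural: "f \<in> Arr C \<Longrightarrow> l (Cod C f) \<bullet> (ide \<one> \<otimes>\<^sub>a f) = f \<bullet> l (Dom C f)"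
    and r_type: "r \<in> (\<Pi>\<^sub>E x\<in>Obj C. iso_hom C (x \<otimes> \<one>) x)"
    and r_natural: "f \<in> Arr C \<Longrightarrow> r (Cod C f) \<bullet> (f \<otimes>\<^sub>a ide \<one>) = f \<bullet> r (Dom C f)"

locale monoidal_category = unital_bifunctor C tens tensa unit l r
  for C :: "('o, 'm) cat" (structure)
    and tens (infixl "\<otimes>" 70) and tensa (infixl "\<otimes>\<^sub>a" 70) and unit ("\<one>") and l and r +
  fixes a :: "'o \<Rightarrow> 'o \<Rightarrow> 'o \<Rightarrow> 'm"
  assumes a_type: "a \<in> (\<Pi>\<^sub>E x\<in>Obj C. \<Pi>\<^sub>E y\<in>Obj C. \<Pi>\<^sub>E z\<in>Obj C.
      iso_hom C (x \<otimes> (y \<otimes> z)) ((x \<otimes> y) \<otimes> z))"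
    and a_natural: "\<lbrakk>f \<in> Arr C; g \<in> Arr C; h \<in> Arr C\<rbrakk> \<Longrightarrow>
      a (Cod C f) (Cod C g) (Cod C h) \<bullet> (f \<otimes>\<^sub>a (g \<otimes>\<^sub>a h)) =
      ((f \<otimes>\<^sub>a g) \<otimes>\<^sub>a h) \<bullet> a (Dom C f) (Dom C g) (Dom C h)"
    and pentagon: "\<lbrakk>x \<in> Obj C; y \<in> Obj C; z \<in> Obj C; t \<in> Obj C\<rbrakk> \<Longrightarrow>
      a (x \<otimes> y) z t \<bullet> a x y (z \<otimes> t) =
      (a x y z \<otimes>\<^sub>a ide t) \<bullet> a x (y \<otimes> z) t \<bullet> (ide x \<otimes>\<^sub>a a y z t)"
    and triangle: "\<lbrakk>x \<in> Obj C; y \<in> Obj C\<rbrakk> \<Longrightarrow>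
      (r x \<otimes>\<^sub>a ide y) \<bullet> a x \<one> y = ide x \<otimes>\<^sub>a l y"


section \<open>The structure shared by symmetric 2-groups and AC 2-groups\<close>

text \<open>The data of an endofunctor \<open>F\<close> together with \<open>F\<^sub>+\<close> and \<open>F\<^sub>0\<close>.\<close>

record ('o, 'm) endo =
  eob :: "'o \<Rightarrow> 'o"
  ear :: "'m \<Rightarrow> 'm"
  esum :: "'o \<Rightarrow> 'o \<Rightarrow> 'm"
  ezero :: "'m"

locale pre_two_group = groupoid C + unital_bifunctor C plus plusa zero l r
  for C :: "('o, 'm) cat" (structure)
    and plus (infixl "\<oplus>" 65) and plusa (infixl "\<oplus>\<^sub>a" 65) and zero ("\<zero>") and l and r +
  assumes weak_inverse: "x \<in> Obj C \<Longrightarrow>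
    \<exists>y \<in> Obj C. iso_hom C (x \<oplus> y) \<zero> \<noteq> {} \<and> iso_hom C \<zero> (y \<oplus> x) \<noteq> {}"
begin

definition unital_endofunctor :: "('o, 'm) endo \<Rightarrow> bool" where
  "unital_endofunctor F \<longleftrightarrow>
    endofunctor (eob F) (ear F) \<and>
    (\<forall>x\<in>Obj C. \<forall>y\<in>Obj C. esum F x y \<in> iso_hom C (eob F x \<oplus> eob F y) (eob F (x \<oplus> y))) \<and>
    (\<forall>f\<in>Arr C. \<forall>g\<in>Arr C. esum F (Cod C f) (Cod C g) \<bullet> (ear F f \<oplus>\<^sub>a ear F g) =
      ear F (f \<oplus>\<^sub>a g) \<bullet> esum F (Dom C f) (Dom C g)) \<and>
    ezero F \<in> iso_hom C \<zero> (eob F \<zero>) \<and>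
    (\<forall>x\<in>Obj C. ear F (r x) \<bullet> esum F x \<zero> \<bullet> (ide (eob F x) \<oplus>\<^sub>a ezero F) = r (eob F x)) \<and>
    (\<forall>x\<in>Obj C. ear F (l x) \<bullet> esum F \<zero> x \<bullet> (ezero F \<oplus>\<^sub>a ide (eob F x)) = l (eob F x))"

definition endo_id :: "('o, 'm) endo" where
  "endo_id = \<lparr>eob = (\<lambda>x. x), ear = (\<lambda>f. f), esum = (\<lambda>x y. ide (x \<oplus> y)), ezero = ide \<zero>\<rparr>"

definition endo_comp :: "('o, 'm) endo \<Rightarrow> ('o, 'm) endo \<Rightarrow> ('o, 'm) endo" where
  "endo_comp F' F = \<lparr>
    eob = (\<lambda>x. eob F' (eob F x)),
    ear = (\<lambda>f. ear F' (ear F f)),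
    esum = (\<lambda>x y. ear F' (esum F x y) \<bullet> esum F' (eob F x) (eob F y)),
    ezero = ear F' (ezero F) \<bullet> ezero F'\<rparr>"

end


section \<open>Symmetric 2-groups\<close>

locale symmetric_two_group =
  pre_two_group C plus plusa zero l r + monoidal_category C plus plusa zero l r a
  for C :: "('o, 'm) cat" (structure)
    and plus (infixl "\<oplus>" 65) and plusa (infixl "\<oplus>\<^sub>a" 65) and zero ("\<zero>") and l and r and a +
  fixes c :: "'o \<Rightarrow> 'o \<Rightarrow> 'm"
  assumes c_type: "c \<in> (\<Pi>\<^sub>E x\<in>Obj C. \<Pi>\<^sub>E y\<in>Obj C. iso_hom C (x \<oplus> y) (y \<oplus> x))"
    and c_natural: "\<lbrakk>f \<in> Arr C; g \<in> Arr C\<rbrakk> \<Longrightarrow>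
      c (Cod C f) (Cod C g) \<bullet> (f \<oplus>\<^sub>a g) = (g \<oplus>\<^sub>a f) \<bullet> c (Dom C f) (Dom C g)"
    and hexagon: "\<lbrakk>x \<in> Obj C; y \<in> Obj C; z \<in> Obj C\<rbrakk> \<Longrightarrow>
      a z x y \<bullet> c (x \<oplus> y) z \<bullet> a x y z =
      (c x z \<oplus>\<^sub>a ide y) \<bullet> a x z y \<bullet> (ide x \<oplus>\<^sub>a c y z)"
    and symmetry: "\<lbrakk>x \<in> Obj C; y \<in> Obj C\<rbrakk> \<Longrightarrow> c y x \<bullet> c x y = ide (x \<oplus> y)"
begin

definition canonical_b :: "'o \<Rightarrow> 'o \<Rightarrow> 'o \<Rightarrow> 'o \<Rightarrow> 'm" where
  "canonical_b = (\<lambda>x\<in>Obj C. \<lambda>y\<in>Obj C. \<lambda>z\<in>Obj C. \<lambda>t\<in>Obj C.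
    a x z (y \<oplus> t) \<bullet>
    (ide x \<oplus>\<^sub>a arr_inv C (a z y t)) \<bullet>
    (ide x \<oplus>\<^sub>a (c y z \<oplus>\<^sub>a ide t)) \<bullet>
    (ide x \<oplus>\<^sub>a a y z t) \<bullet>
    arr_inv C (a x y (z \<oplus> t)))"

definition symmetric_monoidal_endofunctor :: "('o, 'm) endo \<Rightarrow> bool" where
  "symmetric_monoidal_endofunctor F \<longleftrightarrow>
    unital_endofunctor F \<and>
    (\<forall>x\<in>Obj C. \<forall>y\<in>Obj C. \<forall>z\<in>Obj C.
      ear F (a x y z) \<bullet> esum F x (y \<oplus> z) \<bullet> (ide (eob F x) \<oplus>\<^sub>a esum F y z) =
      esum F (x \<oplus> y) z \<bullet> (esum F x y \<oplus>\<^sub>a ide (eob F z)) \<bullet> a (eob F x) (eob F y) (eob F z)) \<and>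
    (\<forall>x\<in>Obj C. \<forall>y\<in>Obj C.
      ear F (c x y) \<bullet> esum F x y = esum F y x \<bullet> c (eob F x) (eob F y))"

end


section \<open>AC 2-groups\<close>

locale ac_two_group = pre_two_group C plus plusa zero l r
  for C :: "('o, 'm) cat" (structure)
    and plus (infixl "\<oplus>" 65) and plusa (infixl "\<oplus>\<^sub>a" 65) and zero ("\<zero>") and l and r +
  fixes b :: "'o \<Rightarrow> 'o \<Rightarrow> 'o \<Rightarrow> 'o \<Rightarrow> 'm"
  assumes b_type: "b \<in> (\<Pi>\<^sub>E x\<in>Obj C. \<Pi>\<^sub>E y\<in>Obj C. \<Pi>\<^sub>E z\<in>Obj C. \<Pi>\<^sub>E t\<in>Obj C.
      iso_hom C ((x \<oplus> y) \<oplus> (z \<oplus> t)) ((x \<oplus> z) \<oplus> (y \<oplus> t)))"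
    and b_natural: "\<lbrakk>f \<in> Arr C; g \<in> Arr C; h \<in> Arr C; k \<in> Arr C\<rbrakk> \<Longrightarrow>
      b (Cod C f) (Cod C g) (Cod C h) (Cod C k) \<bullet> ((f \<oplus>\<^sub>a g) \<oplus>\<^sub>a (h \<oplus>\<^sub>a k)) =
      ((f \<oplus>\<^sub>a h) \<oplus>\<^sub>a (g \<oplus>\<^sub>a k)) \<bullet> b (Dom C f) (Dom C g) (Dom C h) (Dom C k)"
    and AC1: "\<lbrakk>x \<in> Obj C; y \<in> Obj C; z \<in> Obj C; t \<in> Obj C;
      x' \<in> Obj C; y' \<in> Obj C; z' \<in> Obj C; t' \<in> Obj C\<rbrakk> \<Longrightarrow>
      (b x z x' z' \<oplus>\<^sub>a b y t y' t') \<bullet> b (x \<oplus> z) (y \<oplus> t) (x' \<oplus> z') (y' \<oplus> t') \<bullet>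
        (b x y z t \<oplus>\<^sub>a b x' y' z' t') =
      b (x \<oplus> x') (y \<oplus> y') (z \<oplus> z') (t \<oplus> t') \<bullet> (b x y x' y' \<oplus>\<^sub>a b z t z' t') \<bullet>
        b (x \<oplus> y) (z \<oplus> t) (x' \<oplus> y') (z' \<oplus> t')"
    and AC2_1: "\<lbrakk>x \<in> Obj C; y \<in> Obj C\<rbrakk> \<Longrightarrow>
      r (x \<oplus> y) \<bullet> (ide (x \<oplus> y) \<oplus>\<^sub>a l \<zero>) \<bullet> b x \<zero> y \<zero> = r x \<oplus>\<^sub>a r y"
    and AC2_2: "\<lbrakk>x \<in> Obj C; y \<in> Obj C\<rbrakk> \<Longrightarrow>
      l (x \<oplus> y) \<bullet> (r \<zero> \<oplus>\<^sub>a ide (x \<oplus> y)) \<bullet> b \<zero> x \<zero> y = l x \<oplus>\<^sub>a l y"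
    and AC2_3: "\<lbrakk>x \<in> Obj C; y \<in> Obj C\<rbrakk> \<Longrightarrow>
      (r x \<oplus>\<^sub>a r y) \<bullet> b x y \<zero> \<zero> = r (x \<oplus> y) \<bullet> (ide (x \<oplus> y) \<oplus>\<^sub>a l \<zero>)"
    and AC2_4: "\<lbrakk>x \<in> Obj C; y \<in> Obj C\<rbrakk> \<Longrightarrow>
      (l x \<oplus>\<^sub>a l y) \<bullet> b \<zero> \<zero> x y = l (x \<oplus> y) \<bullet> (r \<zero> \<oplus>\<^sub>a ide (x \<oplus> y))"
    and AC3: "\<lbrakk>x \<in> Obj C; y \<in> Obj C\<rbrakk> \<Longrightarrow>
      b x \<zero> \<zero> y = ide ((x \<oplus> \<zero>) \<oplus> (\<zero> \<oplus> y))"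
begin

definition canonical_a :: "'o \<Rightarrow> 'o \<Rightarrow> 'o \<Rightarrow> 'm" where
  "canonical_a = (\<lambda>x\<in>Obj C. \<lambda>y\<in>Obj C. \<lambda>z\<in>Obj C.
    (ide (x \<oplus> y) \<oplus>\<^sub>a l z) \<bullet> b x \<zero> y z \<bullet> (arr_inv C (r x) \<oplus>\<^sub>a ide (y \<oplus> z)))"

definition canonical_c :: "'o \<Rightarrow> 'o \<Rightarrow> 'm" where
  "canonical_c = (\<lambda>x\<in>Obj C. \<lambda>y\<in>Obj C.
    (l y \<oplus>\<^sub>a r x) \<bullet> b \<zero> x y \<zero> \<bullet> (arr_inv C (l x) \<oplus>\<^sub>a arr_inv C (r y)))"

definition ac_endofunctor :: "('o, 'm) endo \<Rightarrow> bool" where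
  "ac_endofunctor F \<longleftrightarrow>
    unital_endofunctor F \<and>
    (\<forall>x\<in>Obj C. \<forall>y\<in>Obj C. \<forall>z\<in>Obj C. \<forall>t\<in>Obj C.
      esum F (x \<oplus> z) (y \<oplus> t) \<bullet> (esum F x z \<oplus>\<^sub>a esum F y t) \<bullet>
        b (eob F x) (eob F y) (eob F z) (eob F t) =
      ear F (b x y z t) \<bullet> esum F (x \<oplus> y) (z \<oplus> t) \<bullet> (esum F x y \<oplus>\<^sub>a esum F z t))"

definition ac_natural_iso ::
  "('o \<Rightarrow> 'm) \<Rightarrow> ('o, 'm) endo \<Rightarrow> ('o, 'm) endo \<Rightarrow> bool" where
  "ac_natural_iso \<tau> F F' \<longleftrightarrow>
    (\<forall>x\<in>Obj C. \<tau> x \<in> iso_hom C (eob F x) (eob F' x)) \<and>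
    (\<forall>f\<in>Arr C. \<tau> (Cod C f) \<bullet> ear F f = ear F' f \<bullet> \<tau> (Dom C f)) \<and>
    (\<forall>x\<in>Obj C. \<forall>y\<in>Obj C. \<tau> (x \<oplus> y) \<bullet> esum F x y = esum F' x y \<bullet> (\<tau> x \<oplus>\<^sub>a \<tau> y)) \<and>
    \<tau> \<zero> \<bullet> ezero F = ezero F'"

definition endo_sum :: "('o, 'm) endo \<Rightarrow> ('o, 'm) endo \<Rightarrow> ('o, 'm) endo" (infixl "\<boxplus>" 65) where
  "F \<boxplus> F' = \<lparr>
    eob = (\<lambda>x. eob F x \<oplus> eob F' x),
    ear = (\<lambda>f. ear F f \<oplus>\<^sub>a ear F' f),
    esum = (\<lambda>x y. (esum F x y \<oplus>\<^sub>a esum F' x y) \<bullet> b (eob F x) (eob F' x) (eob F y) (eob F' y)),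
    ezero = (ezero F \<oplus>\<^sub>a ezero F') \<bullet> arr_inv C (l \<zero>)\<rparr>"

end


section \<open>The structure shared by Quang 2-rings and AC 2-rings\<close>

locale pre_two_ring =
  pre_two_group C plus plusa zero l r + mul: monoidal_category C times timesa one lx rx ax
  for C :: "('o, 'm) cat" (structure)
    and plus (infixl "\<oplus>" 65) and plusa (infixl "\<oplus>\<^sub>a" 65) and zero ("\<zero>") and l and r
    and times (infixl "\<otimes>" 70) and timesa (infixl "\<otimes>\<^sub>a" 70) and one ("\<one>") and lx and rx and ax +
  fixes d :: "'o \<Rightarrow> 'o \<Rightarrow> 'o \<Rightarrow> 'm"
    and e :: "'o \<Rightarrow> 'o \<Rightarrow> 'o \<Rightarrow> 'm"
  assumes d_type: "d \<in> (\<Pi>\<^sub>E x\<in>Obj C. \<Pi>\<^sub>E y\<in>Obj C. \<Pi>\<^sub>E z\<in>Obj C.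
      iso_hom C (x \<otimes> y \<oplus> x \<otimes> z) (x \<otimes> (y \<oplus> z)))"
    and d_natural: "\<lbrakk>f \<in> Arr C; g \<in> Arr C; h \<in> Arr C\<rbrakk> \<Longrightarrow>
      d (Cod C f) (Cod C g) (Cod C h) \<bullet> (f \<otimes>\<^sub>a g \<oplus>\<^sub>a f \<otimes>\<^sub>a h) =
      (f \<otimes>\<^sub>a (g \<oplus>\<^sub>a h)) \<bullet> d (Dom C f) (Dom C g) (Dom C h)"
    and e_type: "e \<in> (\<Pi>\<^sub>E x\<in>Obj C. \<Pi>\<^sub>E y\<in>Obj C. \<Pi>\<^sub>E z\<in>Obj C.
      iso_hom C (x \<otimes> z \<oplus> y \<otimes> z) ((x \<oplus> y) \<otimes> z))"
    and e_natural: "\<lbrakk>f \<in> Arr C; g \<in> Arr C; h \<in> Arr C\<rbrakk> \<Longrightarrow>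
      e (Cod C f) (Cod C g) (Cod C h) \<bullet> (f \<otimes>\<^sub>a h \<oplus>\<^sub>a g \<otimes>\<^sub>a h) =
      ((f \<oplus>\<^sub>a g) \<otimes>\<^sub>a h) \<bullet> e (Dom C f) (Dom C g) (Dom C h)"
begin

text \<open>The endofunctors \<open>x\<cdot>-\<close> and \<open>-\<cdot>z\<close> with a prescribed zero isomorphism.\<close>

definition left_mult :: "'o \<Rightarrow> 'm \<Rightarrow> ('o, 'm) endo" where
  "left_mult x m0 =
    \<lparr>eob = (\<lambda>y. x \<otimes> y), ear = (\<lambda>f. ide x \<otimes>\<^sub>a f), esum = (\<lambda>y z. d x y z), ezero = m0\<rparr>"

definition right_mult :: "'o \<Rightarrow> 'm \<Rightarrow> ('o, 'm) endo" where
  "right_mult z n0 =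
    \<lparr>eob = (\<lambda>x. x \<otimes> z), ear = (\<lambda>f. f \<otimes>\<^sub>a ide z), esum = (\<lambda>x y. e x y z), ezero = n0\<rparr>"

end


section \<open>Quang 2-rings\<close>

locale quang_structure =
  symmetric_two_group C plus plusa zero l r a c +
  pre_two_ring C plus plusa zero l r times timesa one lx rx ax d e
  for C :: "('o, 'm) cat" (structure)
    and plus (infixl "\<oplus>" 65) and plusa (infixl "\<oplus>\<^sub>a" 65) and zero ("\<zero>") and l and r and a and c
    and times (infixl "\<otimes>" 70) and timesa (infixl "\<otimes>\<^sub>a" 70) and one ("\<one>") and lx and rx and ax
    and d and e +
  assumes R1_1: "\<lbrakk>x \<in> Obj C; y \<in> Obj C; z \<in> Obj C; t \<in> Obj C\<rbrakk> \<Longrightarrow>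
      (ide x \<otimes>\<^sub>a a y z t) \<bullet> d x y (z \<oplus> t) \<bullet> (ide (x \<otimes> y) \<oplus>\<^sub>a d x z t) =
      d x (y \<oplus> z) t \<bullet> (d x y z \<oplus>\<^sub>a ide (x \<otimes> t)) \<bullet> a (x \<otimes> y) (x \<otimes> z) (x \<otimes> t)"
    and R1_2: "\<lbrakk>x \<in> Obj C; y \<in> Obj C; z \<in> Obj C; t \<in> Obj C\<rbrakk> \<Longrightarrow>
      (a x y z \<otimes>\<^sub>a ide t) \<bullet> e x (y \<oplus> z) t \<bullet> (ide (x \<otimes> t) \<oplus>\<^sub>a e y z t) =
      e (x \<oplus> y) z t \<bullet> (e x y t \<oplus>\<^sub>a ide (z \<otimes> t)) \<bullet> a (x \<otimes> t) (y \<otimes> t) (z \<otimes> t)"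
    and R1_3: "\<lbrakk>x \<in> Obj C; y \<in> Obj C; z \<in> Obj C\<rbrakk> \<Longrightarrow>
      (ide x \<otimes>\<^sub>a c y z) \<bullet> d x y z = d x z y \<bullet> c (x \<otimes> y) (x \<otimes> z)"
    and R1_4: "\<lbrakk>x \<in> Obj C; y \<in> Obj C; z \<in> Obj C\<rbrakk> \<Longrightarrow>
      (c y z \<otimes>\<^sub>a ide x) \<bullet> e y z x = e z y x \<bullet> c (y \<otimes> x) (z \<otimes> x)"
    and R2: "\<lbrakk>x \<in> Obj C; y \<in> Obj C; z \<in> Obj C; t \<in> Obj C\<rbrakk> \<Longrightarrow>
      d (x \<oplus> y) z t \<bullet> (e x y z \<oplus>\<^sub>a e x y t) \<bullet> canonical_b (x \<otimes> z) (x \<otimes> t) (y \<otimes> z) (y \<otimes> t) =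
      e x y (z \<oplus> t) \<bullet> (d x z t \<oplus>\<^sub>a d y z t)"
    and R3: "\<lbrakk>x \<in> Obj C; y \<in> Obj C; z \<in> Obj C; t \<in> Obj C\<rbrakk> \<Longrightarrow>
      d (x \<otimes> y) z t \<bullet> (ax x y z \<oplus>\<^sub>a ax x y t) =
      ax x y (z \<oplus> t) \<bullet> (ide x \<otimes>\<^sub>a d y z t) \<bullet> d x (y \<otimes> z) (y \<otimes> t)"
    and R4: "\<lbrakk>x \<in> Obj C; y \<in> Obj C; z \<in> Obj C; t \<in> Obj C\<rbrakk> \<Longrightarrow>
      (d x z t \<otimes>\<^sub>a ide y) \<bullet> e (x \<otimes> z) (x \<otimes> t) y \<bullet> (ax x z y \<oplus>\<^sub>a ax x t y) =
      ax x (z \<oplus> t) y \<bullet> (ide x \<otimes>\<^sub>a e z t y) \<bullet> d x (z \<otimes> y) (t \<otimes> y)"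
    and R5: "\<lbrakk>x \<in> Obj C; y \<in> Obj C; z \<in> Obj C; t \<in> Obj C\<rbrakk> \<Longrightarrow>
      (e t z y \<otimes>\<^sub>a ide x) \<bullet> e (t \<otimes> y) (z \<otimes> y) x \<bullet> (ax t y x \<oplus>\<^sub>a ax z y x) =
      ax (t \<oplus> z) y x \<bullet> e t z (y \<otimes> x)"
    and R6_1: "\<lbrakk>x \<in> Obj C; y \<in> Obj C\<rbrakk> \<Longrightarrow> lx (x \<oplus> y) \<bullet> d \<one> x y = lx x \<oplus>\<^sub>a lx y"
    and R6_2: "\<lbrakk>x \<in> Obj C; y \<in> Obj C\<rbrakk> \<Longrightarrow> rx (x \<oplus> y) \<bullet> e x y \<one> = rx x \<oplus>\<^sub>a rx y"


section \<open>AC 2-rings\<close>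

locale ac_structure =
  ac_two_group C plus plusa zero l r b +
  pre_two_ring C plus plusa zero l r times timesa one lx rx ax d e
  for C :: "('o, 'm) cat" (structure)
    and plus (infixl "\<oplus>" 65) and plusa (infixl "\<oplus>\<^sub>a" 65) and zero ("\<zero>") and l and r and b
    and times (infixl "\<otimes>" 70) and timesa (infixl "\<otimes>\<^sub>a" 70) and one ("\<one>") and lx and rx and ax
    and d and e +
  fixes m :: "'o \<Rightarrow> 'm"
    and n :: "'o \<Rightarrow> 'm"
  assumes m_type: "m \<in> (\<Pi>\<^sub>E x\<in>Obj C. iso_hom C \<zero> (x \<otimes> \<zero>))"
    and n_type: "n \<in> (\<Pi>\<^sub>E z\<in>Obj C. iso_hom C \<zero> (\<zero> \<otimes> z))"
    and left_ac: "x \<in> Obj C \<Longrightarrow> ac_endofunctor (left_mult x (m x))"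
    and right_ac: "z \<in> Obj C \<Longrightarrow> ac_endofunctor (right_mult z (n z))"
    and R2': "\<lbrakk>x \<in> Obj C; y \<in> Obj C\<rbrakk> \<Longrightarrow>
      ac_natural_iso (\<lambda>z. e x y z)
        (left_mult x (m x) \<boxplus> left_mult y (m y)) (left_mult (x \<oplus> y) (m (x \<oplus> y)))"
    and R3': "\<lbrakk>x \<in> Obj C; y \<in> Obj C\<rbrakk> \<Longrightarrow>
      ac_natural_iso (\<lambda>z. ax x y z)
        (endo_comp (left_mult x (m x)) (left_mult y (m y))) (left_mult (x \<otimes> y) (m (x \<otimes> y)))"
    and R4': "\<lbrakk>x \<in> Obj C; z \<in> Obj C\<rbrakk> \<Longrightarrow>
      ac_natural_iso (\<lambda>y. ax x y z)
        (endo_comp (left_mult x (m x)) (right_mult z (n z)))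
        (endo_comp (right_mult z (n z)) (left_mult x (m x)))"
    and R5': "\<lbrakk>y \<in> Obj C; z \<in> Obj C\<rbrakk> \<Longrightarrow>
      ac_natural_iso (\<lambda>x. ax x y z)
        (right_mult (y \<otimes> z) (n (y \<otimes> z))) (endo_comp (right_mult z (n z)) (right_mult y (n y)))"
    and R6'_1: "ac_natural_iso lx (left_mult \<one> (m \<one>)) endo_id"
    and R6'_2: "ac_natural_iso rx (right_mult \<one> (n \<one>)) endo_id"


section \<open>2-rings as tuples, and the two assignments\<close>

record ('o, 'm) two_ring =
  grpd :: "('o, 'm) cat"
  plus_ob :: "'o \<Rightarrow> 'o \<Rightarrow> 'o"
  plus_ar :: "'m \<Rightarrow> 'm \<Rightarrow> 'm"
  zero_ob :: 'o
  plus_l :: "'o \<Rightarrow> 'm"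
  plus_r :: "'o \<Rightarrow> 'm"
  times_ob :: "'o \<Rightarrow> 'o \<Rightarrow> 'o"
  times_ar :: "'m \<Rightarrow> 'm \<Rightarrow> 'm"
  one_ob :: 'o
  times_l :: "'o \<Rightarrow> 'm"
  times_r :: "'o \<Rightarrow> 'm"
  times_a :: "'o \<Rightarrow> 'o \<Rightarrow> 'o \<Rightarrow> 'm"
  dist_d :: "'o \<Rightarrow> 'o \<Rightarrow> 'o \<Rightarrow> 'm"
  dist_e :: "'o \<Rightarrow> 'o \<Rightarrow> 'o \<Rightarrow> 'm"

record ('o, 'm) quang = "('o, 'm) two_ring" +
  plus_a :: "'o \<Rightarrow> 'o \<Rightarrow> 'o \<Rightarrow> 'm"
  plus_c :: "'o \<Rightarrow> 'o \<Rightarrow> 'm"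

record ('o, 'm) ac = "('o, 'm) two_ring" +
  plus_b :: "'o \<Rightarrow> 'o \<Rightarrow> 'o \<Rightarrow> 'o \<Rightarrow> 'm"
  zero_m :: "'o \<Rightarrow> 'm"
  zero_n :: "'o \<Rightarrow> 'm"

definition quang_two_ring :: "('o, 'm) quang \<Rightarrow> bool" where
  "quang_two_ring Q \<longleftrightarrow>
    quang_structure (grpd Q)
      (plus_ob Q) (plus_ar Q) (zero_ob Q) (plus_l Q) (plus_r Q) (plus_a Q) (plus_c Q)
      (times_ob Q) (times_ar Q) (one_ob Q) (times_l Q) (times_r Q) (times_a Q)
      (dist_d Q) (dist_e Q)"

definition ac_two_ring :: "('o, 'm) ac \<Rightarrow> bool" where
  "ac_two_ring A \<longleftrightarrow>
    ac_structure (grpd A)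
      (plus_ob A) (plus_ar A) (zero_ob A) (plus_l A) (plus_r A) (plus_b A)
      (times_ob A) (times_ar A) (one_ob A) (times_l A) (times_r A) (times_a A)
      (dist_d A) (dist_e A) (zero_m A) (zero_n A)"

text \<open>
  \<open>left_zero_iso Q x m0\<close> says that \<open>m0\<close> is a zero isomorphism making \<open>x\<cdot>-\<close> a symmetric monoidal
  endofunctor of the additive symmetric 2-group of \<open>Q\<close>; similarly for \<open>-\<cdot>z\<close>.
\<close>

definition left_zero_iso :: "('o, 'm) quang \<Rightarrow> 'o \<Rightarrow> 'm \<Rightarrow> bool" where
  "left_zero_iso Q x m0 \<longleftrightarrow>
    symmetric_two_group.symmetric_monoidal_endofunctor (grpd Q)
      (plus_ob Q) (plus_ar Q) (zero_ob Q) (plus_l Q) (plus_r Q) (plus_a Q) (plus_c Q)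
      (pre_two_ring.left_mult (grpd Q) (times_ob Q) (times_ar Q) (dist_d Q) x m0)"

definition right_zero_iso :: "('o, 'm) quang \<Rightarrow> 'o \<Rightarrow> 'm \<Rightarrow> bool" where
  "right_zero_iso Q z n0 \<longleftrightarrow>
    symmetric_two_group.symmetric_monoidal_endofunctor (grpd Q)
      (plus_ob Q) (plus_ar Q) (zero_ob Q) (plus_l Q) (plus_r Q) (plus_a Q) (plus_c Q)
      (pre_two_ring.right_mult (grpd Q) (times_ob Q) (times_ar Q) (dist_e Q) z n0)"

definition ac_of_quang :: "('o, 'm) quang \<Rightarrow> ('o, 'm) ac" where
  "ac_of_quang Q = \<lparr>
    grpd = grpd Q,
    plus_ob = plus_ob Q, plus_ar = plus_ar Q, zero_ob = zero_ob Q,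
    plus_l = plus_l Q, plus_r = plus_r Q,
    times_ob = times_ob Q, times_ar = times_ar Q, one_ob = one_ob Q,
    times_l = times_l Q, times_r = times_r Q, times_a = times_a Q,
    dist_d = dist_d Q, dist_e = dist_e Q,
    plus_b = symmetric_two_group.canonical_b (grpd Q)
      (plus_ob Q) (plus_ar Q) (plus_a Q) (plus_c Q),
    zero_m = (\<lambda>x\<in>Obj (grpd Q). THE m0. left_zero_iso Q x m0),
    zero_n = (\<lambda>z\<in>Obj (grpd Q). THE n0. right_zero_iso Q z n0)\<rparr>"

definition quang_of_ac :: "('o, 'm) ac \<Rightarrow> ('o, 'm) quang" where
  "quang_of_ac A = \<lparr>
    grpd = grpd A,
    plus_ob = plus_ob A, plus_ar = plus_ar A, zero_ob = zero_ob A,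
    plus_l = plus_l A, plus_r = plus_r A,
    times_ob = times_ob A, times_ar = times_ar A, one_ob = one_ob A,
    times_l = times_l A, times_r = times_r A, times_a = times_a A,
    dist_d = dist_d A, dist_e = dist_e A,
    plus_a = ac_two_group.canonical_a (grpd A)
      (plus_ob A) (plus_ar A) (zero_ob A) (plus_l A) (plus_r A) (plus_b A),
    plus_c = ac_two_group.canonical_c (grpd A)
      (plus_ar A) (zero_ob A) (plus_l A) (plus_r A) (plus_b A)\<rparr>"

end

theory Submission
  imports Defs
begin

text \<open>
  The two kinds of 2-ring differ only in how the coherence of addition is recorded: by associators
  and commutators, or by the associo-commutator \<open>b\<close> together with zero isomorphisms of the
  multiplication functors. So the theorem rests on a bijection between symmetric 2-group and AC
  2-group structures over a fixed groupoid with sum, zero object and unitors, and on the fact that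
  this bijection does not change which endofunctors are structure preserving.

  From associators and commutators to \<open>b\<close>. All axioms of an AC 2-group for the canonical \<open>b\<close> are
  diagrams of associators, unitors and commutators, so they hold by coherence. Coherence is proved
  by a Cayley representation: an arrow \<open>f\<close> is replaced by its translates \<open>f + w\<close>, read on
  right-bracketed sums \<open>x + (y + (\<dots> + w))\<close>. Associators and unitors then turn into identities and
  commutators into exchanges of neighbouring summands, which obey the Coxeter relations of the
  symmetric group (\<open>symmetric_coherence\<close>). The interchange axiom \<open>AC1\<close> becomes an identity of
  words of adjacent transpositions of eight letters (\<open>coxeter_interchange\<close>).

  From \<open>b\<close> to associators and commutators. Both are, up to unitors, values of \<open>b\<close> at zero
  arguments. Putting zeros in all but two, three or four of the eight places of \<open>AC1\<close> turns some of
  its six edges into identities (\<open>edge_ide\<close>, which is where \<open>AC2\<close> and \<open>AC3\<close> enter), and what is left is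
  symmetry, the pentagon, the two halves of the hexagon, or an expression of \<open>b\<close> through
  associators and commutators. The last one shows that the canonical \<open>b\<close> of these is \<open>b\<close> again
  (\<open>canonical_b_canonical\<close>); the other composite of the two passages is the identity by coherence.

  Endofunctors. As \<open>b\<close> is composed of associators and commutators, a functor compatible with these
  is compatible with \<open>b\<close>; as they are composed of \<open>b\<close> and unitors, the converse holds too.

  Zero isomorphisms. In a 2-group the functor \<open>x + -\<close> is fully faithful, so the right unit axiom at
  the zero object has exactly one solution. This one solution satisfies all unit axioms
  (\<open>zero_exists_unique\<close>), and every natural isomorphism compatible with sums respects it
  (\<open>zero_natural\<close>). Hence the zero isomorphisms of an AC 2-ring carry no information, and its
  naturality axioms amount to those axioms of a Quang 2-ring that relate two distributors, or
  distributors with the multiplicative structure.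
\<close>

section \<open>Calculus of arrows and commuting squares\<close>

context category
begin

lemma Dom_Obj [simp]: "f \<in> Arr C \<Longrightarrow> Dom C f \<in> Obj C"
  using Dom_type by auto

lemma Cod_Obj [simp]: "f \<in> Arr C \<Longrightarrow> Cod C f \<in> Obj C"
  using Cod_type by auto

lemma ide_hom: "x \<in> Obj C \<Longrightarrow> ide x \<in> hom C x x"
  using Ide_type by auto

lemma ide_arr [simp]:
  assumes "x \<in> Obj C"
  shows "ide x \<in> Arr C" "Dom C (ide x) = x" "Cod C (ide x) = x"
  using ide_hom [OF assms] by (auto simp: hom_def)

lemma comp_arr [simp]:
  assumes "f \<in> Arr C" "g \<in> Arr C" "Cod C f = Dom C g"
  shows "g \<bullet> f \<in> Arr C" "Dom C (g \<bullet> f) = Dom C f" "Cod C (g \<bullet> f) = Cod C g"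
proof -
  have "g \<bullet> f \<in> hom C (Dom C f) (Cod C g)"
    using PiE_mem [OF PiE_mem [OF Comp_type assms(2)]] assms by blast
  then show "g \<bullet> f \<in> Arr C" "Dom C (g \<bullet> f) = Dom C f" "Cod C (g \<bullet> f) = Cod C g"
    by (auto simp: hom_def)
qed

lemma comp_ide [simp]: "\<lbrakk>f \<in> Arr C; Dom C f = x\<rbrakk> \<Longrightarrow> f \<bullet> ide x = f"
  using Comp_Ide by auto

lemma ide_comp [simp]: "\<lbrakk>f \<in> Arr C; Cod C f = x\<rbrakk> \<Longrightarrow> ide x \<bullet> f = f"
  using Ide_Comp by auto

lemma comp_assoc [simp]:
  "\<lbrakk>f \<in> Arr C; g \<in> Arr C; h \<in> Arr C; Cod C f = Dom C g; Cod C g = Dom C h\<rbrakk>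
    \<Longrightarrow> (h \<bullet> g) \<bullet> f = h \<bullet> (g \<bullet> f)"
  using Comp_assoc by simp

lemma homI [intro]: "\<lbrakk>f \<in> Arr C; Dom C f = x; Cod C f = y\<rbrakk> \<Longrightarrow> f \<in> hom C x y"
  by (simp add: hom_def)

lemma hom_arrD:
  assumes "f \<in> hom C x y"
  shows "f \<in> Arr C" "Dom C f = x" "Cod C f = y"
  using assms by (auto simp: hom_def)

lemma iso_hom_arrD:
  assumes "f \<in> iso_hom C x y"
  shows "f \<in> Arr C" "Dom C f = x" "Cod C f = y"
  using assms by (auto simp: iso_hom_def hom_def)

text \<open>
  Commuting squares with horizontal arrows \<open>f\<close>, \<open>g\<close> and vertical arrows \<open>u\<close>, \<open>v\<close>. Each of the
  comparisons made below (of an arrow with its Cayley image, with its reduction modulo zeros, with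
  its image under a functor) is a square along fixed vertical isomorphisms; in a groupoid such a
  square determines either horizontal arrow from the other.
\<close>

definition sq :: "'m \<Rightarrow> 'm \<Rightarrow> 'm \<Rightarrow> 'm \<Rightarrow> bool" where
  "sq u v f g \<longleftrightarrow>
    u \<in> Arr C \<and> v \<in> Arr C \<and> f \<in> Arr C \<and> g \<in> Arr C \<and>
    Dom C f = Dom C u \<and> Cod C f = Dom C v \<and> Dom C g = Cod C u \<and> Cod C g = Cod C v \<and>
    v \<bullet> f = g \<bullet> u"

lemma sqI:
  assumes "u \<in> Arr C" "v \<in> Arr C" "f \<in> Arr C" "g \<in> Arr C"
    "Dom C f = Dom C u" "Cod C f = Dom C v" "Dom C g = Cod C u" "Cod C g = Cod C v"
    "v \<bullet> f = g \<bullet> u"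
  shows "sq u v f g"
  using assms unfolding sq_def by blast

lemma sqD:
  assumes "sq u v f g"
  shows "u \<in> Arr C" "v \<in> Arr C" "f \<in> Arr C" "g \<in> Arr C"
    "Dom C f = Dom C u" "Cod C f = Dom C v" "Dom C g = Cod C u" "Cod C g = Cod C v"
    "v \<bullet> f = g \<bullet> u"
  using assms unfolding sq_def by blast+

lemma sq_comp:
  assumes "sq u v f g" "sq v w f' g'"
  shows "sq u w (f' \<bullet> f) (g' \<bullet> g)"
proof (rule sqI)
  note [simp] = sqD(1-8) [OF assms(1)] sqD(1-8) [OF assms(2)]
  have "w \<bullet> (f' \<bullet> f) = (w \<bullet> f') \<bullet> f"
    by (subst comp_assoc) simp_all
  also have "\<dots> = (g' \<bullet> v) \<bullet> f"
    using sqD(9) [OF assms(2)] by simp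
  also have "\<dots> = g' \<bullet> (v \<bullet> f)"
    by simp
  also have "\<dots> = (g' \<bullet> g) \<bullet> u"
    using sqD(9) [OF assms(1)] by simp
  finally show "w \<bullet> (f' \<bullet> f) = (g' \<bullet> g) \<bullet> u" .
qed (use sqD [OF assms(1)] sqD [OF assms(2)] in simp_all)

lemma sq_transpose: "sq u v f g \<Longrightarrow> sq f g u v"
  unfolding sq_def by auto

lemma sq_stack:
  assumes "sq u v f g" "sq u' v' g h"
  shows "sq (u' \<bullet> u) (v' \<bullet> v) f h"
  using sq_transpose [OF sq_comp [OF sq_transpose [OF assms(1)] sq_transpose [OF assms(2)]]] .

lemma sq_ide: "u \<in> Arr C \<Longrightarrow> sq u u (ide (Dom C u)) (ide (Cod C u))"
  by (rule sqI) simp_all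

lemma sq_ide_vertical: "f \<in> Arr C \<Longrightarrow> sq (ide (Dom C f)) (ide (Cod C f)) f f"
  by (rule sqI) simp_all

end

context groupoid
begin

lemma arr_inv_hom:
  assumes "f \<in> Arr C"
  shows "arr_inv C f \<in> hom C (Cod C f) (Dom C f) \<and>
    arr_inv C f \<bullet> f = ide (Dom C f) \<and> f \<bullet> arr_inv C f = ide (Cod C f)"
  unfolding arr_inv_def
proof (rule theI')
  obtain g where g: "g \<in> hom C (Cod C f) (Dom C f)" "g \<bullet> f = ide (Dom C f)"
      "f \<bullet> g = ide (Cod C f)"
    using arr_iso [OF assms] by (auto simp: iso_hom_def)
  note [simp] = hom_arrD [OF g(1)] assms
  show "\<exists>!g. g \<in> hom C (Cod C f) (Dom C f) \<and> g \<bullet> f = ide (Dom C f) \<and> f \<bullet> g = ide (Cod C f)"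
  proof (rule ex1I)
    fix h
    assume h: "h \<in> hom C (Cod C f) (Dom C f) \<and> h \<bullet> f = ide (Dom C f) \<and> f \<bullet> h = ide (Cod C f)"
    then have [simp]: "h \<in> Arr C" "Dom C h = Cod C f" "Cod C h = Dom C f"
      by (auto simp: hom_def)
    have "h = h \<bullet> (f \<bullet> g)" using g by simp
    also have "\<dots> = (h \<bullet> f) \<bullet> g" by (subst comp_assoc) simp_all
    also have "\<dots> = g" using h by simp
    finally show "h = g" .
  qed (use g in blast)
qed

lemma inv_arr [simp]:
  assumes "f \<in> Arr C"
  shows "arr_inv C f \<in> Arr C" "Dom C (arr_inv C f) = Cod C f" "Cod C (arr_inv C f) = Dom C f"
    "arr_inv C f \<bullet> f = ide (Dom C f)" "f \<bullet> arr_inv C f = ide (Cod C f)"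
  using arr_inv_hom [OF assms] by (auto simp: hom_def)

lemma inv_comp_cancel [simp]:
  assumes "f \<in> Arr C" "h \<in> Arr C" "Cod C h = Dom C f"
  shows "arr_inv C f \<bullet> (f \<bullet> h) = h"
proof -
  have "arr_inv C f \<bullet> (f \<bullet> h) = (arr_inv C f \<bullet> f) \<bullet> h"
    using assms by (subst comp_assoc) simp_all
  then show ?thesis using assms by simp
qed

lemma comp_inv_cancel [simp]:
  assumes "f \<in> Arr C" "h \<in> Arr C" "Cod C h = Cod C f"
  shows "f \<bullet> (arr_inv C f \<bullet> h) = h"
proof -
  have "f \<bullet> (arr_inv C f \<bullet> h) = (f \<bullet> arr_inv C f) \<bullet> h"
    using assms by (subst comp_assoc) simp_all
  then show ?thesis using assms by simp
qed

lemma iso_hom_eq_hom: "iso_hom C x y = hom C x y"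
  using arr_iso by (auto simp: iso_hom_def hom_def)

lemma left_cancel:
  assumes "h \<bullet> f = h \<bullet> g" "h \<in> Arr C" "f \<in> Arr C" "g \<in> Arr C"
    "Cod C f = Dom C h" "Cod C g = Dom C h"
  shows "f = g"
  using assms by (metis inv_comp_cancel)

lemma right_cancel:
  assumes "f \<bullet> h = g \<bullet> h" "h \<in> Arr C" "f \<in> Arr C" "g \<in> Arr C"
    "Dom C f = Cod C h" "Dom C g = Cod C h"
  shows "f = g"
proof -
  have "(f \<bullet> h) \<bullet> arr_inv C h = (g \<bullet> h) \<bullet> arr_inv C h"
    using assms(1) by simp
  then show ?thesis using assms(2-) by simp
qed

lemma inv_unique:
  assumes "g \<bullet> f = ide (Dom C f)" "f \<in> Arr C" "g \<in> Arr C" "Dom C g = Cod C f" "Cod C g = Dom C f"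
  shows "arr_inv C f = g"
  by (rule right_cancel [where h = f]) (use assms in simp_all)

lemma inv_inv [simp]: "f \<in> Arr C \<Longrightarrow> arr_inv C (arr_inv C f) = f"
  by (rule inv_unique) simp_all

lemma sq_inv:
  assumes "sq u v f g"
  shows "sq v u (arr_inv C f) (arr_inv C g)"
proof (rule sqI)
  note [simp] = sqD(1-8) [OF assms]
  have "g \<bullet> (u \<bullet> arr_inv C f) = v"
    using arg_cong [OF sqD(9) [OF assms], of "\<lambda>h. h \<bullet> arr_inv C f"] by simp
  from arg_cong [OF this, of "\<lambda>h. arr_inv C g \<bullet> h"]
  show "u \<bullet> arr_inv C f = arr_inv C g \<bullet> v" by simp
qed (use sqD [OF assms] in simp_all)

lemma sq_top_unique: "\<lbrakk>sq u v f g; sq u v f' g\<rbrakk> \<Longrightarrow> f = f'"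
  unfolding sq_def by (metis left_cancel)

lemma sq_bottom_unique: "\<lbrakk>sq u v f g; sq u v f g'\<rbrakk> \<Longrightarrow> g = g'"
  unfolding sq_def by (metis right_cancel)

end

context bifunctor
begin

lemma tens_Obj [simp]: "\<lbrakk>x \<in> Obj C; y \<in> Obj C\<rbrakk> \<Longrightarrow> x \<otimes> y \<in> Obj C"
  using PiE_mem [OF PiE_mem [OF tens_type]] by blast

lemma tensa_arr [simp]:
  assumes "f \<in> Arr C" "g \<in> Arr C"
  shows "f \<otimes>\<^sub>a g \<in> Arr C" "Dom C (f \<otimes>\<^sub>a g) = Dom C f \<otimes> Dom C g"
    "Cod C (f \<otimes>\<^sub>a g) = Cod C f \<otimes> Cod C g"
proof -
  have "f \<otimes>\<^sub>a g \<in> hom C (Dom C f \<otimes> Dom C g) (Cod C f \<otimes> Cod C g)"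
    using PiE_mem [OF PiE_mem [OF tensa_type assms(1)] assms(2)] .
  then show "f \<otimes>\<^sub>a g \<in> Arr C" "Dom C (f \<otimes>\<^sub>a g) = Dom C f \<otimes> Dom C g"
    "Cod C (f \<otimes>\<^sub>a g) = Cod C f \<otimes> Cod C g"
    by (auto simp: hom_def)
qed

lemma tensa_ide [simp]: "\<lbrakk>x \<in> Obj C; y \<in> Obj C\<rbrakk> \<Longrightarrow> ide x \<otimes>\<^sub>a ide y = ide (x \<otimes> y)"
  by (rule tensa_Ide)

lemma tensa_comp:
  "\<lbrakk>f \<in> Arr C; g \<in> Arr C; f' \<in> Arr C; g' \<in> Arr C; Cod C f = Dom C g; Cod C f' = Dom C g'\<rbrakk>
    \<Longrightarrow> (g \<otimes>\<^sub>a g') \<bullet> (f \<otimes>\<^sub>a f') = (g \<bullet> f) \<otimes>\<^sub>a (g' \<bullet> f')"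
  by (rule tensa_Comp [symmetric])

lemma tensa_comp_assoc:
  assumes "f \<in> Arr C" "g \<in> Arr C" "f' \<in> Arr C" "g' \<in> Arr C" "Cod C f = Dom C g" "Cod C f' = Dom C g'"
    "h \<in> Arr C" "Cod C h = Dom C f \<otimes> Dom C f'"
  shows "(g \<otimes>\<^sub>a g') \<bullet> ((f \<otimes>\<^sub>a f') \<bullet> h) = ((g \<bullet> f) \<otimes>\<^sub>a (g' \<bullet> f')) \<bullet> h"
proof -
  have "(g \<otimes>\<^sub>a g') \<bullet> ((f \<otimes>\<^sub>a f') \<bullet> h) = ((g \<otimes>\<^sub>a g') \<bullet> (f \<otimes>\<^sub>a f')) \<bullet> h"
    using assms by (subst comp_assoc) simp_all
  then show ?thesis using assms by (simp add: tensa_comp)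
qed

lemma sq_tensa:
  assumes "sq u v f g" "sq u' v' f' g'"
  shows "sq (u \<otimes>\<^sub>a u') (v \<otimes>\<^sub>a v') (f \<otimes>\<^sub>a f') (g \<otimes>\<^sub>a g')"
  using sqD [OF assms(1)] sqD [OF assms(2)] by (intro sqI) (simp_all add: tensa_comp)

end

context unital_bifunctor
begin

lemma unit_Obj [simp]: "\<one> \<in> Obj C"
  by (rule unit_type)

lemma l_arr [simp]:
  assumes "x \<in> Obj C"
  shows "l x \<in> Arr C" "Dom C (l x) = \<one> \<otimes> x" "Cod C (l x) = x"
  using iso_hom_arrD [OF PiE_mem [OF l_type assms]] .

lemma r_arr [simp]:
  assumes "x \<in> Obj C"
  shows "r x \<in> Arr C" "Dom C (r x) = x \<otimes> \<one>" "Cod C (r x) = x"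
  using iso_hom_arrD [OF PiE_mem [OF r_type assms]] .

lemma sq_l: "f \<in> Arr C \<Longrightarrow> sq (l (Dom C f)) (l (Cod C f)) (ide \<one> \<otimes>\<^sub>a f) f"
  by (rule sqI) (simp_all add: l_natural)

lemma sq_r: "f \<in> Arr C \<Longrightarrow> sq (r (Dom C f)) (r (Cod C f)) (f \<otimes>\<^sub>a ide \<one>) f"
  by (rule sqI) (simp_all add: r_natural)

end

lemma (in monoidal_category) a_arr [simp]:
  assumes "x \<in> Obj C" "y \<in> Obj C" "z \<in> Obj C"
  shows "a x y z \<in> Arr C" "Dom C (a x y z) = x \<otimes> (y \<otimes> z)" "Cod C (a x y z) = (x \<otimes> y) \<otimes> z"
  using iso_hom_arrD [OF PiE_mem [OF PiE_mem [OF PiE_mem [OF a_type assms(1)] assms(2)] assms(3)]] .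

lemma (in monoidal_category) sq_a:
  "\<lbrakk>f \<in> Arr C; g \<in> Arr C; h \<in> Arr C\<rbrakk> \<Longrightarrow>
    sq (f \<otimes>\<^sub>a (g \<otimes>\<^sub>a h)) ((f \<otimes>\<^sub>a g) \<otimes>\<^sub>a h)
      (a (Dom C f) (Dom C g) (Dom C h)) (a (Cod C f) (Cod C g) (Cod C h))"
  by (rule sqI) (simp_all add: a_natural)

locale unital_groupoid = groupoid C + unital_bifunctor C tens tensa unit l r
  for C :: "('o, 'm) cat" (structure)
    and tens (infixl "\<otimes>" 70) and tensa (infixl "\<otimes>\<^sub>a" 70) and unit ("\<one>") and l and r
begin

lemma unit_tens_faithful:
  assumes "ide \<one> \<otimes>\<^sub>a f = ide \<one> \<otimes>\<^sub>a g" "f \<in> Arr C" "g \<in> Arr C"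
    "Dom C f = Dom C g" "Cod C f = Cod C g"
  shows "f = g"
  using sq_bottom_unique sq_l assms by metis

lemma tens_unit_faithful:
  assumes "f \<otimes>\<^sub>a ide \<one> = g \<otimes>\<^sub>a ide \<one>" "f \<in> Arr C" "g \<in> Arr C"
    "Dom C f = Dom C g" "Cod C f = Cod C g"
  shows "f = g"
  using sq_bottom_unique sq_r assms by metis

lemma inv_tensa:
  assumes "f \<in> Arr C" "g \<in> Arr C"
  shows "arr_inv C (f \<otimes>\<^sub>a g) = arr_inv C f \<otimes>\<^sub>a arr_inv C g"
  by (rule inv_unique) (use assms in \<open>simp_all add: tensa_comp\<close>)

lemma inv_ide [simp]: "x \<in> Obj C \<Longrightarrow> arr_inv C (ide x) = ide x"
  by (rule inv_unique) simp_all

end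

section \<open>The Cayley representation of a monoidal groupoid\<close>

text \<open>
  Bracketed formal sums. A formal zero is kept apart from a leaf whose object happens to be the unit,
  so that the positions of the zeros can be read off from the shape.
\<close>

datatype 'o sumtree = Zero | At 'o | Sum "'o sumtree" "'o sumtree"

primrec leaves :: "'o sumtree \<Rightarrow> 'o list" where
  "leaves Zero = []"
| "leaves (At x) = [x]"
| "leaves (Sum S T) = leaves S @ leaves T"

context unital_bifunctor
begin

primrec ob :: "'o sumtree \<Rightarrow> 'o" where
  "ob Zero = \<one>"
| "ob (At x) = x"
| "ob (Sum S T) = ob S \<otimes> ob T"

definition tree :: "'o sumtree \<Rightarrow> bool" where
  "tree S \<longleftrightarrow> set (leaves S) \<subseteq> Obj C"

lemma tree_simps [simp]:
  "tree Zero" "tree (At x) \<longleftrightarrow> x \<in> Obj C" "tree (Sum S T) \<longleftrightarrow> tree S \<and> tree T"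
  by (auto simp: tree_def)

lemma ob_Obj [simp]: "tree S \<Longrightarrow> ob S \<in> Obj C"
  by (induction S) auto

end

locale monoidal_groupoid =
  unital_groupoid C tens tensa unit l r + monoidal_category C tens tensa unit l r a
  for C :: "('o, 'm) cat" (structure)
    and tens (infixl "\<otimes>" 70) and tensa (infixl "\<otimes>\<^sub>a" 70) and unit ("\<one>") and l and r and a
begin

text \<open>
  Kelly's argument: two sides of the pentagon for \<open>\<one>\<close>, \<open>\<one>\<close>, \<open>x\<close>, \<open>y\<close> are rewritten by the triangle, and
  tensoring with \<open>\<one>\<close> is faithful.
\<close>

lemma l_tensor:
  assumes [simp]: "x \<in> Obj C" "y \<in> Obj C"
  shows "(l x \<otimes>\<^sub>a ide y) \<bullet> a \<one> x y = l (x \<otimes> y)"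
proof -
  have "a \<one> x y \<bullet> (ide \<one> \<otimes>\<^sub>a ((l x \<otimes>\<^sub>a ide y) \<bullet> a \<one> x y))
      = (a \<one> x y \<bullet> (ide \<one> \<otimes>\<^sub>a (l x \<otimes>\<^sub>a ide y))) \<bullet> (ide \<one> \<otimes>\<^sub>a a \<one> x y)"
    by (simp add: tensa_comp)
  also have "\<dots> = (((ide \<one> \<otimes>\<^sub>a l x) \<otimes>\<^sub>a ide y) \<bullet> a \<one> (\<one> \<otimes> x) y) \<bullet> (ide \<one> \<otimes>\<^sub>a a \<one> x y)"
    using a_natural [of "ide \<one>" "l x" "ide y"] by simp
  also have "\<dots> = ((r \<one> \<otimes>\<^sub>a ide x) \<otimes>\<^sub>a ide y) \<bullet> (a (\<one> \<otimes> \<one>) x y \<bullet> a \<one> \<one> (x \<otimes> y))"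
    unfolding pentagon [OF unit_Obj unit_Obj assms]
    by (simp add: tensa_comp_assoc triangle)
  also have "\<dots> = (((r \<one> \<otimes>\<^sub>a ide x) \<otimes>\<^sub>a ide y) \<bullet> a (\<one> \<otimes> \<one>) x y) \<bullet> a \<one> \<one> (x \<otimes> y)"
    by simp
  also have "\<dots> = (a \<one> x y \<bullet> (r \<one> \<otimes>\<^sub>a ide (x \<otimes> y))) \<bullet> a \<one> \<one> (x \<otimes> y)"
    using a_natural [of "r \<one>" "ide x" "ide y"] by simp
  also have "\<dots> = a \<one> x y \<bullet> (ide \<one> \<otimes>\<^sub>a l (x \<otimes> y))"
    by (simp add: triangle)
  finally have "ide \<one> \<otimes>\<^sub>a ((l x \<otimes>\<^sub>a ide y) \<bullet> a \<one> x y) = ide \<one> \<otimes>\<^sub>a l (x \<otimes> y)"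
    by (rule left_cancel) simp_all
  then show ?thesis
    by (rule unit_tens_faithful) simp_all
qed

text \<open>
  Lists of objects act on objects by iterated left multiplication. This makes the tensor product
  strict: the action of \<open>L @ M\<close> is the composite of the actions of \<open>L\<close> and of \<open>M\<close>.
\<close>

abbreviation stack :: "'o list \<Rightarrow> 'o \<Rightarrow> 'o" where
  "stack L w \<equiv> foldr (\<otimes>) L w"

abbreviation stacka :: "'o list \<Rightarrow> 'm \<Rightarrow> 'm" where
  "stacka L h \<equiv> foldr (\<lambda>x. (\<otimes>\<^sub>a) (ide x)) L h"

lemma stack_Obj [simp]: "\<lbrakk>set L \<subseteq> Obj C; w \<in> Obj C\<rbrakk> \<Longrightarrow> stack L w \<in> Obj C"
  by (induction L) auto

lemma stack_tree_Obj [simp]: "\<lbrakk>tree S; w \<in> Obj C\<rbrakk> \<Longrightarrow> stack (leaves S) w \<in> Obj C"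
  by (simp add: tree_def)

lemma stacka_arr [simp]:
  assumes "set L \<subseteq> Obj C" "h \<in> Arr C"
  shows "stacka L h \<in> Arr C" "Dom C (stacka L h) = stack L (Dom C h)"
    "Cod C (stacka L h) = stack L (Cod C h)"
  using assms by (induction L) auto

lemma stacka_ide [simp]: "\<lbrakk>set L \<subseteq> Obj C; w \<in> Obj C\<rbrakk> \<Longrightarrow> stacka L (ide w) = ide (stack L w)"
  by (induction L) auto

lemma stacka_comp:
  "\<lbrakk>set L \<subseteq> Obj C; g \<in> Arr C; h \<in> Arr C; Cod C h = Dom C g\<rbrakk>
    \<Longrightarrow> stacka L (g \<bullet> h) = stacka L g \<bullet> stacka L h"
  by (induction L) (auto simp: tensa_comp)

text \<open>
  The strict action of the leaves of \<open>S\<close> is isomorphic to tensoring with the object \<open>ob S\<close>.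
\<close>

primrec unstack :: "'o sumtree \<Rightarrow> 'o \<Rightarrow> 'm" where
  "unstack Zero w = arr_inv C (l w)"
| "unstack (At x) w = ide (x \<otimes> w)"
| "unstack (Sum S T) w =
    a (ob S) (ob T) w \<bullet> (ide (ob S) \<otimes>\<^sub>a unstack T w) \<bullet> unstack S (stack (leaves T) w)"

lemma unstack_arr [simp]:
  assumes "tree S" "w \<in> Obj C"
  shows "unstack S w \<in> Arr C" "Dom C (unstack S w) = stack (leaves S) w"
    "Cod C (unstack S w) = ob S \<otimes> w"
proof -
  have "tree S \<longrightarrow> (\<forall>w\<in>Obj C. unstack S w \<in> Arr C \<and> Dom C (unstack S w) = stack (leaves S) w \<and>
      Cod C (unstack S w) = ob S \<otimes> w)"
    by (induction S) auto
  then show "unstack S w \<in> Arr C" "Dom C (unstack S w) = stack (leaves S) w"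
    "Cod C (unstack S w) = ob S \<otimes> w"
    using assms by auto
qed

lemma sq_unstack:
  assumes "tree S" "h \<in> Arr C"
  shows "sq (unstack S (Dom C h)) (unstack S (Cod C h)) (stacka (leaves S) h) (ide (ob S) \<otimes>\<^sub>a h)"
  using assms
proof (induction S arbitrary: h)
  case Zero
  then show ?case using sq_transpose [OF sq_inv [OF sq_transpose [OF sq_l]]] by simp
next
  case (At x)
  then show ?case using sq_ide_vertical [of "ide x \<otimes>\<^sub>a h"] by simp
next
  case (Sum S T)
  have [simp]: "tree S" "tree T" "h \<in> Arr C" "set (leaves T) \<subseteq> Obj C"
    using Sum.prems by (auto simp: tree_def)
  show ?case
    using sq_stack [OF sq_stack [OF Sum.IH(1) [of "stacka (leaves T) h"]
          sq_tensa [OF sq_ide_vertical [of "ide (ob S)"] Sum.IH(2) [of h]]]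
        sq_transpose [OF sq_a [of "ide (ob S)" "ide (ob T)" h]]]
    by simp
qed

text \<open>
  The Cayley representation of \<open>f\<close>: its translates \<open>f \<otimes> w\<close>, transported to the strict actions of the
  leaves. Associators and unitors are represented by identities, and \<open>f\<close> can be recovered from its
  value at \<open>w = \<one>\<close>.
\<close>

definition cayley :: "'o sumtree \<Rightarrow> 'o sumtree \<Rightarrow> 'm \<Rightarrow> ('o \<Rightarrow> 'm) \<Rightarrow> bool" where
  "cayley S T f g \<longleftrightarrow> tree S \<and> tree T \<and> f \<in> hom C (ob S) (ob T) \<and>
    (\<forall>w\<in>Obj C. sq (unstack S w) (unstack T w) (g w) (f \<otimes>\<^sub>a ide w))"

lemma cayleyI:
  assumes "tree S" "tree T" "f \<in> Arr C" "Dom C f = ob S" "Cod C f = ob T"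
    "\<And>w. w \<in> Obj C \<Longrightarrow> sq (unstack S w) (unstack T w) (g w) (f \<otimes>\<^sub>a ide w)"
  shows "cayley S T f g"
  using assms by (auto simp: cayley_def)

lemma cayleyD:
  assumes "cayley S T f g"
  shows "tree S" "tree T" "f \<in> Arr C" "Dom C f = ob S" "Cod C f = ob T"
    "\<And>w. w \<in> Obj C \<Longrightarrow> sq (unstack S w) (unstack T w) (g w) (f \<otimes>\<^sub>a ide w)"
  using assms by (auto simp: cayley_def hom_def)

lemma cayley_arr:
  assumes "cayley S T f g" "w \<in> Obj C"
  shows "g w \<in> Arr C" "Dom C (g w) = stack (leaves S) w" "Cod C (g w) = stack (leaves T) w"
  using sqD(3,5,6) [OF cayleyD(6) [OF assms]] cayleyD(1,2) [OF assms(1)] assms(2) by simp_all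

lemma cayley_inj:
  assumes "cayley S T f g" "cayley S T f' g'" "g \<one> = g' \<one>"
  shows "f = f'"
proof (rule tens_unit_faithful)
  show "f \<otimes>\<^sub>a ide \<one> = f' \<otimes>\<^sub>a ide \<one>"
    using sq_bottom_unique cayleyD(6) [OF assms(1) unit_Obj] cayleyD(6) [OF assms(2) unit_Obj]
      assms(3) by metis
qed (use cayleyD [OF assms(1)] cayleyD [OF assms(2)] in simp_all)

lemma cayley_unique:
  assumes "cayley S T f g" "cayley S T f g'" "w \<in> Obj C"
  shows "g w = g' w"
  using sq_top_unique cayleyD(6) assms by metis

lemma cayley_exists:
  assumes [simp]: "tree S" "tree T" and "f \<in> hom C (ob S) (ob T)"
  shows "cayley S T f (\<lambda>w. arr_inv C (unstack T w) \<bullet> (f \<otimes>\<^sub>a ide w) \<bullet> unstack S w)"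
  using hom_arrD [OF assms(3)] by (intro cayleyI sqI) simp_all

lemma cayley_cong:
  assumes "cayley S T f g" "\<And>w. w \<in> Obj C \<Longrightarrow> g w = g' w"
  shows "cayley S T f g'"
  using assms by (simp add: cayley_def)

lemma cayley_subst:
  assumes "cayley S T f g" "f = f'" "\<And>w. w \<in> Obj C \<Longrightarrow> g w = g' w"
  shows "cayley S T f' g'"
  using assms by (simp add: cayley_def)

lemma cayley_ide: "tree S \<Longrightarrow> cayley S S (ide (ob S)) (\<lambda>w. ide (stack (leaves S) w))"
  by (intro cayleyI sqI) simp_all

lemma cayley_comp:
  assumes "cayley S T f g" "cayley T U f' g'"
  shows "cayley S U (f' \<bullet> f) (\<lambda>w. g' w \<bullet> g w)"
proof (rule cayleyI)
  note [simp] = cayleyD(1-5) [OF assms(1)] cayleyD(1-5) [OF assms(2)]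
  fix w assume w: "w \<in> Obj C"
  then show "sq (unstack S w) (unstack U w) (g' w \<bullet> g w) ((f' \<bullet> f) \<otimes>\<^sub>a ide w)"
    using sq_comp [OF cayleyD(6) [OF assms(1) w] cayleyD(6) [OF assms(2) w]]
    by (simp add: tensa_comp)
qed (use cayleyD [OF assms(1)] cayleyD [OF assms(2)] in simp_all)

lemma cayley_inv:
  assumes "cayley S T f g"
  shows "cayley T S (arr_inv C f) (\<lambda>w. arr_inv C (g w))"
proof (rule cayleyI)
  note [simp] = cayleyD(1-5) [OF assms(1)]
  fix w assume w: "w \<in> Obj C"
  then show "sq (unstack T w) (unstack S w) (arr_inv C (g w)) (arr_inv C f \<otimes>\<^sub>a ide w)"
    using sq_inv [OF cayleyD(6) [OF assms(1) w]] by (simp add: inv_tensa)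
qed (use cayleyD [OF assms(1)] in simp_all)

text \<open>
  The factors act one after the other: \<open>f'\<close> under the leaves of \<open>S\<close>, then \<open>f\<close> above the new leaves.
\<close>

lemma cayley_tensor:
  assumes "cayley S T f g" "cayley S' T' f' g'"
  shows "cayley (Sum S S') (Sum T T') (f \<otimes>\<^sub>a f')
    (\<lambda>w. g (stack (leaves T') w) \<bullet> stacka (leaves S) (g' w))"
proof (rule cayleyI)
  note [simp] = cayleyD(1-5) [OF assms(1)] cayleyD(1-5) [OF assms(2)]
  fix w assume [simp]: "w \<in> Obj C"
  note [simp] = cayley_arr [OF assms(2)]
  let ?w = "stack (leaves S') w" and ?w' = "stack (leaves T') w"
  have "sq (unstack S ?w) (unstack T ?w') (g ?w' \<bullet> stacka (leaves S) (g' w))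
      ((f \<otimes>\<^sub>a ide ?w') \<bullet> (ide (ob S) \<otimes>\<^sub>a g' w))"
    using sq_comp [OF sq_unstack [of S "g' w"]] cayleyD(6) [OF assms(1), of ?w'] by simp
  then have 1: "sq (unstack S ?w) (unstack T ?w') (g ?w' \<bullet> stacka (leaves S) (g' w)) (f \<otimes>\<^sub>a g' w)"
    by (simp add: tensa_comp)
  have 2: "sq (ide (ob S) \<otimes>\<^sub>a unstack S' w) (ide (ob T) \<otimes>\<^sub>a unstack T' w)
      (f \<otimes>\<^sub>a g' w) (f \<otimes>\<^sub>a (f' \<otimes>\<^sub>a ide w))"
    using sq_tensa [OF sq_ide_vertical [of f] cayleyD(6) [OF assms(2), of w]] by simp
  show "sq (unstack (Sum S S') w) (unstack (Sum T T') w)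
      (g ?w' \<bullet> stacka (leaves S) (g' w)) ((f \<otimes>\<^sub>a f') \<otimes>\<^sub>a ide w)"
    using sq_stack [OF sq_stack [OF 1 2] sq_transpose [OF sq_a [of f f' "ide w"]]] by simp
qed (use cayleyD [OF assms(1)] cayleyD [OF assms(2)] in simp_all)

text \<open>
  Comparing the two ways of stacking \<open>S\<close>, \<open>T\<close>, \<open>U\<close> on \<open>w\<close> is the pentagon.
\<close>

lemma cayley_a:
  assumes [simp]: "tree S" "tree T" "tree U"
  shows "cayley (Sum S (Sum T U)) (Sum (Sum S T) U) (a (ob S) (ob T) (ob U))
    (\<lambda>w. ide (stack (leaves S @ leaves T @ leaves U) w))"
proof (intro cayleyI sqI)
  fix w assume [simp]: "w \<in> Obj C"
  let ?w = "stack (leaves U) w" and ?v = "stack (leaves T) (stack (leaves U) w)"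
  let ?s = "ob S" and ?t = "ob T" and ?u = "ob U"
  have "(a ?s ?t ?u \<otimes>\<^sub>a ide w) \<bullet> unstack (Sum S (Sum T U)) w
      = ((a ?s ?t ?u \<otimes>\<^sub>a ide w) \<bullet> a ?s (?t \<otimes> ?u) w \<bullet> (ide ?s \<otimes>\<^sub>a a ?t ?u w)) \<bullet>
        (ide ?s \<otimes>\<^sub>a (ide ?t \<otimes>\<^sub>a unstack U w)) \<bullet> (ide ?s \<otimes>\<^sub>a unstack T ?w) \<bullet> unstack S ?v"
    by (simp add: tensa_comp tensa_comp_assoc)
  also have "\<dots> = a (?s \<otimes> ?t) ?u w \<bullet>
      (a ?s ?t (?u \<otimes> w) \<bullet> (ide ?s \<otimes>\<^sub>a (ide ?t \<otimes>\<^sub>a unstack U w))) \<bullet>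
      (ide ?s \<otimes>\<^sub>a unstack T ?w) \<bullet> unstack S ?v"
    unfolding pentagon [OF ob_Obj [OF assms(1)] ob_Obj [OF assms(2)] ob_Obj [OF assms(3)]
        \<open>w \<in> Obj C\<close>, symmetric]
    by simp
  also have "\<dots> = unstack (Sum (Sum S T) U) w"
    using a_natural [of "ide ?s" "ide ?t" "unstack U w"] by simp
  finally show "unstack (Sum (Sum S T) U) w \<bullet> ide (stack (leaves S @ leaves T @ leaves U) w) =
      (a ?s ?t ?u \<otimes>\<^sub>a ide w) \<bullet> unstack (Sum S (Sum T U)) w"
    by simp
qed simp_all

lemma cayley_l:
  assumes [simp]: "tree S"
  shows "cayley (Sum Zero S) S (l (ob S)) (\<lambda>w. ide (stack (leaves S) w))"
proof (intro cayleyI sqI)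
  fix w assume [simp]: "w \<in> Obj C"
  have "(l (ob S) \<otimes>\<^sub>a ide w) \<bullet> unstack (Sum Zero S) w
      = ((l (ob S) \<otimes>\<^sub>a ide w) \<bullet> a \<one> (ob S) w) \<bullet> (ide \<one> \<otimes>\<^sub>a unstack S w) \<bullet>
        arr_inv C (l (stack (leaves S) w))"
    by simp
  also have "\<dots> = (l (ob S \<otimes> w) \<bullet> (ide \<one> \<otimes>\<^sub>a unstack S w)) \<bullet> arr_inv C (l (stack (leaves S) w))"
    by (simp add: l_tensor)
  also have "\<dots> = unstack S w"
    using l_natural [of "unstack S w"] by simp
  finally show "unstack S w \<bullet> ide (stack (leaves S) w) =
      (l (ob S) \<otimes>\<^sub>a ide w) \<bullet> unstack (Sum Zero S) w"
    by simp
qed simp_all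

lemma cayley_r:
  assumes [simp]: "tree S"
  shows "cayley (Sum S Zero) S (r (ob S)) (\<lambda>w. ide (stack (leaves S) w))"
proof (intro cayleyI sqI)
  fix w assume [simp]: "w \<in> Obj C"
  have "(r (ob S) \<otimes>\<^sub>a ide w) \<bullet> unstack (Sum S Zero) w
      = ((r (ob S) \<otimes>\<^sub>a ide w) \<bullet> a (ob S) \<one> w) \<bullet> (ide (ob S) \<otimes>\<^sub>a arr_inv C (l w)) \<bullet> unstack S w"
    by simp
  also have "\<dots> = unstack S w"
    by (simp add: triangle tensa_comp_assoc)
  finally show "unstack S w \<bullet> ide (stack (leaves S) w) =
      (r (ob S) \<otimes>\<^sub>a ide w) \<bullet> unstack (Sum S Zero) w"
    by simp
qed simp_all

end

section \<open>Coherence for symmetric 2-groups\<close>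

sublocale pre_two_group \<subseteq> unital_groupoid C plus plusa zero l r ..

sublocale symmetric_two_group \<subseteq> monoidal_groupoid C plus plusa zero l r a ..

fun exchange :: "nat \<Rightarrow> 'a list \<Rightarrow> 'a list" where
  "exchange 0 (x # y # L) = y # x # L"
| "exchange (Suc i) (x # L) = x # exchange i L"
| "exchange i L = L"

text \<open>
  A list of positions stands for a product of adjacent transpositions, performed from left to right.
  Positions beyond the end of the list do nothing.
\<close>

primrec permute :: "nat list \<Rightarrow> 'a list \<Rightarrow> 'a list" where
  "permute [] L = L"
| "permute (i # ws) L = permute ws (exchange i L)"

text \<open>
  The Coxeter presentation of the symmetric group on \<open>n\<close> letters. The braid relation carries a bound
  because it fails when \<open>i\<close> is within range but \<open>Suc i\<close> is not: one side is then the transposition,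
  the other the identity.
\<close>

inductive coxeter :: "nat \<Rightarrow> nat list \<Rightarrow> nat list \<Rightarrow> bool" for n where
  coxeter_refl: "coxeter n ws ws"
| coxeter_sym: "coxeter n ws ws' \<Longrightarrow> coxeter n ws' ws"
| coxeter_trans [trans]: "\<lbrakk>coxeter n ws ws'; coxeter n ws' ws''\<rbrakk> \<Longrightarrow> coxeter n ws ws''"
| coxeter_congruence: "coxeter n ws ws' \<Longrightarrow> coxeter n (us @ ws @ vs) (us @ ws' @ vs)"
| coxeter_involution: "coxeter n [i, i] []"
| coxeter_commutation: "i + 2 \<le> j \<Longrightarrow> coxeter n [i, j] [j, i]"
| coxeter_braid: "i + 2 < n \<Longrightarrow> coxeter n [i, Suc i, i] [Suc i, i, Suc i]"

lemma length_exchange [simp]: "length (exchange i L) = length L"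
  by (induction i L rule: exchange.induct) auto

lemma set_exchange [simp]: "set (exchange i L) = set L"
  by (induction i L rule: exchange.induct) auto

lemma exchange_exchange [simp]: "exchange i (exchange i L) = L"
  by (induction i L rule: exchange.induct) auto

lemma length_permute [simp]: "length (permute ws L) = length L"
  by (induction ws arbitrary: L) auto

lemma set_permute [simp]: "set (permute ws L) = set L"
  by (induction ws arbitrary: L) auto

lemma permute_append [simp]: "permute (us @ vs) L = permute vs (permute us L)"
  by (induction us arbitrary: L) auto

lemma permute_rev [simp]: "permute (rev ws) (permute ws L) = L"
  by (induction ws arbitrary: L) auto

lemma exchange_append_left: "Suc i < length L \<Longrightarrow> exchange i (L @ M) = exchange i L @ M"
  by (induction i L rule: exchange.induct) auto

lemma exchange_append_right: "exchange (length L + i) (L @ M) = L @ exchange i M"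
  by (induction L) auto

lemma permute_append_left:
  "\<forall>i\<in>set ws. Suc i < length L \<Longrightarrow> permute ws (L @ M) = permute ws L @ M"
  by (induction ws arbitrary: L) (auto simp: exchange_append_left)

lemma permute_append_right:
  "permute (map ((+) (length L)) ws) (L @ M) = L @ permute ws M"
  by (induction ws arbitrary: M) (auto simp: exchange_append_right)

lemma exchange_commute: "i + 2 \<le> j \<Longrightarrow> exchange i (exchange j L) = exchange j (exchange i L)"
proof (induction i L arbitrary: j rule: exchange.induct)
  case (1 x y L)
  then obtain k where "j = Suc (Suc k)" by (metis add_2_eq_Suc le_Suc_ex plus_nat.add_0)
  then show ?case by simp
next
  case (2 i x L)
  then obtain k where "j = Suc k" "i + 2 \<le> k" by (cases j) auto
  then show ?case using 2 by simp
next
  case ("3_2" v)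
  then show ?case by (cases j) auto
next
  case ("3_3" v)
  then obtain k where "j = Suc (Suc k)" by (metis add_2_eq_Suc le_Suc_ex plus_nat.add_0)
  then show ?case by simp
qed auto

lemma exchange_braid:
  "i + 2 < length L \<Longrightarrow>
    exchange i (exchange (Suc i) (exchange i L)) =
    exchange (Suc i) (exchange i (exchange (Suc i) L))"
proof (induction i arbitrary: L)
  case 0
  then obtain x y z M where "L = x # y # z # M"
    by (auto simp: Suc_le_length_iff numeral_2_eq_2 Suc_le_eq [symmetric])
  then show ?case by simp
next
  case (Suc i)
  then show ?case by (cases L) auto
qed

context symmetric_two_group
begin

lemma c_arr [simp]:
  assumes "x \<in> Obj C" "y \<in> Obj C"
  shows "c x y \<in> Arr C" "Dom C (c x y) = x \<oplus> y" "Cod C (c x y) = y \<oplus> x"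
  using iso_hom_arrD [OF PiE_mem [OF PiE_mem [OF c_type assms(1)] assms(2)]] .

lemma sq_c: "\<lbrakk>f \<in> Arr C; g \<in> Arr C\<rbrakk> \<Longrightarrow>
    sq (f \<oplus>\<^sub>a g) (g \<oplus>\<^sub>a f) (c (Dom C f) (Dom C g)) (c (Cod C f) (Cod C g))"
  by (rule sqI) (simp_all add: c_natural)

lemma inv_c: "\<lbrakk>x \<in> Obj C; y \<in> Obj C\<rbrakk> \<Longrightarrow> arr_inv C (c x y) = c y x"
  by (rule inv_unique) (simp_all add: symmetry)

lemma c_sum_left:
  assumes [simp]: "x \<in> Obj C" "y \<in> Obj C" "z \<in> Obj C"
  shows "c (x \<oplus> y) z = arr_inv C (a z x y) \<bullet> (c x z \<oplus>\<^sub>a ide y) \<bullet> a x z y \<bullet>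
    (ide x \<oplus>\<^sub>a c y z) \<bullet> arr_inv C (a x y z)"
proof -
  have "c (x \<oplus> y) z = arr_inv C (a z x y) \<bullet> (a z x y \<bullet> c (x \<oplus> y) z \<bullet> a x y z) \<bullet> arr_inv C (a x y z)"
    by simp
  then show ?thesis unfolding hexagon [OF assms] by simp
qed

text \<open>
  Cayley images are natural in \<open>w\<close>, as translates are; this is why exchanges at distant positions
  commute.
\<close>

lemma cayley_natural:
  assumes "cayley S T f g" and [simp]: "h \<in> Arr C"
  shows "g (Cod C h) \<bullet> stacka (leaves S) h = stacka (leaves T) h \<bullet> g (Dom C h)"
proof (rule sq_top_unique)
  note [simp] = cayleyD(1-5) [OF assms(1)]
  show "sq (unstack S (Dom C h)) (unstack T (Cod C h)) (g (Cod C h) \<bullet> stacka (leaves S) h) (f \<oplus>\<^sub>a h)"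
    using sq_comp [OF sq_unstack [of S h] cayleyD(6) [OF assms(1), of "Cod C h"]]
    by (simp add: tensa_comp)
  show "sq (unstack S (Dom C h)) (unstack T (Cod C h)) (stacka (leaves T) h \<bullet> g (Dom C h)) (f \<oplus>\<^sub>a h)"
    using sq_comp [OF cayleyD(6) [OF assms(1), of "Dom C h"] sq_unstack [of T h]]
    by (simp add: tensa_comp)
qed

text \<open>
  The Cayley image of a commutator of two leaves.
\<close>

definition swap :: "'o \<Rightarrow> 'o \<Rightarrow> 'o \<Rightarrow> 'm" where
  "swap x y w = arr_inv C (a y x w) \<bullet> (c x y \<oplus>\<^sub>a ide w) \<bullet> a x y w"

lemma swap_arr [simp]:
  assumes "x \<in> Obj C" "y \<in> Obj C" "w \<in> Obj C"
  shows "swap x y w \<in> Arr C" "Dom C (swap x y w) = x \<oplus> (y \<oplus> w)"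
    "Cod C (swap x y w) = y \<oplus> (x \<oplus> w)"
  using assms by (auto simp: swap_def)

lemma cayley_c_At:
  assumes [simp]: "x \<in> Obj C" "y \<in> Obj C"
  shows "cayley (Sum (At x) (At y)) (Sum (At y) (At x)) (c x y) (swap x y)"
  by (intro cayleyI sqI) (simp_all add: swap_def)

fun swap_at :: "nat \<Rightarrow> 'o list \<Rightarrow> 'o \<Rightarrow> 'm" where
  "swap_at 0 (x # y # L) w = swap x y (stack L w)"
| "swap_at (Suc i) (x # L) w = ide x \<oplus>\<^sub>a swap_at i L w"
| "swap_at i L w = ide (stack L w)"

primrec path :: "nat list \<Rightarrow> 'o list \<Rightarrow> 'o \<Rightarrow> 'm" where
  "path [] L w = ide (stack L w)"
| "path (i # ws) L w = path ws (exchange i L) w \<bullet> swap_at i L w"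

lemma swap_at_arr [simp]:
  assumes "set L \<subseteq> Obj C" "w \<in> Obj C"
  shows "swap_at i L w \<in> Arr C" "Dom C (swap_at i L w) = stack L w"
    "Cod C (swap_at i L w) = stack (exchange i L) w"
  using assms by (induction i L w rule: swap_at.induct) auto

lemma path_arr [simp]:
  assumes "set L \<subseteq> Obj C" "w \<in> Obj C"
  shows "path ws L w \<in> Arr C" "Dom C (path ws L w) = stack L w"
    "Cod C (path ws L w) = stack (permute ws L) w"
proof -
  have "set L \<subseteq> Obj C \<longrightarrow> path ws L w \<in> Arr C \<and> Dom C (path ws L w) = stack L w \<and>
      Cod C (path ws L w) = stack (permute ws L) w"
    using assms(2) by (induction ws arbitrary: L) auto
  then show "path ws L w \<in> Arr C" "Dom C (path ws L w) = stack L w"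
    "Cod C (path ws L w) = stack (permute ws L) w"
    using assms(1) by auto
qed

lemma path_append:
  "\<lbrakk>set L \<subseteq> Obj C; w \<in> Obj C\<rbrakk> \<Longrightarrow> path (us @ vs) L w = path vs (permute us L) w \<bullet> path us L w"
  by (induction us arbitrary: L) auto

lemma swap_at_append_left:
  "Suc i < length L \<Longrightarrow> swap_at i (L @ M) w = swap_at i L (stack M w)"
  by (induction i L w rule: swap_at.induct) auto

lemma swap_at_append_right: "swap_at (length L + i) (L @ M) w = stacka L (swap_at i M w)"
  by (induction L) auto

lemma path_append_left:
  "\<forall>i\<in>set ws. Suc i < length L \<Longrightarrow> path ws (L @ M) w = path ws L (stack M w)"
  by (induction ws arbitrary: L) (auto simp: swap_at_append_left exchange_append_left)

lemma path_append_right: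
  assumes "set L \<subseteq> Obj C" "set M \<subseteq> Obj C" "w \<in> Obj C"
  shows "path (map ((+) (length L)) ws) (L @ M) w = stacka L (path ws M w)"
  using assms(2)
proof (induction ws arbitrary: M)
  case Nil
  then show ?case using assms by simp
next
  case (Cons i ws)
  then show ?case using assms(1,3)
    by (simp add: swap_at_append_right exchange_append_right stacka_comp)
qed

lemma swap_involution:
  assumes [simp]: "x \<in> Obj C" "y \<in> Obj C" "w \<in> Obj C"
  shows "swap y x w \<bullet> swap x y w = ide (x \<oplus> (y \<oplus> w))"
  using cayley_unique [OF cayley_comp [OF cayley_c_At cayley_c_At], of x y
      "\<lambda>w. ide (x \<oplus> (y \<oplus> w))" w] cayley_ide [of "Sum (At x) (At y)"]
  by (simp add: symmetry)

lemma swap_at_involution: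
  "\<lbrakk>set L \<subseteq> Obj C; w \<in> Obj C\<rbrakk> \<Longrightarrow> swap_at i (exchange i L) w \<bullet> swap_at i L w = ide (stack L w)"
  by (induction i L w rule: swap_at.induct) (auto simp: swap_involution tensa_comp)

lemma swap_at_commute:
  "\<lbrakk>i + 2 \<le> j; set L \<subseteq> Obj C; w \<in> Obj C\<rbrakk> \<Longrightarrow>
    swap_at j (exchange i L) w \<bullet> swap_at i L w = swap_at i (exchange j L) w \<bullet> swap_at j L w"
proof (induction i L w arbitrary: j rule: swap_at.induct)
  case (1 x y L w)
  then obtain k where k: "j = Suc (Suc k)" by (metis add_2_eq_Suc le_Suc_ex plus_nat.add_0)
  have "x \<in> Obj C" "y \<in> Obj C" "set L \<subseteq> Obj C" "w \<in> Obj C"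
    using 1 by auto
  then show ?case
    using cayley_natural [OF cayley_c_At, of x y "swap_at k L w"] by (simp add: k)
next
  case (2 i x L w)
  then obtain k where "j = Suc k" "i + 2 \<le> k" by (cases j) auto
  then show ?case using 2 by (simp add: tensa_comp)
next
  case ("3_2" v)
  then show ?case by (cases j) auto
next
  case ("3_3" v)
  then obtain k where "j = Suc (Suc k)" by (metis add_2_eq_Suc le_Suc_ex plus_nat.add_0)
  then show ?case using "3_3" by simp
qed auto

lemma path_rev:
  assumes "set L \<subseteq> Obj C" "w \<in> Obj C"
  shows "path (rev ws) (permute ws L) w \<bullet> path ws L w = ide (stack L w)"
  using assms
proof (induction ws arbitrary: L)
  case (Cons i ws)
  have "path (rev (i # ws)) (permute (i # ws) L) w \<bullet> path (i # ws) L w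
      = swap_at i (exchange i L) w \<bullet>
        (path (rev ws) (permute ws (exchange i L)) w \<bullet> path ws (exchange i L) w) \<bullet> swap_at i L w"
    using Cons.prems by (simp add: path_append)
  then show ?case
    using Cons by (simp add: swap_at_involution)
qed simp

text \<open>
  An arrow between formal sums is represented by a word if its Cayley image performs the exchanges of
  the word. The bound on the positions lets the word keep its meaning when further summands are
  added on the right.
\<close>

definition represents :: "'o sumtree \<Rightarrow> 'o sumtree \<Rightarrow> 'm \<Rightarrow> nat list \<Rightarrow> bool" where
  "represents S T f ws \<longleftrightarrow> cayley S T f (path ws (leaves S)) \<and>
    (\<forall>i\<in>set ws. Suc i < length (leaves S)) \<and> permute ws (leaves S) = leaves T"

lemma representsD:
  assumes "represents S T f ws"
  shows "cayley S T f (path ws (leaves S))" "\<forall>i\<in>set ws. Suc i < length (leaves S)"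
    "permute ws (leaves S) = leaves T" "length (leaves T) = length (leaves S)"
    "tree S" "tree T" "f \<in> Arr C" "Dom C f = ob S" "Cod C f = ob T"
    "set (leaves S) \<subseteq> Obj C" "set (leaves T) \<subseteq> Obj C"
  using assms cayleyD(1-5) [of S T f "path ws (leaves S)"]
  unfolding represents_def by (auto simp: tree_def) (metis length_permute)

lemma path_Nil: "path [] L = (\<lambda>w. ide (stack L w))"
  by (rule ext) simp

lemma represents_ide: "tree S \<Longrightarrow> represents S S (ide (ob S)) []"
  using cayley_ide [of S] by (simp add: represents_def path_Nil del: path.simps)

lemma represents_comp:
  assumes "represents S T f ws" "represents T U g vs"
  shows "represents S U (g \<bullet> f) (ws @ vs)"
proof -
  note [simp] = representsD(2-) [OF assms(1)] representsD(2-) [OF assms(2)]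
  have "cayley S U (g \<bullet> f) (path (ws @ vs) (leaves S))"
    by (rule cayley_cong [OF cayley_comp [OF representsD(1) [OF assms(1)] representsD(1) [OF assms(2)]]])
      (simp add: path_append)
  then show ?thesis
    using representsD(2) [OF assms(1)] representsD(2) [OF assms(2)] by (auto simp: represents_def)
qed

lemma represents_inv:
  assumes "represents S T f ws"
  shows "represents T S (arr_inv C f) (rev ws)"
proof -
  note [simp] = representsD(2-) [OF assms]
  have "cayley T S (arr_inv C f) (path (rev ws) (leaves T))"
  proof (rule cayley_cong [OF cayley_inv [OF representsD(1) [OF assms]]])
    fix w assume "w \<in> Obj C"
    then show "arr_inv C (path ws (leaves S) w) = path (rev ws) (leaves T) w"
      using path_rev [of "leaves S" w ws] permute_rev [of ws "leaves S"]
      by (intro inv_unique) simp_all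
  qed
  then show ?thesis
    using permute_rev [of ws "leaves S"] representsD(2) [OF assms] by (auto simp: represents_def)
qed

lemma represents_sum:
  assumes "represents S T f ws" "represents S' T' f' ws'"
  shows "represents (Sum S S') (Sum T T') (f \<oplus>\<^sub>a f') (map ((+) (length (leaves S))) ws' @ ws)"
proof -
  note [simp] = representsD(3-) [OF assms(1)] representsD(3-) [OF assms(2)]
  have "cayley (Sum S S') (Sum T T') (f \<oplus>\<^sub>a f')
      (path (map ((+) (length (leaves S))) ws' @ ws) (leaves (Sum S S')))"
    by (rule cayley_cong [OF cayley_tensor [OF representsD(1) [OF assms(1)] representsD(1) [OF assms(2)]]])
      (use representsD(2) [OF assms(1)] in
        \<open>simp add: path_append permute_append_right path_append_right path_append_left
          del: foldr_append\<close>)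
  then show ?thesis
    using representsD(2) [OF assms(1)] representsD(2) [OF assms(2)]
    by (auto simp: represents_def permute_append_right permute_append_left)
qed

lemma represents_a:
  "\<lbrakk>tree S; tree T; tree U\<rbrakk> \<Longrightarrow>
    represents (Sum S (Sum T U)) (Sum (Sum S T) U) (a (ob S) (ob T) (ob U)) []"
  using cayley_a [of S T U] by (simp add: represents_def path_Nil del: path.simps)

lemma represents_l: "tree S \<Longrightarrow> represents (Sum Zero S) S (l (ob S)) []"
  using cayley_l [of S] by (simp add: represents_def path_Nil del: path.simps)

lemma represents_r: "tree S \<Longrightarrow> represents (Sum S Zero) S (r (ob S)) []"
  using cayley_r [of S] by (simp add: represents_def path_Nil del: path.simps)

lemma represents_c_At:
  assumes [simp]: "x \<in> Obj C" "y \<in> Obj C"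
  shows "represents (Sum (At x) (At y)) (Sum (At y) (At x)) (c x y) [0]"
proof -
  have "cayley (Sum (At x) (At y)) (Sum (At y) (At x)) (c x y) (path [0] [x, y])"
    by (rule cayley_cong [OF cayley_c_At]) simp_all
  then show ?thesis by (simp add: represents_def)
qed

lemma represents_c_sum:
  assumes "represents (Sum S U) (Sum U S) (c (ob S) (ob U)) ws"
    "represents (Sum T U) (Sum U T) (c (ob T) (ob U)) vs"
  shows "represents (Sum (Sum S T) U) (Sum U (Sum S T)) (c (ob (Sum S T)) (ob U))
    (map ((+) (length (leaves S))) vs @ ws)"
proof -
  have [simp]: "tree S" "tree T" "tree U"
    using representsD(5) [OF assms(1)] representsD(5) [OF assms(2)] by simp_all
  show ?thesis
    using represents_comp [OF represents_comp [OF represents_comp [OF represents_comp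
      [OF represents_inv [OF represents_a [of S T U]]
        represents_sum [OF represents_ide [of S] assms(2)]]
      represents_a [of S U T]] represents_sum [OF assms(1) represents_ide [of T]]]
      represents_inv [OF represents_a [of U S T]]]
    by (simp add: c_sum_left)
qed

lemma represents_c_flip:
  assumes "represents (Sum S T) (Sum T S) (c (ob S) (ob T)) ws"
  shows "represents (Sum T S) (Sum S T) (c (ob T) (ob S)) (rev ws)"
  using represents_inv [OF assms] representsD(5) [OF assms] by (simp add: inv_c)

text \<open>
  If \<open>g\<close> is the Cayley image of the commutator of \<open>\<zero>\<close> and \<open>T\<close>, then naturality along \<open>\<zero> + \<zero> \<rightarrow> \<zero>\<close>
  shows that \<open>g\<close> is also the image of the commutator of \<open>\<zero> + \<zero>\<close> and \<open>T\<close>, whereas the hexagon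
  shows that this image is \<open>g \<bullet> g\<close>. So \<open>g\<close> is an idempotent isomorphism.
\<close>

lemma represents_c_Zero:
  assumes [simp]: "tree T"
  shows "represents (Sum Zero T) (Sum T Zero) (c \<zero> (ob T)) []"
proof -
  let ?z = "ob T"
  have "\<exists>g. cayley (Sum Zero T) (Sum T Zero) (c \<zero> ?z) g"
    by (rule exI, rule cayley_exists) auto
  then obtain g where g: "cayley (Sum Zero T) (Sum T Zero) (c \<zero> ?z) g" ..
  have [simp]: "set (leaves T) \<subseteq> Obj C"
    using assms by (simp add: tree_def)
  have c00: "(ide ?z \<oplus>\<^sub>a arr_inv C (l \<zero>)) \<bullet> c \<zero> ?z \<bullet> (l \<zero> \<oplus>\<^sub>a ide ?z) = c (\<zero> \<oplus> \<zero>) ?z"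
    using c_natural [of "l \<zero>" "ide ?z"] by (simp add: tensa_comp_assoc)
  have 1: "cayley (Sum (Sum Zero Zero) T) (Sum T (Sum Zero Zero)) (c (\<zero> \<oplus> \<zero>) ?z) g"
    by (rule cayley_subst [OF cayley_comp [OF cayley_comp
            [OF cayley_tensor [OF cayley_l [of Zero] cayley_ide [of T]] g]
            cayley_tensor [OF cayley_ide [of T] cayley_inv [OF cayley_l [of Zero]]]]])
      (use cayley_arr [OF g] c00 in simp_all)
  have 2: "cayley (Sum (Sum Zero Zero) T) (Sum T (Sum Zero Zero)) (c (\<zero> \<oplus> \<zero>) ?z)
      (\<lambda>w. g w \<bullet> g w)"
    by (rule cayley_subst [OF cayley_comp [OF cayley_comp [OF cayley_comp [OF cayley_comp
            [OF cayley_inv [OF cayley_a [of Zero Zero T]]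
              cayley_tensor [OF cayley_ide [of Zero] g]]
            cayley_a [of Zero T Zero]] cayley_tensor [OF g cayley_ide [of Zero]]]
            cayley_inv [OF cayley_a [of T Zero Zero]]]])
      (use cayley_arr [OF g] in \<open>simp_all add: c_sum_left\<close>)
  have "cayley (Sum Zero T) (Sum T Zero) (c \<zero> ?z) (path [] (leaves (Sum Zero T)))"
  proof (rule cayley_cong [OF g])
    fix w assume w: "w \<in> Obj C"
    have "g w \<bullet> g w = g w"
      using cayley_unique [OF 2 1 w] .
    then have "g w \<bullet> g w = g w \<bullet> ide (stack (leaves T) w)"
      using cayley_arr [OF g w] by simp
    then have "g w = ide (stack (leaves T) w)"
      by (rule left_cancel) (use cayley_arr [OF g w] w in simp_all)
    then show "g w = path [] (leaves (Sum Zero T)) w"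
      by simp
  qed
  then show ?thesis by (simp add: represents_def)
qed

text \<open>
  For three letters the two words represent the two sides of a naturality square of the commutator,
  the one for \<open>c x y\<close> in its first argument. Deeper positions follow by functoriality of the action.
\<close>

lemma swap_at_braid:
  assumes "i + 2 < length L" "set L \<subseteq> Obj C" "w \<in> Obj C"
  shows "path [i, Suc i, i] L w = path [Suc i, i, Suc i] L w"
  using assms
proof (induction i arbitrary: L)
  case 0
  then obtain x y z M where L: "L = x # y # z # M"
    by (auto simp: Suc_le_length_iff numeral_2_eq_2 Suc_le_eq [symmetric])
  with 0 have [simp]: "x \<in> Obj C" "y \<in> Obj C" "z \<in> Obj C" "set M \<subseteq> Obj C" "w \<in> Obj C"
    by auto
  have c3: "represents (Sum (Sum (At u) (At v)) (At z)) (Sum (At z) (Sum (At u) (At v))) (c (u \<oplus> v) z) [1, 0]"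
    if "u \<in> Obj C" "v \<in> Obj C" for u v
    using represents_c_sum [of "At u" "At z" "[0]" "At v" "[0]"] represents_c_At that by simp
  have 1: "represents (Sum (Sum (At x) (At y)) (At z)) (Sum (At z) (Sum (At y) (At x)))
      (c (y \<oplus> x) z \<bullet> (c x y \<oplus>\<^sub>a ide z)) [0, 1, 0]"
    using represents_comp [OF represents_sum [OF represents_c_At represents_ide [of "At z"]] c3, of x y]
    by simp
  have 2: "represents (Sum (Sum (At x) (At y)) (At z)) (Sum (At z) (Sum (At y) (At x)))
      ((ide z \<oplus>\<^sub>a c x y) \<bullet> c (x \<oplus> y) z) [1, 0, 1]"
    using represents_comp [OF c3 represents_sum [OF represents_ide [of "At z"] represents_c_At], of x y]
    by simp
  have "path [0, 1, 0] [x, y, z] (stack M w) = path [1, 0, 1] [x, y, z] (stack M w)"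
    using cayley_unique [OF representsD(1) [OF 1]] representsD(1) [OF 2]
      c_natural [of "c x y" "ide z"] by simp
  then show ?case
    using path_append_left [of "[0, 1, 0]" "[x, y, z]" M w]
      path_append_left [of "[1, 0, 1]" "[x, y, z]" M w] L by simp
next
  case (Suc i)
  then obtain x M where L: "L = x # M" by (cases L) auto
  then show ?case
    using Suc.IH [of M] Suc.prems path_append_right [of "[x]" M w "[i, Suc i, i]"]
      path_append_right [of "[x]" M w "[Suc i, i, Suc i]"] by simp
qed

lemma path_coxeter:
  assumes "coxeter n ws ws'" "length L = n" "set L \<subseteq> Obj C" "w \<in> Obj C"
  shows "permute ws L = permute ws' L \<and> path ws L w = path ws' L w"
  using assms
proof (induction arbitrary: L)
  case (coxeter_congruence ws ws' us vs)
  have "permute ws (permute us L) = permute ws' (permute us L) \<and>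
      path ws (permute us L) w = path ws' (permute us L) w"
    using coxeter_congruence by simp
  then show ?case
    using coxeter_congruence.prems by (simp add: path_append)
next
  case (coxeter_involution i)
  then show ?case by (simp add: swap_at_involution)
next
  case (coxeter_commutation i j)
  then show ?case using exchange_commute [of i j L] by (simp add: swap_at_commute)
next
  case (coxeter_braid i)
  then show ?case using swap_at_braid [of i L w] exchange_braid [of i L] by simp
qed auto

text \<open>
  Coherence: a diagram of structural arrows commutes as soon as its two sides perform the same
  permutation of the leaves, where sameness is witnessed by Coxeter relations.
\<close>

theorem symmetric_coherence:
  assumes "represents S T f ws" "represents S T f' ws'" "coxeter (length (leaves S)) ws ws'"
  shows "f = f'"
  using cayley_inj [OF representsD(1) [OF assms(1)] representsD(1) [OF assms(2)]]
    path_coxeter [OF assms(3) _ representsD(10) [OF assms(1)] unit_Obj] by simp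

end

section \<open>Symmetric 2-groups are AC 2-groups\<close>

lemma coxeter_commute:
  assumes "i + 2 \<le> j \<or> j + 2 \<le> i"
  shows "coxeter n (us @ [i, j] @ vs) (us @ [j, i] @ vs)"
  using assms coxeter_commutation coxeter_sym by (blast intro: coxeter_congruence)

text \<open>
  The two sides of \<open>AC1\<close>, with the letters \<open>x\<close>, \<open>y\<close>, \<open>z\<close>, \<open>t\<close>, \<open>x'\<close>, \<open>y'\<close>, \<open>z'\<close>, \<open>t'\<close> at the
  positions 0 to 7. The right side is longer because it moves \<open>y'\<close> past \<open>z\<close> and back again. Once these
  two exchanges are cancelled, the sides differ, up to commutations, by two braid moves, one on
  \<open>y\<close>, \<open>z\<close>, \<open>x'\<close> and one on \<open>t\<close>, \<open>y'\<close>, \<open>z'\<close>.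
\<close>

lemma coxeter_interchange: "coxeter 8 [5, 1, 3, 4, 2, 3, 5, 1] [3, 4, 2, 3, 5, 1, 3, 4, 2, 3]"
proof -
  have 1: "coxeter 8 [5, 1, 3, 4, 2, 3, 5, 1] [3, 5, 4, 5, 1, 2, 1, 3]"
  proof -
    have "coxeter 8 [5, 1, 3, 4, 2, 3, 5, 1] [5, 3, 1, 4, 2, 3, 5, 1]"
      using coxeter_commute [of 1 3 8 "[5]" "[4, 2, 3, 5, 1]"] by simp
    also have "coxeter 8 \<dots> [3, 5, 1, 4, 2, 3, 5, 1]"
      using coxeter_commute [of 5 3 8 "[]" "[1, 4, 2, 3, 5, 1]"] by simp
    also have "coxeter 8 \<dots> [3, 5, 4, 1, 2, 3, 5, 1]"
      using coxeter_commute [of 1 4 8 "[3, 5]" "[2, 3, 5, 1]"] by simp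
    also have "coxeter 8 \<dots> [3, 5, 4, 1, 2, 5, 3, 1]"
      using coxeter_commute [of 3 5 8 "[3, 5, 4, 1, 2]" "[1]"] by simp
    also have "coxeter 8 \<dots> [3, 5, 4, 1, 5, 2, 3, 1]"
      using coxeter_commute [of 2 5 8 "[3, 5, 4, 1]" "[3, 1]"] by simp
    also have "coxeter 8 \<dots> [3, 5, 4, 5, 1, 2, 3, 1]"
      using coxeter_commute [of 1 5 8 "[3, 5, 4]" "[2, 3, 1]"] by simp
    also have "coxeter 8 \<dots> [3, 5, 4, 5, 1, 2, 1, 3]"
      using coxeter_commute [of 3 1 8 "[3, 5, 4, 5, 1, 2]" "[]"] by simp
    finally show ?thesis .
  qed
  have 2: "coxeter 8 [3, 4, 2, 3, 5, 1, 3, 4, 2, 3] [3, 5, 4, 5, 1, 2, 1, 3]"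
  proof -
    have "coxeter 8 [3, 4, 2, 3, 5, 1, 3, 4, 2, 3] [3, 4, 2, 5, 3, 1, 3, 4, 2, 3]"
      using coxeter_commute [of 3 5 8 "[3, 4, 2]" "[1, 3, 4, 2, 3]"] by simp
    also have "coxeter 8 \<dots> [3, 4, 2, 5, 1, 3, 3, 4, 2, 3]"
      using coxeter_commute [of 3 1 8 "[3, 4, 2, 5]" "[3, 4, 2, 3]"] by simp
    also have "coxeter 8 \<dots> [3, 4, 2, 5, 1, 4, 2, 3]"
      using coxeter_congruence [OF coxeter_involution [of _ 3], where us = "[3, 4, 2, 5, 1]" and vs = "[4, 2, 3]"] by simp
    also have "coxeter 8 \<dots> [3, 4, 5, 2, 1, 4, 2, 3]"
      using coxeter_commute [of 2 5 8 "[3, 4]" "[1, 4, 2, 3]"] by simp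
    also have "coxeter 8 \<dots> [3, 4, 5, 2, 4, 1, 2, 3]"
      using coxeter_commute [of 1 4 8 "[3, 4, 5, 2]" "[2, 3]"] by simp
    also have "coxeter 8 \<dots> [3, 4, 5, 4, 2, 1, 2, 3]"
      using coxeter_commute [of 2 4 8 "[3, 4, 5]" "[1, 2, 3]"] by simp
    also have "coxeter 8 \<dots> [3, 5, 4, 5, 2, 1, 2, 3]"
      using coxeter_congruence [OF coxeter_braid [of 4 8], where us = "[3]" and vs = "[2, 1, 2, 3]"] by (simp add: eval_nat_numeral)
    also have "coxeter 8 \<dots> [3, 5, 4, 5, 1, 2, 1, 3]"
      using coxeter_congruence [OF coxeter_sym [OF coxeter_braid [of 1 8]], where us = "[3, 5, 4, 5]" and vs = "[3]"] by (simp add: eval_nat_numeral)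
    finally show ?thesis .
  qed
  show ?thesis
    using coxeter_trans [OF 1 coxeter_sym [OF 2]] .
qed

context symmetric_two_group
begin

lemma canonical_b_apply:
  "\<lbrakk>x \<in> Obj C; y \<in> Obj C; z \<in> Obj C; t \<in> Obj C\<rbrakk> \<Longrightarrow> canonical_b x y z t =
    a x z (y \<oplus> t) \<bullet> (ide x \<oplus>\<^sub>a arr_inv C (a z y t)) \<bullet> (ide x \<oplus>\<^sub>a (c y z \<oplus>\<^sub>a ide t)) \<bullet>
    (ide x \<oplus>\<^sub>a a y z t) \<bullet> arr_inv C (a x y (z \<oplus> t))"
  by (simp add: canonical_b_def)

lemma canonical_b_arr [simp]:
  assumes "x \<in> Obj C" "y \<in> Obj C" "z \<in> Obj C" "t \<in> Obj C"
  shows "canonical_b x y z t \<in> Arr C"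
    "Dom C (canonical_b x y z t) = (x \<oplus> y) \<oplus> (z \<oplus> t)"
    "Cod C (canonical_b x y z t) = (x \<oplus> z) \<oplus> (y \<oplus> t)"
  using assms by (simp_all add: canonical_b_apply)

lemma sq_canonical_b:
  assumes [simp]: "f \<in> Arr C" "g \<in> Arr C" "h \<in> Arr C" "k \<in> Arr C"
  shows "sq ((f \<oplus>\<^sub>a g) \<oplus>\<^sub>a (h \<oplus>\<^sub>a k)) ((f \<oplus>\<^sub>a h) \<oplus>\<^sub>a (g \<oplus>\<^sub>a k))
    (canonical_b (Dom C f) (Dom C g) (Dom C h) (Dom C k))
    (canonical_b (Cod C f) (Cod C g) (Cod C h) (Cod C k))"
proof -
  note f = sq_ide [OF assms(1)]
  note 1 = sq_inv [OF sq_a [of f g "h \<oplus>\<^sub>a k"]]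
  note 2 = sq_tensa [OF f sq_a [of g h k]]
  note 3 = sq_tensa [OF f sq_tensa [OF sq_c [of g h] sq_ide [of k]]]
  note 4 = sq_tensa [OF f sq_inv [OF sq_a [of h g k]]]
  note 5 = sq_a [of f h "g \<oplus>\<^sub>a k"]
  show ?thesis
    using sq_comp [OF sq_comp [OF sq_comp [OF sq_comp [OF 1 2] 3] 4] 5]
    by (simp add: canonical_b_apply)
qed

text \<open>
  The associators in \<open>b\<close> are invisible, so only the commutator of the two middle summands remains,
  shifted by the leaves to its left.
\<close>

lemma represents_canonical_b:
  assumes "represents (Sum T U) (Sum U T) (c (ob T) (ob U)) ws" and [simp]: "tree S" "tree V"
  shows "represents (Sum (Sum S T) (Sum U V)) (Sum (Sum S U) (Sum T V))
    (canonical_b (ob S) (ob T) (ob U) (ob V)) (map ((+) (length (leaves S))) ws)"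
proof -
  have [simp]: "tree T" "tree U"
    using representsD(5) [OF assms(1)] by simp_all
  note s = represents_ide [of S] and v = represents_ide [of V]
  note 1 = represents_inv [OF represents_a [of S T "Sum U V"]]
  note 2 = represents_sum [OF s represents_a [of T U V]]
  note 3 = represents_sum [OF s represents_sum [OF assms(1) v]]
  note 4 = represents_sum [OF s represents_inv [OF represents_a [of U T V]]]
  note 5 = represents_a [of S U "Sum T V"]
  show ?thesis
    using represents_comp [OF represents_comp [OF represents_comp [OF represents_comp [OF 1 2] 3] 4] 5]
    by (simp add: canonical_b_apply)
qed

lemma represents_canonical_b_At:
  assumes "x \<in> Obj C" "y \<in> Obj C" "z \<in> Obj C" "t \<in> Obj C"
  shows "represents (Sum (Sum (At x) (At y)) (Sum (At z) (At t)))
    (Sum (Sum (At x) (At z)) (Sum (At y) (At t))) (canonical_b x y z t) [1]"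
  using represents_canonical_b [of "At y" "At z" "[0]" "At x" "At t"] represents_c_At assms by simp

text \<open>
  Here the middle summands are blocks of two letters, and crossing them takes four exchanges.
\<close>

lemma represents_canonical_b_Sum:
  assumes [simp]: "x \<in> Obj C" "x' \<in> Obj C" "y \<in> Obj C" "y' \<in> Obj C"
    "z \<in> Obj C" "z' \<in> Obj C" "t \<in> Obj C" "t' \<in> Obj C"
  shows "represents
    (Sum (Sum (Sum (At x) (At x')) (Sum (At y) (At y'))) (Sum (Sum (At z) (At z')) (Sum (At t) (At t'))))
    (Sum (Sum (Sum (At x) (At x')) (Sum (At z) (At z'))) (Sum (Sum (At y) (At y')) (Sum (At t) (At t'))))
    (canonical_b (x \<oplus> x') (y \<oplus> y') (z \<oplus> z') (t \<oplus> t')) [3, 4, 2, 3]"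
proof -
  have 1: "represents (Sum (At v) (Sum (At z) (At z'))) (Sum (Sum (At z) (At z')) (At v))
      (c v (z \<oplus> z')) [0, 1]" if "v \<in> Obj C" for v
    using represents_c_flip [of "Sum (At z) (At z')" "At v" "[1, 0]"]
      represents_c_sum [of "At z" "At v" "[0]" "At z'" "[0]"] represents_c_At that by simp
  have "represents (Sum (Sum (At y) (At y')) (Sum (At z) (At z')))
      (Sum (Sum (At z) (At z')) (Sum (At y) (At y'))) (c (y \<oplus> y') (z \<oplus> z')) [1, 2, 0, 1]"
    using represents_c_sum [of "At y" "Sum (At z) (At z')" "[0, 1]" "At y'" "[0, 1]"] 1
    by (simp add: numeral_2_eq_2)
  then show ?thesis
    using represents_canonical_b [of "Sum (At y) (At y')" "Sum (At z) (At z')" "[1, 2, 0, 1]"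
        "Sum (At x) (At x')" "Sum (At t) (At t')"] by (simp add: eval_nat_numeral)
qed

lemma represents_canonical_b_Zero:
  assumes [simp]: "x \<in> Obj C" "y \<in> Obj C"
  shows "represents (Sum (Sum (At x) Zero) (Sum (At y) Zero)) (Sum (Sum (At x) (At y)) (Sum Zero Zero))
      (canonical_b x \<zero> y \<zero>) []"
    and "represents (Sum (Sum Zero (At x)) (Sum Zero (At y))) (Sum (Sum Zero Zero) (Sum (At x) (At y)))
      (canonical_b \<zero> x \<zero> y) []"
    and "represents (Sum (Sum (At x) (At y)) (Sum Zero Zero)) (Sum (Sum (At x) Zero) (Sum (At y) Zero))
      (canonical_b x y \<zero> \<zero>) []"
    and "represents (Sum (Sum Zero Zero) (Sum (At x) (At y))) (Sum (Sum Zero (At x)) (Sum Zero (At y)))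
      (canonical_b \<zero> \<zero> x y) []"
    and "represents (Sum (Sum (At x) Zero) (Sum Zero (At y))) (Sum (Sum (At x) Zero) (Sum Zero (At y)))
      (canonical_b x \<zero> \<zero> y) []"
  using represents_canonical_b [of Zero "At y" "[]" "At x" Zero]
    represents_canonical_b [of "At x" Zero "[]" Zero "At y"]
    represents_canonical_b [of "At y" Zero "[]" "At x" Zero]
    represents_canonical_b [of Zero "At x" "[]" Zero "At y"]
    represents_canonical_b [of Zero Zero "[]" "At x" "At y"]
    represents_c_Zero [of "At x"] represents_c_Zero [of "At y"] represents_c_Zero [of Zero]
    represents_c_flip [of Zero "At x" "[]"] represents_c_flip [of Zero "At y" "[]"]
  by simp_all

theorem ac_two_group_canonical_b: "ac_two_group C (\<oplus>) (\<oplus>\<^sub>a) \<zero> l r canonical_b"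
proof unfold_locales
  show "canonical_b \<in> (\<Pi>\<^sub>E x\<in>Obj C. \<Pi>\<^sub>E y\<in>Obj C. \<Pi>\<^sub>E z\<in>Obj C. \<Pi>\<^sub>E t\<in>Obj C.
      iso_hom C ((x \<oplus> y) \<oplus> (z \<oplus> t)) ((x \<oplus> z) \<oplus> (y \<oplus> t)))"
    unfolding canonical_b_def
    by (intro restrict_PiE_iff [THEN iffD2] ballI) (simp add: iso_hom_eq_hom hom_def)
next
  fix f g h k
  assume "f \<in> Arr C" "g \<in> Arr C" "h \<in> Arr C" "k \<in> Arr C"
  then show "canonical_b (Cod C f) (Cod C g) (Cod C h) (Cod C k) \<bullet> ((f \<oplus>\<^sub>a g) \<oplus>\<^sub>a (h \<oplus>\<^sub>a k)) =
      ((f \<oplus>\<^sub>a h) \<oplus>\<^sub>a (g \<oplus>\<^sub>a k)) \<bullet> canonical_b (Dom C f) (Dom C g) (Dom C h) (Dom C k)"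
    using sqD(9) [OF sq_canonical_b [of f g h k]] by simp
next
  fix x y z t x' y' z' t'
  assume [simp]: "x \<in> Obj C" "y \<in> Obj C" "z \<in> Obj C" "t \<in> Obj C"
    "x' \<in> Obj C" "y' \<in> Obj C" "z' \<in> Obj C" "t' \<in> Obj C"
  \<comment> \<open>inner exchanges act at positions 1 and 5, the block exchange at 3, 4, 2, 3\<close>
  have cox: "coxeter 8 ([5, 1] @ [3, 4, 2, 3] @ [5, 1]) ([3, 4, 2, 3] @ [5, 1] @ [3, 4, 2, 3])"
    using coxeter_interchange by simp
  have L: "represents
      (Sum (Sum (Sum (At x) (At y)) (Sum (At z) (At t))) (Sum (Sum (At x') (At y')) (Sum (At z') (At t'))))
      (Sum (Sum (Sum (At x) (At x')) (Sum (At z) (At z'))) (Sum (Sum (At y) (At y')) (Sum (At t) (At t'))))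
      ((canonical_b x z x' z' \<oplus>\<^sub>a canonical_b y t y' t') \<bullet>
        canonical_b (x \<oplus> z) (y \<oplus> t) (x' \<oplus> z') (y' \<oplus> t') \<bullet>
        (canonical_b x y z t \<oplus>\<^sub>a canonical_b x' y' z' t')) ([5, 1] @ [3, 4, 2, 3] @ [5, 1])"
    using represents_comp [OF represents_comp [OF
        represents_sum [OF represents_canonical_b_At [of x y z t] represents_canonical_b_At [of x' y' z' t']]
        represents_canonical_b_Sum [of x z y t x' z' y' t']]
        represents_sum [OF represents_canonical_b_At [of x z x' z'] represents_canonical_b_At [of y t y' t']]]
    by (simp add: eval_nat_numeral)
  have R: "represents
      (Sum (Sum (Sum (At x) (At y)) (Sum (At z) (At t))) (Sum (Sum (At x') (At y')) (Sum (At z') (At t'))))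
      (Sum (Sum (Sum (At x) (At x')) (Sum (At z) (At z'))) (Sum (Sum (At y) (At y')) (Sum (At t) (At t'))))
      (canonical_b (x \<oplus> x') (y \<oplus> y') (z \<oplus> z') (t \<oplus> t') \<bullet>
        (canonical_b x y x' y' \<oplus>\<^sub>a canonical_b z t z' t') \<bullet>
        canonical_b (x \<oplus> y) (z \<oplus> t) (x' \<oplus> y') (z' \<oplus> t')) ([3, 4, 2, 3] @ [5, 1] @ [3, 4, 2, 3])"
    using represents_comp [OF represents_comp [OF
        represents_canonical_b_Sum [of x y z t x' y' z' t']
        represents_sum [OF represents_canonical_b_At [of x y x' y'] represents_canonical_b_At [of z t z' t']]]
        represents_canonical_b_Sum [of x x' y y' z z' t t']]
    by (simp add: eval_nat_numeral)
  show "(canonical_b x z x' z' \<oplus>\<^sub>a canonical_b y t y' t') \<bullet>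
        canonical_b (x \<oplus> z) (y \<oplus> t) (x' \<oplus> z') (y' \<oplus> t') \<bullet>
        (canonical_b x y z t \<oplus>\<^sub>a canonical_b x' y' z' t') =
      canonical_b (x \<oplus> x') (y \<oplus> y') (z \<oplus> z') (t \<oplus> t') \<bullet>
        (canonical_b x y x' y' \<oplus>\<^sub>a canonical_b z t z' t') \<bullet>
        canonical_b (x \<oplus> y) (z \<oplus> t) (x' \<oplus> y') (z' \<oplus> t')"
    by (rule symmetric_coherence [OF L R]) (use cox in \<open>simp add: eval_nat_numeral\<close>)
next
  fix x y
  assume [simp]: "x \<in> Obj C" "y \<in> Obj C"
  let ?x = "At x" and ?y = "At y"
  note coherence = symmetric_coherence [OF _ _ coxeter_refl]
  note b = represents_canonical_b_Zero [of x y]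
  have xy: "represents (Sum ?x ?y) (Sum ?x ?y) (ide (x \<oplus> y)) []"
    using represents_ide [of "Sum ?x ?y"] by simp
  have r: "represents (Sum (Sum ?x ?y) Zero) (Sum ?x ?y) (r (x \<oplus> y)) []"
    and l: "represents (Sum Zero (Sum ?x ?y)) (Sum ?x ?y) (l (x \<oplus> y)) []"
    using represents_r [of "Sum ?x ?y"] represents_l [of "Sum ?x ?y"] by simp_all
  have rr: "represents (Sum (Sum ?x Zero) (Sum ?y Zero)) (Sum ?x ?y) (r x \<oplus>\<^sub>a r y) []"
    using represents_sum [OF represents_r [of ?x] represents_r [of ?y]] by simp
  have ll: "represents (Sum (Sum Zero ?x) (Sum Zero ?y)) (Sum ?x ?y) (l x \<oplus>\<^sub>a l y) []"
    using represents_sum [OF represents_l [of ?x] represents_l [of ?y]] by simp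
  have l0: "represents (Sum (Sum ?x ?y) (Sum Zero Zero)) (Sum (Sum ?x ?y) Zero)
      (ide (x \<oplus> y) \<oplus>\<^sub>a l \<zero>) []"
    using represents_sum [OF xy represents_l [of Zero]] by simp
  have r0: "represents (Sum (Sum Zero Zero) (Sum ?x ?y)) (Sum Zero (Sum ?x ?y))
      (r \<zero> \<oplus>\<^sub>a ide (x \<oplus> y)) []"
    using represents_sum [OF represents_r [of Zero] xy] by simp
  show "r (x \<oplus> y) \<bullet> (ide (x \<oplus> y) \<oplus>\<^sub>a l \<zero>) \<bullet> canonical_b x \<zero> y \<zero> = r x \<oplus>\<^sub>a r y"
    using coherence [OF represents_comp [OF represents_comp [OF b(1) l0] r, simplified] rr] by simp
  show "l (x \<oplus> y) \<bullet> (r \<zero> \<oplus>\<^sub>a ide (x \<oplus> y)) \<bullet> canonical_b \<zero> x \<zero> y = l x \<oplus>\<^sub>a l y"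
    using coherence [OF represents_comp [OF represents_comp [OF b(2) r0] l, simplified] ll] by simp
  show "(r x \<oplus>\<^sub>a r y) \<bullet> canonical_b x y \<zero> \<zero> = r (x \<oplus> y) \<bullet> (ide (x \<oplus> y) \<oplus>\<^sub>a l \<zero>)"
    using coherence [OF represents_comp [OF b(3) rr] represents_comp [OF l0 r]] by simp
  show "(l x \<oplus>\<^sub>a l y) \<bullet> canonical_b \<zero> \<zero> x y = l (x \<oplus> y) \<bullet> (r \<zero> \<oplus>\<^sub>a ide (x \<oplus> y))"
    using coherence [OF represents_comp [OF b(4) ll] represents_comp [OF r0 l]] by simp
  show "canonical_b x \<zero> \<zero> y = ide ((x \<oplus> \<zero>) \<oplus> (\<zero> \<oplus> y))"
    using coherence [OF b(5)] represents_ide [of "Sum (Sum ?x Zero) (Sum Zero ?y)"] by simp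
qed

lemma canonical_a_canonical_b:
  "ac_two_group.canonical_a C (\<oplus>) (\<oplus>\<^sub>a) \<zero> l r canonical_b = a"
proof -
  interpret ac: ac_two_group C "(\<oplus>)" "(\<oplus>\<^sub>a)" \<zero> l r canonical_b
    by (rule ac_two_group_canonical_b)
  show ?thesis
  proof (rule ext)+
    fix x y z
    show "ac.canonical_a x y z = a x y z"
    proof (cases "x \<in> Obj C \<and> y \<in> Obj C \<and> z \<in> Obj C")
      case True
      then have [simp]: "x \<in> Obj C" "y \<in> Obj C" "z \<in> Obj C" by auto
      let ?x = "At x" and ?y = "At y" and ?z = "At z"
      have "represents (Sum ?x (Sum ?y ?z)) (Sum (Sum ?x ?y) ?z) (ac.canonical_a x y z) []"
        using represents_comp [OF represents_comp [OF
            represents_sum [OF represents_inv [OF represents_r [of ?x]] represents_ide [of "Sum ?y ?z"]]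
            represents_canonical_b [of Zero ?y "[]" ?x ?z]]
            represents_sum [OF represents_ide [of "Sum ?x ?y"] represents_l [of ?z]]]
        using represents_c_Zero [of ?y] by (simp add: ac.canonical_a_def)
      then show ?thesis
        using symmetric_coherence [OF _ _ coxeter_refl] represents_a [of ?x ?y ?z] by simp
    next
      case False
      then show ?thesis
        using PiE_arb [OF a_type, of x] PiE_arb [OF PiE_mem [OF a_type], of x y]
          PiE_arb [OF PiE_mem [OF PiE_mem [OF a_type]], of x y z]
        by (auto simp: ac.canonical_a_def restrict_def)
    qed
  qed
qed

lemma canonical_c_canonical_b:
  "ac_two_group.canonical_c C (\<oplus>\<^sub>a) \<zero> l r canonical_b = c"
proof -
  interpret ac: ac_two_group C "(\<oplus>)" "(\<oplus>\<^sub>a)" \<zero> l r canonical_b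
    by (rule ac_two_group_canonical_b)
  show ?thesis
  proof (rule ext)+
    fix x y
    show "ac.canonical_c x y = c x y"
    proof (cases "x \<in> Obj C \<and> y \<in> Obj C")
      case True
      then have [simp]: "x \<in> Obj C" "y \<in> Obj C" by auto
      let ?x = "At x" and ?y = "At y"
      have "represents (Sum ?x ?y) (Sum ?y ?x) (ac.canonical_c x y) [0]"
        using represents_comp [OF represents_comp [OF
            represents_sum [OF represents_inv [OF represents_l [of ?x]] represents_inv [OF represents_r [of ?y]]]
            represents_canonical_b [of ?x ?y "[0]" Zero Zero]]
            represents_sum [OF represents_l [of ?y] represents_r [of ?x]]]
        by (simp add: ac.canonical_c_def represents_c_At)
      then show ?thesis
        using symmetric_coherence [OF _ _ coxeter_refl] represents_c_At [of x y] by simp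
    next
      case False
      then show ?thesis
        using PiE_arb [OF c_type, of x] PiE_arb [OF PiE_mem [OF c_type], of x y]
        by (auto simp: ac.canonical_c_def restrict_def)
    qed
  qed
qed

end

section \<open>Removing zeros from formal sums\<close>

primrec reduce :: "'o sumtree \<Rightarrow> 'o sumtree" where
  "reduce Zero = Zero"
| "reduce (At x) = At x"
| "reduce (Sum S T) =
    (if reduce S = Zero then reduce T else if reduce T = Zero then reduce S
     else Sum (reduce S) (reduce T))"

lemma reduce_reduce [simp]: "reduce (reduce S) = reduce S"
  by (induction S) auto

lemma reduce_Sum_reduce: "reduce (Sum (reduce S) (reduce T)) = reduce (Sum S T)"
  by simp

context unital_bifunctor
begin

text \<open>
  The unitors that remove the zeros. A sum of two zeros is collapsed by \<open>l\<close>; by \<open>r_zero_eq_l_zero\<close>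
  below \<open>r\<close> would give the same arrow in an AC 2-group.
\<close>

primrec collapse :: "'o sumtree \<Rightarrow> 'm" where
  "collapse Zero = ide \<one>"
| "collapse (At x) = ide x"
| "collapse (Sum S T) =
    (if reduce S = Zero then l (ob (reduce T))
     else if reduce T = Zero then r (ob (reduce S))
     else ide (ob (reduce S) \<otimes> ob (reduce T))) \<bullet> (collapse S \<otimes>\<^sub>a collapse T)"

lemma tree_reduce [simp]: "tree S \<Longrightarrow> tree (reduce S)"
  by (induction S) auto

lemma collapse_arr [simp]:
  assumes "tree S"
  shows "collapse S \<in> Arr C" "Dom C (collapse S) = ob S" "Cod C (collapse S) = ob (reduce S)"
proof -
  have "tree S \<longrightarrow>
      collapse S \<in> Arr C \<and> Dom C (collapse S) = ob S \<and> Cod C (collapse S) = ob (reduce S)"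
    by (induction S) auto
  then show "collapse S \<in> Arr C" "Dom C (collapse S) = ob S" "Cod C (collapse S) = ob (reduce S)"
    using assms by auto
qed

lemma collapse_reduce [simp]: "tree S \<Longrightarrow> collapse (reduce S) = ide (ob (reduce S))"
  by (induction S) auto

lemma collapse_Sum:
  "\<lbrakk>tree S; tree T\<rbrakk> \<Longrightarrow>
    collapse (Sum S T) = collapse (Sum (reduce S) (reduce T)) \<bullet> (collapse S \<otimes>\<^sub>a collapse T)"
  by (auto simp: tensa_comp)

text \<open>
  The arrow \<open>g\<close> between the reduced sums is what becomes of \<open>f\<close> when the zeros are removed by unitors.
\<close>

definition reduces :: "'o sumtree \<Rightarrow> 'o sumtree \<Rightarrow> 'm \<Rightarrow> 'm \<Rightarrow> bool" where
  "reduces S T f g \<longleftrightarrow> tree S \<and> tree T \<and> sq (collapse S) (collapse T) f g"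

lemma reducesI: "\<lbrakk>tree S; tree T; sq (collapse S) (collapse T) f g\<rbrakk> \<Longrightarrow> reduces S T f g"
  by (simp add: reduces_def)

lemma reducesD:
  assumes "reduces S T f g"
  shows "tree S" "tree T" "sq (collapse S) (collapse T) f g"
    "f \<in> Arr C" "Dom C f = ob S" "Cod C f = ob T"
    "g \<in> Arr C" "Dom C g = ob (reduce S)" "Cod C g = ob (reduce T)"
  using assms sqD [of "collapse S" "collapse T" f g] by (auto simp: reduces_def)

lemma reduces_comp: "\<lbrakk>reduces S T f g; reduces T U f' g'\<rbrakk> \<Longrightarrow> reduces S U (f' \<bullet> f) (g' \<bullet> g)"
  unfolding reduces_def by (auto intro: sq_comp)

lemma reduces_Sum:
  assumes "reduces S T f g" "reduces S' T' f' g'"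
    "sq (collapse (Sum (reduce S) (reduce S'))) (collapse (Sum (reduce T) (reduce T'))) (g \<otimes>\<^sub>a g') h"
  shows "reduces (Sum S S') (Sum T T') (f \<otimes>\<^sub>a f') h"
  using sq_stack [OF sq_tensa [OF reducesD(3) [OF assms(1)] reducesD(3) [OF assms(2)]] assms(3)]
    reducesD(1,2) [OF assms(1)] reducesD(1,2) [OF assms(2)]
  by (intro reducesI) (simp_all only: collapse_Sum tree_simps simp_thms)

lemma reduces_Sum_nonzero:
  assumes "reduces S T f g" "reduces S' T' f' g'"
    "reduce S \<noteq> Zero" "reduce T \<noteq> Zero" "reduce S' \<noteq> Zero" "reduce T' \<noteq> Zero"
  shows "reduces (Sum S S') (Sum T T') (f \<otimes>\<^sub>a f') (g \<otimes>\<^sub>a g')"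
  using reducesD [OF assms(1)] reducesD [OF assms(2)] assms(3-)
  by (intro reduces_Sum [OF assms(1,2)]) (simp add: sq_def)

lemma reduces_Sum_ide:
  assumes "reduces S T f (ide (ob (reduce S)))" "reduces S' T' f' (ide (ob (reduce S')))"
    "reduce T = reduce S" "reduce T' = reduce S'"
  shows "reduces (Sum S S') (Sum T T') (f \<otimes>\<^sub>a f') (ide (ob (reduce (Sum S S'))))"
proof (rule reduces_Sum [OF assms(1,2)])
  have [simp]: "tree S" "tree S'"
    using reducesD(1) assms(1,2) by blast+
  show "sq (collapse (Sum (reduce S) (reduce S'))) (collapse (Sum (reduce T) (reduce T')))
      (ide (ob (reduce S)) \<otimes>\<^sub>a ide (ob (reduce S'))) (ide (ob (reduce (Sum S S'))))"
    using sq_ide [of "collapse (Sum (reduce S) (reduce S'))"] 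
    by (simp add: assms(3,4) reduce_Sum_reduce del: collapse.simps reduce.simps)
qed

end

context ac_two_group
begin

lemma b_arr [simp]:
  assumes "x \<in> Obj C" "y \<in> Obj C" "z \<in> Obj C" "t \<in> Obj C"
  shows "b x y z t \<in> Arr C" "Dom C (b x y z t) = (x \<oplus> y) \<oplus> (z \<oplus> t)"
    "Cod C (b x y z t) = (x \<oplus> z) \<oplus> (y \<oplus> t)"
  using iso_hom_arrD [OF PiE_mem [OF PiE_mem [OF PiE_mem [OF PiE_mem
    [OF b_type assms(1)] assms(2)] assms(3)] assms(4)]] .

lemma sq_b:
  "\<lbrakk>f \<in> Arr C; g \<in> Arr C; h \<in> Arr C; k \<in> Arr C\<rbrakk> \<Longrightarrow>
    sq ((f \<oplus>\<^sub>a g) \<oplus>\<^sub>a (h \<oplus>\<^sub>a k)) ((f \<oplus>\<^sub>a h) \<oplus>\<^sub>a (g \<oplus>\<^sub>a k))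
      (b (Dom C f) (Dom C g) (Dom C h) (Dom C k)) (b (Cod C f) (Cod C g) (Cod C h) (Cod C k))"
  by (rule sqI) (simp_all add: b_natural)

text \<open>
  Since \<open>b \<zero> \<zero> \<zero> \<zero>\<close> is an identity by \<open>AC3\<close>, the first axiom of \<open>AC2\<close> at \<open>\<zero>\<close> compares \<open>r \<zero>\<close> with \<open>l \<zero>\<close>.
\<close>

lemma r_zero_eq_l_zero: "r \<zero> = l \<zero>"
proof (rule unit_tens_faithful)
  have r00: "r (\<zero> \<oplus> \<zero>) = r \<zero> \<oplus>\<^sub>a ide \<zero>"
    by (rule left_cancel [where h = "r \<zero>"]) (use r_natural [of "r \<zero>"] in simp_all)
  have "r (\<zero> \<oplus> \<zero>) \<bullet> (ide (\<zero> \<oplus> \<zero>) \<oplus>\<^sub>a l \<zero>) = r \<zero> \<oplus>\<^sub>a r \<zero>"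
    using AC2_1 [of \<zero> \<zero>] AC3 [of \<zero> \<zero>] by simp
  also have "\<dots> = r (\<zero> \<oplus> \<zero>) \<bullet> (ide (\<zero> \<oplus> \<zero>) \<oplus>\<^sub>a r \<zero>)"
    by (simp add: r00 tensa_comp)
  finally have "(r \<zero> \<oplus>\<^sub>a ide \<zero>) \<bullet> (ide (\<zero> \<oplus> \<zero>) \<oplus>\<^sub>a l \<zero>) = (r \<zero> \<oplus>\<^sub>a ide \<zero>) \<bullet> (ide (\<zero> \<oplus> \<zero>) \<oplus>\<^sub>a r \<zero>)"
    by (simp add: r00)
  then have "(ide \<zero> \<oplus>\<^sub>a l \<zero>) \<bullet> (r \<zero> \<oplus>\<^sub>a ide (\<zero> \<oplus> \<zero>)) = (ide \<zero> \<oplus>\<^sub>a r \<zero>) \<bullet> (r \<zero> \<oplus>\<^sub>a ide (\<zero> \<oplus> \<zero>))"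
    by (simp add: tensa_comp)
  then show "ide \<zero> \<oplus>\<^sub>a r \<zero> = ide \<zero> \<oplus>\<^sub>a l \<zero>"
    by (rule right_cancel [symmetric]) simp_all
qed simp_all

lemma collapse_Sum_Zero_right:
  "reduce T = Zero \<Longrightarrow> collapse (Sum S T) = r (ob (reduce S)) \<bullet> (collapse S \<oplus>\<^sub>a collapse T)"
  by (simp add: r_zero_eq_l_zero)

lemma collapse_Sum_Zero_left:
  "reduce S = Zero \<Longrightarrow> collapse (Sum S T) = l (ob (reduce T)) \<bullet> (collapse S \<oplus>\<^sub>a collapse T)"
  by simp

text \<open>
  The diagram \<open>AC1\<close> has as edges single values of \<open>b\<close> and sums of two values of \<open>b\<close>. These predicates
  say what becomes of the edges when the zeros among the arguments are removed.
\<close>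

definition edge :: "'o sumtree \<Rightarrow> 'o sumtree \<Rightarrow> 'o sumtree \<Rightarrow> 'o sumtree \<Rightarrow> 'm \<Rightarrow> bool" where
  "edge S T U V = reduces (Sum (Sum S T) (Sum U V)) (Sum (Sum S U) (Sum T V))
    (b (ob S) (ob T) (ob U) (ob V))"

lemma edgeI:
  assumes [simp]: "tree S" "tree T" "tree U" "tree V"
    and "sq (collapse (Sum (Sum (reduce S) (reduce T)) (Sum (reduce U) (reduce V))))
      (collapse (Sum (Sum (reduce S) (reduce U)) (Sum (reduce T) (reduce V))))
      (b (ob (reduce S)) (ob (reduce T)) (ob (reduce U)) (ob (reduce V))) g"
  shows "edge S T U V g"
  unfolding edge_def
proof (rule reducesI)
  have *: "collapse (Sum (Sum S T) (Sum U V)) =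
      collapse (Sum (Sum (reduce S) (reduce T)) (Sum (reduce U) (reduce V))) \<bullet>
      ((collapse S \<oplus>\<^sub>a collapse T) \<oplus>\<^sub>a (collapse U \<oplus>\<^sub>a collapse V))"
    if "tree S" "tree T" "tree U" "tree V" for S T U V :: "'o sumtree"
    using that by (simp add: tensa_comp)
  show "sq (collapse (Sum (Sum S T) (Sum U V))) (collapse (Sum (Sum S U) (Sum T V)))
      (b (ob S) (ob T) (ob U) (ob V)) g"
    unfolding * [OF assms(1-4)] * [OF assms(1,3,2,4)]
    by (rule sq_stack [OF _ assms(5)])
      (use sq_b [of "collapse S" "collapse T" "collapse U" "collapse V"] in simp)
qed simp_all

text \<open>
  However \<open>P\<close> and \<open>Q\<close> are padded with two zeros without being interchanged, the collapse factors
  through that of \<open>Sum P Q\<close>. As the latter is left unevaluated, this covers the cases in which \<open>P\<close> or \<open>Q\<close> is itself zero.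
\<close>

lemma collapse_with_Zeros:
  fixes P Q :: "'o sumtree"
  assumes [simp]: "tree P" "tree Q" and red: "reduce P = P" "reduce Q = Q"
  defines "p \<equiv> ob P" and "q \<equiv> ob Q"
  shows "collapse (Sum (Sum P Zero) (Sum Q Zero)) = collapse (Sum P Q) \<bullet> (r p \<oplus>\<^sub>a r q)"
    and "collapse (Sum (Sum Zero P) (Sum Zero Q)) = collapse (Sum P Q) \<bullet> (l p \<oplus>\<^sub>a l q)"
    and "collapse (Sum (Sum P Zero) (Sum Zero Q)) = collapse (Sum P Q) \<bullet> (r p \<oplus>\<^sub>a l q)"
    and "collapse (Sum (Sum P Q) (Sum Zero Zero)) =
      collapse (Sum P Q) \<bullet> r (p \<oplus> q) \<bullet> (ide (p \<oplus> q) \<oplus>\<^sub>a l \<zero>)"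
    and "collapse (Sum (Sum Zero Zero) (Sum P Q)) =
      collapse (Sum P Q) \<bullet> l (p \<oplus> q) \<bullet> (r \<zero> \<oplus>\<^sub>a ide (p \<oplus> q))"
proof -
  have [simp]: "collapse P = ide p" "collapse Q = ide q" "ob P = p" "ob Q = q" "p \<in> Obj C" "q \<in> Obj C"
    using collapse_reduce [of P] collapse_reduce [of Q] red assms(1,2) ob_Obj [of P] ob_Obj [of Q]
    by (simp_all only: p_def q_def)
  have r: "collapse (Sum P Zero) = r p" "collapse (Sum Q Zero) = r q"
    by (subst collapse_Sum_Zero_right; simp add: red)+
  have l: "collapse (Sum Zero P) = l p" "collapse (Sum Zero Q) = l q"
    by (subst collapse_Sum_Zero_left; simp add: red)+
  have J: "collapse (Sum P Q) \<in> Arr C" "Dom C (collapse (Sum P Q)) = p \<oplus> q"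
    "Cod C (collapse (Sum P Q)) = ob (reduce (Sum P Q))"
    using collapse_arr [of "Sum P Q"] assms(1,2)
    by (simp_all only: tree_simps ob.simps simp_thms \<open>ob P = p\<close> \<open>ob Q = q\<close>)
  have [simp]: "reduce (Sum P Zero) = P" "reduce (Sum Q Zero) = Q"
    "reduce (Sum Zero P) = P" "reduce (Sum Zero Q) = Q"
    by (simp_all add: red)
  note [simp del] = collapse.simps(3) reduce.simps(3)
  show "collapse (Sum (Sum P Zero) (Sum Q Zero)) = collapse (Sum P Q) \<bullet> (r p \<oplus>\<^sub>a r q)"
    "collapse (Sum (Sum Zero P) (Sum Zero Q)) = collapse (Sum P Q) \<bullet> (l p \<oplus>\<^sub>a l q)"
    "collapse (Sum (Sum P Zero) (Sum Zero Q)) = collapse (Sum P Q) \<bullet> (r p \<oplus>\<^sub>a l q)"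
    by (subst collapse_Sum; simp add: r l)+
  have 0: "collapse (Sum Zero Zero) = l \<zero>" "reduce (Sum Zero Zero) = Zero"
    by (simp_all add: collapse.simps(3) reduce.simps(3))
  have "collapse (Sum (Sum P Q) (Sum Zero Zero)) =
      r (ob (reduce (Sum P Q))) \<bullet> (collapse (Sum P Q) \<oplus>\<^sub>a l \<zero>)"
    by (subst collapse_Sum_Zero_right) (simp_all add: 0)
  also have "\<dots> = (r (ob (reduce (Sum P Q))) \<bullet> (collapse (Sum P Q) \<oplus>\<^sub>a ide \<zero>)) \<bullet> (ide (p \<oplus> q) \<oplus>\<^sub>a l \<zero>)"
    by (simp add: J tensa_comp)
  also have "\<dots> = collapse (Sum P Q) \<bullet> r (p \<oplus> q) \<bullet> (ide (p \<oplus> q) \<oplus>\<^sub>a l \<zero>)"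
    using r_natural [OF J(1)] by (simp add: J)
  finally show "collapse (Sum (Sum P Q) (Sum Zero Zero)) =
      collapse (Sum P Q) \<bullet> r (p \<oplus> q) \<bullet> (ide (p \<oplus> q) \<oplus>\<^sub>a l \<zero>)" .
  have "collapse (Sum (Sum Zero Zero) (Sum P Q)) =
      l (ob (reduce (Sum P Q))) \<bullet> (l \<zero> \<oplus>\<^sub>a collapse (Sum P Q))"
    by (subst collapse_Sum_Zero_left) (simp_all add: 0)
  also have "\<dots> = (l (ob (reduce (Sum P Q))) \<bullet> (ide \<zero> \<oplus>\<^sub>a collapse (Sum P Q))) \<bullet> (l \<zero> \<oplus>\<^sub>a ide (p \<oplus> q))"
    by (simp add: J tensa_comp)
  also have "\<dots> = collapse (Sum P Q) \<bullet> l (p \<oplus> q) \<bullet> (r \<zero> \<oplus>\<^sub>a ide (p \<oplus> q))"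
    using l_natural [OF J(1)] by (simp add: J r_zero_eq_l_zero)
  finally show "collapse (Sum (Sum Zero Zero) (Sum P Q)) =
      collapse (Sum P Q) \<bullet> l (p \<oplus> q) \<bullet> (r \<zero> \<oplus>\<^sub>a ide (p \<oplus> q))" .
qed

text \<open>
  If the two remaining summands do not cross, \<open>b\<close> moves only zeros around. The five positions are
  exactly those of the four axioms \<open>AC2\<close> and of \<open>AC3\<close>.
\<close>

lemma edge_ide:
  assumes [simp]: "tree S" "tree T" "tree U" "tree V"
    and zeros: "reduce T = Zero \<and> reduce V = Zero \<or> reduce S = Zero \<and> reduce U = Zero \<or>
      reduce U = Zero \<and> reduce V = Zero \<or> reduce S = Zero \<and> reduce T = Zero \<or>
      reduce T = Zero \<and> reduce U = Zero"
  shows "edge S T U V (ide (ob (reduce (Sum (Sum S T) (Sum U V)))))"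
proof -
  have J: "collapse (Sum (reduce P) (reduce Q)) \<in> Arr C"
    "Dom C (collapse (Sum (reduce P) (reduce Q))) = ob (reduce P) \<oplus> ob (reduce Q)"
    "Cod C (collapse (Sum (reduce P) (reduce Q))) = ob (reduce (Sum P Q))"
    if "tree P" "tree Q" for P Q :: "'o sumtree"
    using collapse_arr [of "Sum (reduce P) (reduce Q)"] that by (simp_all del: collapse.simps)
  have reduce_Sum: "reduce (Sum P Q) = reduce Q" if "reduce P = Zero" for P Q :: "'o sumtree"
    using that by simp
  have reduce_Sum': "reduce (Sum P Q) = reduce P" if "reduce Q = Zero" for P Q :: "'o sumtree"
    using that by simp
  have reduce_Sums: "reduce (Sum (Sum S T) (Sum U V)) = reduce (Sum (reduce (Sum S T)) (reduce (Sum U V)))"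
    by (rule reduce_Sum_reduce [symmetric])
  note [simp del] = collapse.simps(3) reduce.simps(3)
  from zeros show ?thesis
  proof (elim disjE conjE)
    assume "reduce T = Zero" "reduce V = Zero"
    then show ?thesis
      by (intro edgeI) (simp_all add: sq_def collapse_with_Zeros J reduce_Sum_reduce AC2_1
          reduce_Sums reduce_Sum')
  next
    assume "reduce S = Zero" "reduce U = Zero"
    then show ?thesis
      by (intro edgeI) (simp_all add: sq_def collapse_with_Zeros J reduce_Sum_reduce AC2_2
          reduce_Sums reduce_Sum)
  next
    assume "reduce U = Zero" "reduce V = Zero"
    then show ?thesis
      by (intro edgeI) (simp_all add: sq_def collapse_with_Zeros J reduce_Sum_reduce AC2_3
          reduce_Sums reduce_Sum')
  next
    assume "reduce S = Zero" "reduce T = Zero"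
    then show ?thesis
      by (intro edgeI) (simp_all add: sq_def collapse_with_Zeros J reduce_Sum_reduce AC2_4
          reduce_Sums reduce_Sum)
  next
    assume "reduce T = Zero" "reduce U = Zero"
    then show ?thesis
      by (intro edgeI) (simp_all add: sq_def collapse_with_Zeros J reduce_Sum_reduce AC3
          reduce_Sums reduce_Sum reduce_Sum')
  qed
qed

lemma canonical_a_apply:
  "\<lbrakk>x \<in> Obj C; y \<in> Obj C; z \<in> Obj C\<rbrakk> \<Longrightarrow> canonical_a x y z =
    (ide (x \<oplus> y) \<oplus>\<^sub>a l z) \<bullet> b x \<zero> y z \<bullet> (arr_inv C (r x) \<oplus>\<^sub>a ide (y \<oplus> z))"
  by (simp add: canonical_a_def)

lemma canonical_c_apply:
  "\<lbrakk>x \<in> Obj C; y \<in> Obj C\<rbrakk> \<Longrightarrow> canonical_c x y =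
    (l y \<oplus>\<^sub>a r x) \<bullet> b \<zero> x y \<zero> \<bullet> (arr_inv C (l x) \<oplus>\<^sub>a arr_inv C (r y))"
  by (simp add: canonical_c_def)

text \<open>
  The values of \<open>b\<close> with a single zero in the fourth or in the third place. They turn out to be an
  associator conjugate of a commutator (\<open>b_right_Zero_canonical_a\<close>) and an inverse associator
  (\<open>inv_canonical_a\<close>).
\<close>

definition b_right_Zero :: "'o \<Rightarrow> 'o \<Rightarrow> 'o \<Rightarrow> 'm" where
  "b_right_Zero x y z =
    (ide (x \<oplus> z) \<oplus>\<^sub>a r y) \<bullet> b x y z \<zero> \<bullet> (ide (x \<oplus> y) \<oplus>\<^sub>a arr_inv C (r z))"

definition b_third_Zero :: "'o \<Rightarrow> 'o \<Rightarrow> 'o \<Rightarrow> 'm" where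
  "b_third_Zero x y z =
    (r x \<oplus>\<^sub>a ide (y \<oplus> z)) \<bullet> b x y \<zero> z \<bullet> (ide (x \<oplus> y) \<oplus>\<^sub>a arr_inv C (l z))"

lemma edge_general:
  assumes [simp]: "tree S" "tree T" "tree U" "tree V"
    and "reduce S \<noteq> Zero" "reduce T \<noteq> Zero" "reduce U \<noteq> Zero" "reduce V \<noteq> Zero"
  shows "edge S T U V (b (ob (reduce S)) (ob (reduce T)) (ob (reduce U)) (ob (reduce V)))"
  by (rule edgeI) (simp_all add: sq_def assms(5-))

lemma edge_a:
  assumes [simp]: "tree S" "tree T" "tree U" "tree V"
    and "reduce S \<noteq> Zero" "reduce T = Zero" "reduce U \<noteq> Zero" "reduce V \<noteq> Zero"
  shows "edge S T U V (canonical_a (ob (reduce S)) (ob (reduce U)) (ob (reduce V)))"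
  by (rule edgeI) (simp_all add: sq_def assms(5-) canonical_a_apply tensa_comp)

lemma edge_c:
  assumes [simp]: "tree S" "tree T" "tree U" "tree V"
    and "reduce S = Zero" "reduce T \<noteq> Zero" "reduce U \<noteq> Zero" "reduce V = Zero"
  shows "edge S T U V (canonical_c (ob (reduce T)) (ob (reduce U)))"
  by (rule edgeI) (simp_all add: sq_def assms(5-) canonical_c_apply tensa_comp)

lemma edge_right_Zero:
  assumes [simp]: "tree S" "tree T" "tree U" "tree V"
    and "reduce S \<noteq> Zero" "reduce T \<noteq> Zero" "reduce U \<noteq> Zero" "reduce V = Zero"
  shows "edge S T U V (b_right_Zero (ob (reduce S)) (ob (reduce T)) (ob (reduce U)))"
  by (rule edgeI) (simp_all add: sq_def assms(5-) b_right_Zero_def tensa_comp)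

lemma edge_third_Zero:
  assumes [simp]: "tree S" "tree T" "tree U" "tree V"
    and "reduce S \<noteq> Zero" "reduce T \<noteq> Zero" "reduce U = Zero" "reduce V \<noteq> Zero"
  shows "edge S T U V (b_third_Zero (ob (reduce S)) (ob (reduce T)) (ob (reduce V)))"
  by (rule edgeI) (simp_all add: sq_def assms(5-) b_third_Zero_def tensa_comp)

abbreviation edge_pair ::
  "'o sumtree \<Rightarrow> 'o sumtree \<Rightarrow> 'o sumtree \<Rightarrow> 'o sumtree \<Rightarrow>
   'o sumtree \<Rightarrow> 'o sumtree \<Rightarrow> 'o sumtree \<Rightarrow> 'o sumtree \<Rightarrow> 'm \<Rightarrow> bool" where
  "edge_pair S T U V S' T' U' V' \<equiv> reduces
    (Sum (Sum (Sum S T) (Sum U V)) (Sum (Sum S' T') (Sum U' V')))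
    (Sum (Sum (Sum S U) (Sum T V)) (Sum (Sum S' U') (Sum T' V')))
    (b (ob S) (ob T) (ob U) (ob V) \<oplus>\<^sub>a b (ob S') (ob T') (ob U') (ob V'))"

lemma edge_pair_ide:
  assumes "edge S T U V (ide (ob (reduce (Sum (Sum S T) (Sum U V)))))"
    "edge S' T' U' V' (ide (ob (reduce (Sum (Sum S' T') (Sum U' V')))))"
    "reduce (Sum (Sum S U) (Sum T V)) = reduce (Sum (Sum S T) (Sum U V))"
    "reduce (Sum (Sum S' U') (Sum T' V')) = reduce (Sum (Sum S' T') (Sum U' V'))"
  shows "edge_pair S T U V S' T' U' V'
    (ide (ob (reduce (Sum (Sum (Sum S T) (Sum U V)) (Sum (Sum S' T') (Sum U' V'))))))"
  using reduces_Sum_ide [OF assms(1,2) [unfolded edge_def] assms(3,4)] .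

text \<open>
  The axiom \<open>AC1\<close> read modulo zeros. The bottom arrows of two squares along the same vertical arrows
  agree if the top ones do.
\<close>

lemma AC1_reduced:
  assumes "tree x" "tree y" "tree z" "tree t" "tree x'" "tree y'" "tree z'" "tree t'"
    and "edge_pair x y z t x' y' z' t' g1"
    and "edge (Sum x z) (Sum y t) (Sum x' z') (Sum y' t') g2"
    and "edge_pair x z x' z' y t y' t' g3"
    and "edge (Sum x y) (Sum z t) (Sum x' y') (Sum z' t') h1"
    and "edge_pair x y x' y' z t z' t' h2"
    and "edge (Sum x x') (Sum y y') (Sum z z') (Sum t t') h3"
  shows "g3 \<bullet> g2 \<bullet> g1 = h3 \<bullet> h2 \<bullet> h1"
proof -
  have "reduces (Sum (Sum (Sum x y) (Sum z t)) (Sum (Sum x' y') (Sum z' t')))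
      (Sum (Sum (Sum x x') (Sum z z')) (Sum (Sum y y') (Sum t t')))
      (((b (ob x) (ob z) (ob x') (ob z') \<oplus>\<^sub>a b (ob y) (ob t) (ob y') (ob t')) \<bullet>
        b (ob (Sum x z)) (ob (Sum y t)) (ob (Sum x' z')) (ob (Sum y' t'))) \<bullet>
        (b (ob x) (ob y) (ob z) (ob t) \<oplus>\<^sub>a b (ob x') (ob y') (ob z') (ob t'))) ((g3 \<bullet> g2) \<bullet> g1)"
    using reduces_comp [OF assms(9) reduces_comp [OF assms(10) [unfolded edge_def] assms(11)]] .
  moreover have "reduces (Sum (Sum (Sum x y) (Sum z t)) (Sum (Sum x' y') (Sum z' t')))
      (Sum (Sum (Sum x x') (Sum z z')) (Sum (Sum y y') (Sum t t')))
      ((b (ob (Sum x x')) (ob (Sum y y')) (ob (Sum z z')) (ob (Sum t t')) \<bullet>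
        (b (ob x) (ob y) (ob x') (ob y') \<oplus>\<^sub>a b (ob z) (ob t) (ob z') (ob t'))) \<bullet>
        b (ob (Sum x y)) (ob (Sum z t)) (ob (Sum x' y')) (ob (Sum z' t'))) ((h3 \<bullet> h2) \<bullet> h1)"
    using reduces_comp [OF assms(12) [unfolded edge_def]
        reduces_comp [OF assms(13) assms(14) [unfolded edge_def]]] .
  ultimately show ?thesis
    using AC1 [of "ob x" "ob y" "ob z" "ob t" "ob x'" "ob y'" "ob z'" "ob t'"] assms(1-8)
      reducesD(7-9) [OF assms(9)] reducesD(7-9) [OF assms(10) [unfolded edge_def]]
      reducesD(7-9) [OF assms(11)] reducesD(7-9) [OF assms(12) [unfolded edge_def]]
      reducesD(7-9) [OF assms(13)] reducesD(7-9) [OF assms(14) [unfolded edge_def]]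
    by (auto simp: reduces_def simp del: collapse.simps reduce.simps intro: sq_bottom_unique)
qed

end

section \<open>AC 2-groups are symmetric 2-groups\<close>

context ac_two_group
begin

lemma canonical_a_arr [simp]:
  assumes "x \<in> Obj C" "y \<in> Obj C" "z \<in> Obj C"
  shows "canonical_a x y z \<in> Arr C" "Dom C (canonical_a x y z) = x \<oplus> (y \<oplus> z)"
    "Cod C (canonical_a x y z) = (x \<oplus> y) \<oplus> z"
  using assms by (simp_all add: canonical_a_apply)

lemma canonical_c_arr [simp]:
  assumes "x \<in> Obj C" "y \<in> Obj C"
  shows "canonical_c x y \<in> Arr C" "Dom C (canonical_c x y) = x \<oplus> y"
    "Cod C (canonical_c x y) = y \<oplus> x"
  using assms by (simp_all add: canonical_c_apply)

lemma b_right_Zero_arr [simp]: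
  assumes "x \<in> Obj C" "y \<in> Obj C" "z \<in> Obj C"
  shows "b_right_Zero x y z \<in> Arr C" "Dom C (b_right_Zero x y z) = (x \<oplus> y) \<oplus> z"
    "Cod C (b_right_Zero x y z) = (x \<oplus> z) \<oplus> y"
  using assms by (simp_all add: b_right_Zero_def)

lemma b_third_Zero_arr [simp]:
  assumes "x \<in> Obj C" "y \<in> Obj C" "z \<in> Obj C"
  shows "b_third_Zero x y z \<in> Arr C" "Dom C (b_third_Zero x y z) = (x \<oplus> y) \<oplus> z"
    "Cod C (b_third_Zero x y z) = x \<oplus> (y \<oplus> z)"
  using assms by (simp_all add: b_third_Zero_def)

text \<open>
  This and the facts up to \<open>b_decomposition\<close> are \<open>AC1\<close> with zeros in most places. The places of the letters decide
  which edges reduce to identities and which to a value of \<open>b\<close> that is wanted.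
\<close>

lemma canonical_symmetry:
  assumes [simp]: "x \<in> Obj C" "y \<in> Obj C"
  shows "canonical_c y x \<bullet> canonical_c x y = ide (x \<oplus> y)"
  using AC1_reduced [of Zero Zero "At x" Zero Zero "At y" Zero Zero, OF _ _ _ _ _ _ _ _
      edge_pair_ide [OF edge_ide edge_ide] edge_ide edge_pair_ide [OF edge_ide edge_ide]
      edge_c edge_pair_ide [OF edge_ide edge_ide] edge_c]
  by simp

lemma canonical_a_b_third_Zero:
  assumes [simp]: "x \<in> Obj C" "y \<in> Obj C" "z \<in> Obj C"
  shows "canonical_a x y z \<bullet> b_third_Zero x y z = ide ((x \<oplus> y) \<oplus> z)"
  using AC1_reduced [of "At x" Zero "At y" Zero Zero Zero Zero "At z", OF _ _ _ _ _ _ _ _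
      edge_pair_ide [OF edge_ide edge_ide] edge_ide edge_pair_ide [OF edge_ide edge_ide]
      edge_third_Zero edge_pair_ide [OF edge_ide edge_ide] edge_a]
  by simp

lemma canonical_pentagon:
  assumes [simp]: "x \<in> Obj C" "y \<in> Obj C" "z \<in> Obj C" "t \<in> Obj C"
  shows "canonical_a (x \<oplus> y) z t \<bullet> canonical_a x y (z \<oplus> t) =
    (canonical_a x y z \<oplus>\<^sub>a ide t) \<bullet> canonical_a x (y \<oplus> z) t \<bullet> (ide x \<oplus>\<^sub>a canonical_a y z t)"
  using AC1_reduced [of "At x" Zero Zero Zero "At y" Zero "At z" "At t", OF _ _ _ _ _ _ _ _
      reduces_Sum_nonzero [OF edge_ide [unfolded edge_def] edge_a [unfolded edge_def]] edge_a
      reduces_Sum_nonzero [OF edge_a [unfolded edge_def] edge_ide [unfolded edge_def]]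
      edge_a edge_pair_ide [OF edge_ide edge_ide] edge_a]
  by simp

lemma canonical_hexagon_b:
  assumes [simp]: "x \<in> Obj C" "y \<in> Obj C" "z \<in> Obj C"
  shows "(canonical_c x z \<oplus>\<^sub>a ide y) \<bullet> b_right_Zero x y z = canonical_a z x y \<bullet> canonical_c (x \<oplus> y) z"
  using AC1_reduced [of Zero Zero "At x" "At y" "At z" Zero Zero Zero, OF _ _ _ _ _ _ _ _
      edge_pair_ide [OF edge_ide edge_ide] edge_right_Zero
      reduces_Sum_nonzero [OF edge_c [unfolded edge_def] edge_ide [unfolded edge_def]]
      edge_c edge_pair_ide [OF edge_ide edge_ide] edge_a]
  by simp

lemma b_right_Zero_canonical_a:
  assumes [simp]: "x \<in> Obj C" "y \<in> Obj C" "z \<in> Obj C"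
  shows "b_right_Zero x y z \<bullet> canonical_a x y z = canonical_a x z y \<bullet> (ide x \<oplus>\<^sub>a canonical_c y z)"
  using AC1_reduced [of "At x" Zero Zero Zero Zero "At y" "At z" Zero, OF _ _ _ _ _ _ _ _
      reduces_Sum_nonzero [OF edge_ide [unfolded edge_def] edge_c [unfolded edge_def]] edge_a
      edge_pair_ide [OF edge_ide edge_ide]
      edge_a edge_pair_ide [OF edge_ide edge_ide] edge_right_Zero]
  by simp

text \<open>
  Moving \<open>t\<close> out of the way reduces \<open>b\<close> to its values with a zero in the fourth place.
\<close>

lemma b_decomposition:
  assumes [simp]: "x \<in> Obj C" "y \<in> Obj C" "z \<in> Obj C" "t \<in> Obj C"
  shows "b x y z t \<bullet> b_third_Zero (x \<oplus> y) z t =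
    b_third_Zero (x \<oplus> z) y t \<bullet> (b_right_Zero x y z \<oplus>\<^sub>a ide t)"
  using AC1_reduced [of "At x" "At y" "At z" Zero Zero Zero Zero "At t", OF _ _ _ _ _ _ _ _
      reduces_Sum_nonzero [OF edge_right_Zero [unfolded edge_def] edge_ide [unfolded edge_def]]
      edge_third_Zero edge_pair_ide [OF edge_ide edge_ide]
      edge_third_Zero edge_pair_ide [OF edge_ide edge_ide] edge_general]
  by simp

lemma inv_canonical_a:
  "\<lbrakk>x \<in> Obj C; y \<in> Obj C; z \<in> Obj C\<rbrakk> \<Longrightarrow> arr_inv C (canonical_a x y z) = b_third_Zero x y z"
  using arg_cong [OF canonical_a_b_third_Zero, of x y z "\<lambda>f. arr_inv C (canonical_a x y z) \<bullet> f"]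
  by simp

lemma sq_canonical_a:
  assumes [simp]: "f \<in> Arr C" "g \<in> Arr C" "h \<in> Arr C"
  shows "sq (f \<oplus>\<^sub>a (g \<oplus>\<^sub>a h)) ((f \<oplus>\<^sub>a g) \<oplus>\<^sub>a h)
    (canonical_a (Dom C f) (Dom C g) (Dom C h)) (canonical_a (Cod C f) (Cod C g) (Cod C h))"
proof -
  note 1 = sq_tensa [OF sq_inv [OF sq_transpose [OF sq_r [of f]]] sq_ide [of "g \<oplus>\<^sub>a h"]]
  note 2 = sq_b [of f "ide \<zero>" g h]
  note 3 = sq_tensa [OF sq_ide [of "f \<oplus>\<^sub>a g"] sq_transpose [OF sq_l [of h]]]
  show ?thesis
    using sq_comp [OF sq_comp [OF 1 2] 3] by (simp add: canonical_a_apply)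
qed

lemma sq_canonical_c:
  assumes [simp]: "f \<in> Arr C" "g \<in> Arr C"
  shows "sq (f \<oplus>\<^sub>a g) (g \<oplus>\<^sub>a f) (canonical_c (Dom C f) (Dom C g)) (canonical_c (Cod C f) (Cod C g))"
proof -
  note 1 = sq_tensa [OF sq_inv [OF sq_transpose [OF sq_l [of f]]] sq_inv [OF sq_transpose [OF sq_r [of g]]]]
  note 2 = sq_b [of "ide \<zero>" f g "ide \<zero>"]
  note 3 = sq_tensa [OF sq_transpose [OF sq_l [of g]] sq_transpose [OF sq_r [of f]]]
  show ?thesis
    using sq_comp [OF sq_comp [OF 1 2] 3] by (simp add: canonical_c_apply)
qed

text \<open>
  The hexagon is glued from its two halves \<open>canonical_hexagon_b\<close> and \<open>b_right_Zero_canonical_a\<close>; the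
  triangle is \<open>AC3\<close>.
\<close>

theorem symmetric_two_group_canonical: "symmetric_two_group C (\<oplus>) (\<oplus>\<^sub>a) \<zero> l r canonical_a canonical_c"
proof unfold_locales
  show "canonical_a \<in> (\<Pi>\<^sub>E x\<in>Obj C. \<Pi>\<^sub>E y\<in>Obj C. \<Pi>\<^sub>E z\<in>Obj C.
      iso_hom C (x \<oplus> (y \<oplus> z)) ((x \<oplus> y) \<oplus> z))"
    unfolding canonical_a_def
    by (intro restrict_PiE_iff [THEN iffD2] ballI) (simp add: iso_hom_eq_hom hom_def)
  show "canonical_c \<in> (\<Pi>\<^sub>E x\<in>Obj C. \<Pi>\<^sub>E y\<in>Obj C. iso_hom C (x \<oplus> y) (y \<oplus> x))"
    unfolding canonical_c_def
    by (intro restrict_PiE_iff [THEN iffD2] ballI) (simp add: iso_hom_eq_hom hom_def)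
next
  fix f g h
  assume "f \<in> Arr C" "g \<in> Arr C" "h \<in> Arr C"
  then show "canonical_a (Cod C f) (Cod C g) (Cod C h) \<bullet> (f \<oplus>\<^sub>a (g \<oplus>\<^sub>a h)) =
      ((f \<oplus>\<^sub>a g) \<oplus>\<^sub>a h) \<bullet> canonical_a (Dom C f) (Dom C g) (Dom C h)"
    using sqD(9) [OF sq_canonical_a] by simp
next
  fix f g
  assume "f \<in> Arr C" "g \<in> Arr C"
  then show "canonical_c (Cod C f) (Cod C g) \<bullet> (f \<oplus>\<^sub>a g) = (g \<oplus>\<^sub>a f) \<bullet> canonical_c (Dom C f) (Dom C g)"
    using sqD(9) [OF sq_canonical_c] by simp
next
  fix x y
  assume [simp]: "x \<in> Obj C" "y \<in> Obj C"
  show "(r x \<oplus>\<^sub>a ide y) \<bullet> canonical_a x \<zero> y = ide x \<oplus>\<^sub>a l y"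
    by (simp add: canonical_a_apply AC3 tensa_comp)
  show "canonical_c y x \<bullet> canonical_c x y = ide (x \<oplus> y)"
    by (rule canonical_symmetry) simp_all
next
  fix x y z
  assume [simp]: "x \<in> Obj C" "y \<in> Obj C" "z \<in> Obj C"
  have "canonical_a z x y \<bullet> canonical_c (x \<oplus> y) z \<bullet> canonical_a x y z =
      (canonical_a z x y \<bullet> canonical_c (x \<oplus> y) z) \<bullet> canonical_a x y z"
    by simp
  also have "\<dots> = (canonical_c x z \<oplus>\<^sub>a ide y) \<bullet> (b_right_Zero x y z \<bullet> canonical_a x y z)"
    by (simp flip: canonical_hexagon_b)
  finally show "canonical_a z x y \<bullet> canonical_c (x \<oplus> y) z \<bullet> canonical_a x y z =
      (canonical_c x z \<oplus>\<^sub>a ide y) \<bullet> canonical_a x z y \<bullet> (ide x \<oplus>\<^sub>a canonical_c y z)"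
    by (simp add: b_right_Zero_canonical_a)
next
  fix x y z t
  assume "x \<in> Obj C" "y \<in> Obj C" "z \<in> Obj C" "t \<in> Obj C"
  then show "canonical_a (x \<oplus> y) z t \<bullet> canonical_a x y (z \<oplus> t) =
    (canonical_a x y z \<oplus>\<^sub>a ide t) \<bullet> canonical_a x (y \<oplus> z) t \<bullet> (ide x \<oplus>\<^sub>a canonical_a y z t)"
    by (rule canonical_pentagon)
qed

text \<open>
  By \<open>b_decomposition\<close> the given \<open>b\<close> is a composite of canonical associators and commutators, in an
  order different from that in the definition of the canonical associo-commutator. Both composites
  exchange the two middle letters, so coherence applies.
\<close>

lemma canonical_b_canonical:
  "symmetric_two_group.canonical_b C (\<oplus>) (\<oplus>\<^sub>a) canonical_a canonical_c = b"
proof -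
  interpret sm: symmetric_two_group C "(\<oplus>)" "(\<oplus>\<^sub>a)" \<zero> l r canonical_a canonical_c
    by (rule symmetric_two_group_canonical)
  show ?thesis
  proof (rule ext)+
    fix x y z t
    show "sm.canonical_b x y z t = b x y z t"
    proof (cases "x \<in> Obj C \<and> y \<in> Obj C \<and> z \<in> Obj C \<and> t \<in> Obj C")
      case True
      then have [simp]: "x \<in> Obj C" "y \<in> Obj C" "z \<in> Obj C" "t \<in> Obj C" by auto
      let ?x = "At x" and ?y = "At y" and ?z = "At z" and ?t = "At t"
      have b_right: "b_right_Zero x y z =
          canonical_a x z y \<bullet> (ide x \<oplus>\<^sub>a canonical_c y z) \<bullet> arr_inv C (canonical_a x y z)"
        using arg_cong [OF b_right_Zero_canonical_a, of x y z "\<lambda>f. f \<bullet> arr_inv C (canonical_a x y z)"]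
        by simp
      have 1: "sm.represents (Sum (Sum ?x ?y) ?z) (Sum (Sum ?x ?z) ?y) (b_right_Zero x y z) [1]"
        using sm.represents_comp [OF sm.represents_comp [OF
            sm.represents_inv [OF sm.represents_a [of ?x ?y ?z]]
            sm.represents_sum [OF sm.represents_ide [of ?x] sm.represents_c_At [of y z]]]
            sm.represents_a [of ?x ?z ?y]]
        by (simp add: b_right)
      have "b x y z t = arr_inv C (canonical_a (x \<oplus> z) y t) \<bullet> (b_right_Zero x y z \<oplus>\<^sub>a ide t) \<bullet>
          canonical_a (x \<oplus> y) z t"
        using arg_cong [OF b_decomposition, of x y z t "\<lambda>f. f \<bullet> canonical_a (x \<oplus> y) z t"]
        by (simp flip: inv_canonical_a)
      then have "sm.represents (Sum (Sum ?x ?y) (Sum ?z ?t)) (Sum (Sum ?x ?z) (Sum ?y ?t)) (b x y z t) [1]"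
        using sm.represents_comp [OF sm.represents_comp [OF sm.represents_a [of "Sum ?x ?y" ?z ?t]
            sm.represents_sum [OF 1 sm.represents_ide [of ?t]]]
            sm.represents_inv [OF sm.represents_a [of "Sum ?x ?z" ?y ?t]]]
        by simp
      then show ?thesis
        using sm.symmetric_coherence [OF sm.represents_canonical_b_At _ coxeter_refl] by simp
    next
      case False
      then show ?thesis
        using PiE_arb [OF b_type, of x] PiE_arb [OF PiE_mem [OF b_type], of x y]
          PiE_arb [OF PiE_mem [OF PiE_mem [OF b_type]], of x y z]
          PiE_arb [OF PiE_mem [OF PiE_mem [OF PiE_mem [OF b_type]]], of x y z t]
        by (auto simp: sm.canonical_b_def restrict_def)
    qed
  qed
qed

end

section \<open>Monoidal endofunctors of 2-groups\<close>

text \<open>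
  The part of a unital endofunctor that does not involve the zero isomorphism, which here is still to
  be found.
\<close>

locale sum_endofunctor = pre_two_group C plus plusa zero l r
  for C :: "('o, 'm) cat" (structure)
    and plus (infixl "\<oplus>" 65) and plusa (infixl "\<oplus>\<^sub>a" 65) and zero ("\<zero>") and l and r +
  fixes F :: "('o, 'm) endo"
  assumes is_endofunctor: "endofunctor (eob F) (ear F)"
    and esum_hom: "\<lbrakk>x \<in> Obj C; y \<in> Obj C\<rbrakk> \<Longrightarrow> esum F x y \<in> hom C (eob F x \<oplus> eob F y) (eob F (x \<oplus> y))"
    and esum_natural: "\<lbrakk>f \<in> Arr C; g \<in> Arr C\<rbrakk> \<Longrightarrow>
      esum F (Cod C f) (Cod C g) \<bullet> (ear F f \<oplus>\<^sub>a ear F g) =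
      ear F (f \<oplus>\<^sub>a g) \<bullet> esum F (Dom C f) (Dom C g)"
begin

lemma eob_Obj [simp]: "x \<in> Obj C \<Longrightarrow> eob F x \<in> Obj C"
  using is_endofunctor by (simp add: endofunctor_def)

lemma ear_arr [simp]:
  assumes "f \<in> Arr C"
  shows "ear F f \<in> Arr C" "Dom C (ear F f) = eob F (Dom C f)" "Cod C (ear F f) = eob F (Cod C f)"
  using is_endofunctor assms by (auto simp: endofunctor_def hom_def)

lemma ear_ide [simp]: "x \<in> Obj C \<Longrightarrow> ear F (ide x) = ide (eob F x)"
  using is_endofunctor by (simp add: endofunctor_def)

lemma ear_comp:
  "\<lbrakk>f \<in> Arr C; g \<in> Arr C; Cod C f = Dom C g\<rbrakk> \<Longrightarrow> ear F (g \<bullet> f) = ear F g \<bullet> ear F f"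
  using is_endofunctor by (simp add: endofunctor_def)

lemma ear_inv: "f \<in> Arr C \<Longrightarrow> ear F (arr_inv C f) = arr_inv C (ear F f)"
  by (rule inv_unique [symmetric]) (simp_all flip: ear_comp)

lemma esum_arr [simp]:
  assumes "x \<in> Obj C" "y \<in> Obj C"
  shows "esum F x y \<in> Arr C" "Dom C (esum F x y) = eob F x \<oplus> eob F y"
    "Cod C (esum F x y) = eob F (x \<oplus> y)"
  using hom_arrD [OF esum_hom [OF assms]] .

lemma sq_esum:
  "\<lbrakk>f \<in> Arr C; g \<in> Arr C\<rbrakk> \<Longrightarrow>
    sq (esum F (Dom C f) (Dom C g)) (esum F (Cod C f) (Cod C g))
      (ear F f \<oplus>\<^sub>a ear F g) (ear F (f \<oplus>\<^sub>a g))"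
  by (rule sqI) (simp_all add: esum_natural)

end

locale sum_zero_endofunctor = sum_endofunctor C plus plusa zero l r F
  for C :: "('o, 'm) cat" (structure)
    and plus (infixl "\<oplus>" 65) and plusa (infixl "\<oplus>\<^sub>a" 65) and zero ("\<zero>") and l and r
    and F :: "('o, 'm) endo" +
  assumes ezero_hom: "ezero F \<in> hom C \<zero> (eob F \<zero>)"
    and r_axiom: "x \<in> Obj C \<Longrightarrow>
      ear F (r x) \<bullet> esum F x \<zero> \<bullet> (ide (eob F x) \<oplus>\<^sub>a ezero F) = r (eob F x)"
    and l_axiom: "x \<in> Obj C \<Longrightarrow>
      ear F (l x) \<bullet> esum F \<zero> x \<bullet> (ezero F \<oplus>\<^sub>a ide (eob F x)) = l (eob F x)"
begin

lemma ezero_arr [simp]: "ezero F \<in> Arr C" "Dom C (ezero F) = \<zero>" "Cod C (ezero F) = eob F \<zero>"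
  using hom_arrD [OF ezero_hom] .

abbreviation image :: "'o sumtree \<Rightarrow> 'o sumtree" where
  "image \<equiv> map_sumtree (eob F)"

text \<open>
  The structure arrows of \<open>F\<close> assemble to a comparison of a formal sum of images with the image of
  the sum; \<open>preserves\<close> expresses that the structural arrows \<open>f\<close> and \<open>g\<close> correspond under it.
\<close>

primrec compare :: "'o sumtree \<Rightarrow> 'm" where
  "compare Zero = ezero F"
| "compare (At x) = ide (eob F x)"
| "compare (Sum S T) = esum F (ob S) (ob T) \<bullet> (compare S \<oplus>\<^sub>a compare T)"

lemma tree_image [simp]: "tree S \<Longrightarrow> tree (image S)"
  by (induction S) auto

lemma compare_arr [simp]:
  assumes "tree S"
  shows "compare S \<in> Arr C" "Dom C (compare S) = ob (image S)" "Cod C (compare S) = eob F (ob S)"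
proof -
  have "tree S \<longrightarrow>
      compare S \<in> Arr C \<and> Dom C (compare S) = ob (image S) \<and> Cod C (compare S) = eob F (ob S)"
    by (induction S) auto
  then show "compare S \<in> Arr C" "Dom C (compare S) = ob (image S)"
    "Cod C (compare S) = eob F (ob S)"
    using assms by auto
qed

definition preserves :: "'o sumtree \<Rightarrow> 'o sumtree \<Rightarrow> 'm \<Rightarrow> 'm \<Rightarrow> bool" where
  "preserves S T f g \<longleftrightarrow> tree S \<and> tree T \<and> f \<in> hom C (ob S) (ob T) \<and>
    sq (compare S) (compare T) g (ear F f)"

lemma preservesI:
  "\<lbrakk>tree S; tree T; f \<in> Arr C; Dom C f = ob S; Cod C f = ob T;
    sq (compare S) (compare T) g (ear F f)\<rbrakk> \<Longrightarrow> preserves S T f g"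
  by (auto simp: preserves_def)

lemma preservesD:
  assumes "preserves S T f g"
  shows "tree S" "tree T" "f \<in> Arr C" "Dom C f = ob S" "Cod C f = ob T"
    "sq (compare S) (compare T) g (ear F f)"
    "g \<in> Arr C" "Dom C g = ob (image S)" "Cod C g = ob (image T)"
  using assms sqD [of "compare S" "compare T" g "ear F f"]
  by (auto simp: preserves_def hom_def)

lemma preserves_ide: "tree S \<Longrightarrow> preserves S S (ide (ob S)) (ide (ob (image S)))"
  using sq_ide [of "compare S"] by (intro preservesI) simp_all

lemma preserves_comp:
  assumes "preserves S T f g" "preserves T U f' g'"
  shows "preserves S U (f' \<bullet> f) (g' \<bullet> g)"
  using sq_comp [OF preservesD(6) [OF assms(1)] preservesD(6) [OF assms(2)]]
    preservesD(1-5) [OF assms(1)] preservesD(1-5) [OF assms(2)]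
  by (intro preservesI) (simp_all add: ear_comp)

lemma preserves_inv:
  assumes "preserves S T f g"
  shows "preserves T S (arr_inv C f) (arr_inv C g)"
  using sq_inv [OF preservesD(6) [OF assms]] preservesD(1-5) [OF assms]
  by (intro preservesI) (simp_all add: ear_inv)

lemma preserves_sum:
  assumes "preserves S T f g" "preserves S' T' f' g'"
  shows "preserves (Sum S S') (Sum T T') (f \<oplus>\<^sub>a f') (g \<oplus>\<^sub>a g')"
  using sq_stack [OF sq_tensa [OF preservesD(6) [OF assms(1)] preservesD(6) [OF assms(2)]]
      sq_esum [of f f']]
    preservesD(1-5) [OF assms(1)] preservesD(1-5) [OF assms(2)]
  by (intro preservesI) simp_all

lemma preserves_l:
  assumes [simp]: "tree S"
  shows "preserves (Sum Zero S) S (l (ob S)) (l (ob (image S)))"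
proof (intro preservesI sqI)
  have "ear F (l (ob S)) \<bullet> compare (Sum Zero S) =
      (ear F (l (ob S)) \<bullet> esum F \<zero> (ob S) \<bullet> (ezero F \<oplus>\<^sub>a ide (eob F (ob S)))) \<bullet> (ide \<zero> \<oplus>\<^sub>a compare S)"
    by (simp add: tensa_comp)
  also have "\<dots> = compare S \<bullet> l (ob (image S))"
    using l_natural [of "compare S"] by (subst l_axiom) simp_all
  finally show "compare S \<bullet> l (ob (image S)) = ear F (l (ob S)) \<bullet> compare (Sum Zero S)"
    by simp
qed simp_all

lemma preserves_r:
  assumes [simp]: "tree S"
  shows "preserves (Sum S Zero) S (r (ob S)) (r (ob (image S)))"
proof (intro preservesI sqI)
  have "ear F (r (ob S)) \<bullet> compare (Sum S Zero) =
      (ear F (r (ob S)) \<bullet> esum F (ob S) \<zero> \<bullet> (ide (eob F (ob S)) \<oplus>\<^sub>a ezero F)) \<bullet> (compare S \<oplus>\<^sub>a ide \<zero>)"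
    by (simp add: tensa_comp)
  also have "\<dots> = compare S \<bullet> r (ob (image S))"
    using r_natural [of "compare S"] by (subst r_axiom) simp_all
  finally show "compare S \<bullet> r (ob (image S)) = ear F (r (ob S)) \<bullet> compare (Sum S Zero)"
    by simp
qed simp_all

end

lemma (in pre_two_group) unital_endofunctor_iff:
  "unital_endofunctor F \<longleftrightarrow> sum_zero_endofunctor C (\<oplus>) (\<oplus>\<^sub>a) \<zero> l r F"
proof
  assume "unital_endofunctor F"
  then show "sum_zero_endofunctor C (\<oplus>) (\<oplus>\<^sub>a) \<zero> l r F"
    by unfold_locales (simp_all add: unital_endofunctor_def iso_hom_eq_hom)
next
  assume "sum_zero_endofunctor C (\<oplus>) (\<oplus>\<^sub>a) \<zero> l r F"
  then interpret sum_zero_endofunctor C "(\<oplus>)" "(\<oplus>\<^sub>a)" \<zero> l r F .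
  show "unital_endofunctor F"
    using is_endofunctor esum_hom esum_natural ezero_hom r_axiom l_axiom
    by (simp add: unital_endofunctor_def iso_hom_eq_hom)
qed

context symmetric_two_group
begin

text \<open>
  Preserved arrows are closed under composition, sums and inverses, and \<open>canonical_b\<close> is obtained in
  this way from associators and commutators.
\<close>

lemma symmetric_monoidal_endofunctor_imp_ac:
  assumes "symmetric_monoidal_endofunctor F"
  shows "ac_two_group.ac_endofunctor C (\<oplus>) (\<oplus>\<^sub>a) \<zero> l r canonical_b F"
proof -
  interpret ac: ac_two_group C "(\<oplus>)" "(\<oplus>\<^sub>a)" \<zero> l r canonical_b
    by (rule ac_two_group_canonical_b)
  interpret F: sum_zero_endofunctor C "(\<oplus>)" "(\<oplus>\<^sub>a)" \<zero> l r F
    using assms by (simp add: symmetric_monoidal_endofunctor_def unital_endofunctor_iff)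
  have a: "F.preserves (Sum S (Sum T U)) (Sum (Sum S T) U)
      (a (ob S) (ob T) (ob U)) (a (ob (F.image S)) (ob (F.image T)) (ob (F.image U)))"
    if [simp]: "tree S" "tree T" "tree U" for S T U
  proof (rule F.preservesI)
    let ?s = "ob S" and ?t = "ob T" and ?u = "ob U"
    have 1: "sq (esum F ?s (?t \<oplus> ?u) \<bullet> (ide (eob F ?s) \<oplus>\<^sub>a esum F ?t ?u))
        (esum F (?s \<oplus> ?t) ?u \<bullet> (esum F ?s ?t \<oplus>\<^sub>a ide (eob F ?u)))
        (a (eob F ?s) (eob F ?t) (eob F ?u)) (ear F (a ?s ?t ?u))"
      using assms by (intro sqI) (simp_all add: symmetric_monoidal_endofunctor_def)
    have 2: "sq (F.compare S \<oplus>\<^sub>a (F.compare T \<oplus>\<^sub>a F.compare U)) ((F.compare S \<oplus>\<^sub>a F.compare T) \<oplus>\<^sub>a F.compare U)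
        (a (ob (F.image S)) (ob (F.image T)) (ob (F.image U))) (a (eob F ?s) (eob F ?t) (eob F ?u))"
      using sq_a [of "F.compare S" "F.compare T" "F.compare U"] by simp
    show "sq (F.compare (Sum S (Sum T U))) (F.compare (Sum (Sum S T) U))
        (a (ob (F.image S)) (ob (F.image T)) (ob (F.image U))) (ear F (a ?s ?t ?u))"
      using sq_stack [OF 2 1] by (simp add: tensa_comp)
  qed simp_all
  have c: "F.preserves (Sum (At x) (At y)) (Sum (At y) (At x)) (c x y) (c (eob F x) (eob F y))"
    if "x \<in> Obj C" "y \<in> Obj C" for x y
    using assms that
    by (intro F.preservesI sqI) (simp_all add: symmetric_monoidal_endofunctor_def)
  have "F.preserves (Sum (Sum (At x) (At y)) (Sum (At z) (At t))) (Sum (Sum (At x) (At z)) (Sum (At y) (At t)))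
      (canonical_b x y z t) (canonical_b (eob F x) (eob F y) (eob F z) (eob F t))"
    if [simp]: "x \<in> Obj C" "y \<in> Obj C" "z \<in> Obj C" "t \<in> Obj C" for x y z t
  proof -
    let ?x = "At x" and ?y = "At y" and ?z = "At z" and ?t = "At t"
    note x = F.preserves_ide [of ?x] and t = F.preserves_ide [of ?t]
    note 1 = F.preserves_inv [OF a [of ?x ?y "Sum ?z ?t"]]
    note 2 = F.preserves_sum [OF x a [of ?y ?z ?t]]
    note 3 = F.preserves_sum [OF x F.preserves_sum [OF c [of y z] t]]
    note 4 = F.preserves_sum [OF x F.preserves_inv [OF a [of ?z ?y ?t]]]
    note 5 = a [of ?x ?z "Sum ?y ?t"]
    show ?thesis
      using F.preserves_comp [OF F.preserves_comp [OF F.preserves_comp [OF F.preserves_comp [OF 1 2] 3] 4] 5]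
      by (simp add: canonical_b_apply)
  qed
  from sqD(9) [OF F.preservesD(6) [OF this]]
  show ?thesis
    using assms by (simp add: ac.ac_endofunctor_def symmetric_monoidal_endofunctor_def)
qed

end

context ac_two_group
begin

text \<open>
  Conversely the canonical associators and commutators are obtained from \<open>b\<close> and the unitors; the
  unit axioms say that the unitors are preserved.
\<close>

lemma ac_endofunctor_imp_symmetric_monoidal:
  assumes "ac_endofunctor F"
  shows "symmetric_two_group.symmetric_monoidal_endofunctor C (\<oplus>) (\<oplus>\<^sub>a) \<zero> l r canonical_a canonical_c F"
proof -
  interpret sm: symmetric_two_group C "(\<oplus>)" "(\<oplus>\<^sub>a)" \<zero> l r canonical_a canonical_c
    by (rule symmetric_two_group_canonical)
  interpret F: sum_zero_endofunctor C "(\<oplus>)" "(\<oplus>\<^sub>a)" \<zero> l r F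
    using assms by (simp add: ac_endofunctor_def unital_endofunctor_iff)
  have b: "F.preserves (Sum (Sum S T) (Sum U V)) (Sum (Sum S U) (Sum T V)) (b (ob S) (ob T) (ob U) (ob V))
      (b (ob (F.image S)) (ob (F.image T)) (ob (F.image U)) (ob (F.image V)))"
    if [simp]: "tree S" "tree T" "tree U" "tree V" for S T U V
  proof (rule F.preservesI)
    let ?s = "ob S" and ?t = "ob T" and ?u = "ob U" and ?v = "ob V"
    have 1: "sq (esum F (?s \<oplus> ?t) (?u \<oplus> ?v) \<bullet> (esum F ?s ?t \<oplus>\<^sub>a esum F ?u ?v))
        (esum F (?s \<oplus> ?u) (?t \<oplus> ?v) \<bullet> (esum F ?s ?u \<oplus>\<^sub>a esum F ?t ?v))
        (b (eob F ?s) (eob F ?t) (eob F ?u) (eob F ?v)) (ear F (b ?s ?t ?u ?v))"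
      using assms by (intro sqI) (simp_all add: ac_endofunctor_def)
    have 2: "sq ((F.compare S \<oplus>\<^sub>a F.compare T) \<oplus>\<^sub>a (F.compare U \<oplus>\<^sub>a F.compare V))
        ((F.compare S \<oplus>\<^sub>a F.compare U) \<oplus>\<^sub>a (F.compare T \<oplus>\<^sub>a F.compare V))
        (b (ob (F.image S)) (ob (F.image T)) (ob (F.image U)) (ob (F.image V)))
        (b (eob F ?s) (eob F ?t) (eob F ?u) (eob F ?v))"
      using sq_b [of "F.compare S" "F.compare T" "F.compare U" "F.compare V"] by simp
    show "sq (F.compare (Sum (Sum S T) (Sum U V))) (F.compare (Sum (Sum S U) (Sum T V)))
        (b (ob (F.image S)) (ob (F.image T)) (ob (F.image U)) (ob (F.image V))) (ear F (b ?s ?t ?u ?v))"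
      using sq_stack [OF 2 1] by (simp add: tensa_comp)
  qed simp_all
  have a: "F.preserves (Sum (At x) (Sum (At y) (At z))) (Sum (Sum (At x) (At y)) (At z))
      (canonical_a x y z) (canonical_a (eob F x) (eob F y) (eob F z))"
    if [simp]: "x \<in> Obj C" "y \<in> Obj C" "z \<in> Obj C" for x y z
    using F.preserves_comp [OF F.preserves_comp [OF
        F.preserves_sum [OF F.preserves_inv [OF F.preserves_r [of "At x"]] F.preserves_ide [of "Sum (At y) (At z)"]]
        b [of "At x" Zero "At y" "At z"]]
        F.preserves_sum [OF F.preserves_ide [of "Sum (At x) (At y)"] F.preserves_l [of "At z"]]]
    by (simp add: canonical_a_apply)
  have c: "F.preserves (Sum (At x) (At y)) (Sum (At y) (At x))
      (canonical_c x y) (canonical_c (eob F x) (eob F y))"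
    if [simp]: "x \<in> Obj C" "y \<in> Obj C" for x y
    using F.preserves_comp [OF F.preserves_comp [OF
        F.preserves_sum [OF F.preserves_inv [OF F.preserves_l [of "At x"]] F.preserves_inv [OF F.preserves_r [of "At y"]]]
        b [of Zero "At x" "At y" Zero]]
        F.preserves_sum [OF F.preserves_l [of "At y"] F.preserves_r [of "At x"]]]
    by (simp add: canonical_c_apply)
  show ?thesis
    using assms sqD(9) [OF F.preservesD(6) [OF a]] sqD(9) [OF F.preservesD(6) [OF c]]
    by (simp add: sm.symmetric_monoidal_endofunctor_def ac_endofunctor_def)
qed

end

section \<open>Zero isomorphisms\<close>

context symmetric_two_group
begin

lemma r_tensor:
  assumes [simp]: "x \<in> Obj C" "y \<in> Obj C"
  shows "r (x \<oplus> y) \<bullet> a x y \<zero> = ide x \<oplus>\<^sub>a r y"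
  using symmetric_coherence [OF
      represents_comp [OF represents_a [of "At x" "At y" Zero] represents_r [of "Sum (At x) (At y)"]]
      represents_sum [OF represents_ide [of "At x"] represents_r [of "At y"]]] coxeter_refl
  by simp

lemma r_c_zero:
  assumes [simp]: "x \<in> Obj C"
  shows "r x \<bullet> c \<zero> x = l x"
  using symmetric_coherence [OF
      represents_comp [OF represents_c_Zero [of "At x"] represents_r [of "At x"]]
      represents_l [of "At x"]] coxeter_refl
  by simp

lemma r_zero: "r \<zero> = l \<zero>"
  using symmetric_coherence [OF represents_r [of Zero] represents_l [of Zero]] coxeter_refl by simp

text \<open>
  With \<open>y\<close> a weak inverse of \<open>x\<close>, the functor \<open>y + (x + -)\<close> is isomorphic to the identity. So
  \<open>x + -\<close> is faithful, and, as \<open>y + -\<close> is faithful for the same reason, also full.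
\<close>

lemma sum_left_unit:
  assumes [simp]: "x \<in> Obj C"
  obtains y k where "y \<in> Obj C" "\<And>w. w \<in> Obj C \<Longrightarrow> k w \<in> hom C w (y \<oplus> (x \<oplus> w))"
    "\<And>f. f \<in> Arr C \<Longrightarrow> (ide y \<oplus>\<^sub>a (ide x \<oplus>\<^sub>a f)) \<bullet> k (Dom C f) = k (Cod C f) \<bullet> f"
proof -
  obtain y i where y [simp]: "y \<in> Obj C" and i: "i \<in> iso_hom C \<zero> (y \<oplus> x)"
    using weak_inverse [OF assms] by blast
  note [simp] = iso_hom_arrD [OF i]
  define k where "k w = arr_inv C (a y x w) \<bullet> (i \<oplus>\<^sub>a ide w) \<bullet> arr_inv C (l w)" for w
  show thesis
  proof
    show "y \<in> Obj C" by (rule y)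
    show "k w \<in> hom C w (y \<oplus> (x \<oplus> w))" if "w \<in> Obj C" for w
      using that by (intro homI) (simp_all add: k_def)
    fix f
    assume [simp]: "f \<in> Arr C"
    have 1: "sq f (ide \<zero> \<oplus>\<^sub>a f) (arr_inv C (l (Dom C f))) (arr_inv C (l (Cod C f)))"
      by (rule sq_inv [OF sq_transpose [OF sq_l]]) simp
    have 2: "sq (ide \<zero> \<oplus>\<^sub>a f) (ide (y \<oplus> x) \<oplus>\<^sub>a f) (i \<oplus>\<^sub>a ide (Dom C f)) (i \<oplus>\<^sub>a ide (Cod C f))"
      using sq_tensa [OF sq_ide_vertical [of i] sq_ide [of f]] by simp
    have 3: "sq (ide (y \<oplus> x) \<oplus>\<^sub>a f) (ide y \<oplus>\<^sub>a (ide x \<oplus>\<^sub>a f))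
        (arr_inv C (a y x (Dom C f))) (arr_inv C (a y x (Cod C f)))"
      using sq_inv [OF sq_a [of "ide y" "ide x" f]] by simp
    show "(ide y \<oplus>\<^sub>a (ide x \<oplus>\<^sub>a f)) \<bullet> k (Dom C f) = k (Cod C f) \<bullet> f"
      using sqD(9) [OF sq_comp [OF sq_comp [OF 1 2] 3]] by (simp add: k_def)
  qed
qed

lemma sum_left_faithful:
  assumes "ide x \<oplus>\<^sub>a f = ide x \<oplus>\<^sub>a g" "x \<in> Obj C" "f \<in> Arr C" "g \<in> Arr C"
    "Dom C f = Dom C g" "Cod C f = Cod C g"
  shows "f = g"
proof -
  obtain y k where k: "\<And>w. w \<in> Obj C \<Longrightarrow> k w \<in> hom C w (y \<oplus> (x \<oplus> w))"
    and natural: "\<And>f. f \<in> Arr C \<Longrightarrow> (ide y \<oplus>\<^sub>a (ide x \<oplus>\<^sub>a f)) \<bullet> k (Dom C f) = k (Cod C f) \<bullet> f"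
    using sum_left_unit [OF assms(2)] by metis
  have "k (Cod C g) \<bullet> f = k (Cod C g) \<bullet> g"
    using natural [OF assms(3)] natural [OF assms(4)] assms(1,5,6) by simp
  then show ?thesis
    by (rule left_cancel) (use hom_arrD [OF k [of "Cod C g"]] assms in simp_all)
qed

lemma sum_left_full:
  assumes "x \<in> Obj C" "u \<in> Obj C" "v \<in> Obj C" "p \<in> hom C (x \<oplus> u) (x \<oplus> v)"
  shows "\<exists>f\<in>hom C u v. ide x \<oplus>\<^sub>a f = p"
proof -
  obtain y k where y [simp]: "y \<in> Obj C" and k: "\<And>w. w \<in> Obj C \<Longrightarrow> k w \<in> hom C w (y \<oplus> (x \<oplus> w))"
    and natural: "\<And>f. f \<in> Arr C \<Longrightarrow> (ide y \<oplus>\<^sub>a (ide x \<oplus>\<^sub>a f)) \<bullet> k (Dom C f) = k (Cod C f) \<bullet> f"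
    using sum_left_unit [OF assms(1)] by metis
  note [simp] = assms(1-3) hom_arrD [OF assms(4)] hom_arrD [OF k [OF assms(2)]]
    hom_arrD [OF k [OF assms(3)]]
  define f where "f = arr_inv C (k v) \<bullet> (ide y \<oplus>\<^sub>a p) \<bullet> k u"
  have f [simp]: "f \<in> Arr C" "Dom C f = u" "Cod C f = v"
    by (simp_all add: f_def)
  have "(ide y \<oplus>\<^sub>a (ide x \<oplus>\<^sub>a f)) \<bullet> k u = (ide y \<oplus>\<^sub>a p) \<bullet> k u"
    using natural [OF f(1)] by (simp add: f_def)
  then have "ide y \<oplus>\<^sub>a (ide x \<oplus>\<^sub>a f) = ide y \<oplus>\<^sub>a p"
    by (rule right_cancel) simp_all
  then have "ide x \<oplus>\<^sub>a f = p"
    by (rule sum_left_faithful) simp_all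
  then show ?thesis using f by (intro bexI [of _ f] homI)
qed

text \<open>
  Write \<open>h x : F x + F \<zero> \<rightarrow> F x\<close> for the arrow induced by \<open>r x\<close>; the right unit axiom for a zero
  isomorphism \<open>k\<close> says that \<open>h x\<close> composed with \<open>id + k\<close> is the unitor. At \<open>\<zero>\<close> this has exactly one
  solution, as \<open>F \<zero> + -\<close> is fully faithful. Compatibility with associators makes \<open>h\<close> an associative
  action of \<open>F \<zero>\<close> (\<open>h_assoc\<close>, where the isomorphism \<open>h x\<close> is cancelled), so a \<open>k\<close> that is neutral
  for the action on \<open>F \<zero>\<close> itself is neutral for the action on every \<open>F x\<close>. Compatibility with commutators turns the right unit axiom into the left one.
\<close>

lemma zero_exists_unique:
  assumes F: "sum_endofunctor C (\<oplus>) (\<oplus>\<^sub>a) \<zero> l r F"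
    and compat_a: "\<And>x y z. \<lbrakk>x \<in> Obj C; y \<in> Obj C; z \<in> Obj C\<rbrakk> \<Longrightarrow>
      ear F (a x y z) \<bullet> esum F x (y \<oplus> z) \<bullet> (ide (eob F x) \<oplus>\<^sub>a esum F y z) =
      esum F (x \<oplus> y) z \<bullet> (esum F x y \<oplus>\<^sub>a ide (eob F z)) \<bullet> a (eob F x) (eob F y) (eob F z)"
    and compat_c: "\<And>x y. \<lbrakk>x \<in> Obj C; y \<in> Obj C\<rbrakk> \<Longrightarrow>
      ear F (c x y) \<bullet> esum F x y = esum F y x \<bullet> c (eob F x) (eob F y)"
  shows "\<exists>!k. symmetric_monoidal_endofunctor (F\<lparr>ezero := k\<rparr>)"
proof -
  interpret F: sum_endofunctor C "(\<oplus>)" "(\<oplus>\<^sub>a)" \<zero> l r F by (rule F)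
  let ?F0 = "eob F \<zero>"
  define h where "h x = ear F (r x) \<bullet> esum F x \<zero>" for x
  have h [simp]: "h x \<in> Arr C" "Dom C (h x) = eob F x \<oplus> ?F0" "Cod C (h x) = eob F x"
    if "x \<in> Obj C" for x
    using that by (simp_all add: h_def)
  have iff: "symmetric_monoidal_endofunctor (F\<lparr>ezero := k\<rparr>) \<longleftrightarrow> k \<in> hom C \<zero> ?F0 \<and>
      (\<forall>x\<in>Obj C. h x \<bullet> (ide (eob F x) \<oplus>\<^sub>a k) = r (eob F x)) \<and>
      (\<forall>x\<in>Obj C. ear F (l x) \<bullet> esum F \<zero> x \<bullet> (k \<oplus>\<^sub>a ide (eob F x)) = l (eob F x))" for k
  proof (cases "k \<in> hom C \<zero> ?F0")
    case True
    note [simp] = hom_arrD [OF True]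
    show ?thesis
      using True compat_a compat_c F.is_endofunctor F.esum_hom F.esum_natural
      by (simp add: symmetric_monoidal_endofunctor_def unital_endofunctor_def iso_hom_eq_hom h_def)
  next
    case False
    then show ?thesis
      by (simp add: symmetric_monoidal_endofunctor_def unital_endofunctor_def iso_hom_eq_hom)
  qed
  have h_assoc: "(h x \<oplus>\<^sub>a ide ?F0) \<bullet> a (eob F x) ?F0 ?F0 = ide (eob F x) \<oplus>\<^sub>a h \<zero>"
    if [simp]: "x \<in> Obj C" for x
  proof -
    have "h x \<bullet> (ide (eob F x) \<oplus>\<^sub>a h \<zero>)
        = ear F (r x) \<bullet> (esum F x \<zero> \<bullet> (ide (eob F x) \<oplus>\<^sub>a ear F (r \<zero>))) \<bullet> (ide (eob F x) \<oplus>\<^sub>a esum F \<zero> \<zero>)"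
      by (simp add: h_def tensa_comp)
    also have "esum F x \<zero> \<bullet> (ide (eob F x) \<oplus>\<^sub>a ear F (r \<zero>)) = ear F (ide x \<oplus>\<^sub>a r \<zero>) \<bullet> esum F x (\<zero> \<oplus> \<zero>)"
      using F.esum_natural [of "ide x" "r \<zero>"] by simp
    also have "ear F (ide x \<oplus>\<^sub>a r \<zero>) = ear F (r x \<oplus>\<^sub>a ide \<zero>) \<bullet> ear F (a x \<zero> \<zero>)"
      by (simp add: r_zero triangle flip: F.ear_comp)
    also have "ear F (r x) \<bullet> ((ear F (r x \<oplus>\<^sub>a ide \<zero>) \<bullet> ear F (a x \<zero> \<zero>)) \<bullet> esum F x (\<zero> \<oplus> \<zero>)) \<bullet>
          (ide (eob F x) \<oplus>\<^sub>a esum F \<zero> \<zero>)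
        = ear F (r x) \<bullet> ear F (r x \<oplus>\<^sub>a ide \<zero>) \<bullet>
          (ear F (a x \<zero> \<zero>) \<bullet> esum F x (\<zero> \<oplus> \<zero>) \<bullet> (ide (eob F x) \<oplus>\<^sub>a esum F \<zero> \<zero>))"
      by simp
    also have "\<dots> = ear F (r x) \<bullet> (ear F (r x \<oplus>\<^sub>a ide \<zero>) \<bullet> esum F (x \<oplus> \<zero>) \<zero>) \<bullet>
          (esum F x \<zero> \<oplus>\<^sub>a ide ?F0) \<bullet> a (eob F x) ?F0 ?F0"
      unfolding compat_a [OF that unit_Obj unit_Obj] by simp
    also have "ear F (r x \<oplus>\<^sub>a ide \<zero>) \<bullet> esum F (x \<oplus> \<zero>) \<zero> = esum F x \<zero> \<bullet> (ear F (r x) \<oplus>\<^sub>a ide ?F0)"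
      using F.esum_natural [of "r x" "ide \<zero>"] by simp
    also have "ear F (r x) \<bullet> (esum F x \<zero> \<bullet> (ear F (r x) \<oplus>\<^sub>a ide ?F0)) \<bullet>
          (esum F x \<zero> \<oplus>\<^sub>a ide ?F0) \<bullet> a (eob F x) ?F0 ?F0
        = h x \<bullet> (h x \<oplus>\<^sub>a ide ?F0) \<bullet> a (eob F x) ?F0 ?F0"
      by (simp add: h_def tensa_comp_assoc)
    finally show ?thesis
      by (rule left_cancel [of "h x", OF sym]) simp_all
  qed
  \<comment> \<open>the only choice allowed by the right unit axiom at the zero object\<close>
  obtain k where k: "k \<in> hom C \<zero> ?F0" and k0: "ide ?F0 \<oplus>\<^sub>a k = arr_inv C (h \<zero>) \<bullet> r ?F0"
    using sum_left_full [of ?F0 \<zero> ?F0 "arr_inv C (h \<zero>) \<bullet> r ?F0"] by (auto simp: hom_def)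
  note [simp] = hom_arrD [OF k]
  have r_axiom: "h x \<bullet> (ide (eob F x) \<oplus>\<^sub>a k) = r (eob F x)" if [simp]: "x \<in> Obj C" for x
  proof -
    let ?Fx = "eob F x"
    have "(h x \<oplus>\<^sub>a k) \<bullet> a ?Fx ?F0 \<zero> = (h x \<oplus>\<^sub>a ide ?F0) \<bullet> (((ide ?Fx \<oplus>\<^sub>a ide ?F0) \<oplus>\<^sub>a k) \<bullet> a ?Fx ?F0 \<zero>)"
      by (simp add: tensa_comp_assoc)
    also have "\<dots> = ((h x \<oplus>\<^sub>a ide ?F0) \<bullet> a ?Fx ?F0 ?F0) \<bullet> (ide ?Fx \<oplus>\<^sub>a (ide ?F0 \<oplus>\<^sub>a k))"
      using a_natural [of "ide ?Fx" "ide ?F0" k] by simp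
    also have "\<dots> = ide ?Fx \<oplus>\<^sub>a r ?F0"
      by (simp add: h_assoc k0 tensa_comp)
    also have "\<dots> = r (?Fx \<oplus> ?F0) \<bullet> a ?Fx ?F0 \<zero>"
      by (simp add: r_tensor)
    finally have "h x \<oplus>\<^sub>a k = r (?Fx \<oplus> ?F0)"
      by (rule right_cancel) simp_all
    then have "(h x \<bullet> (ide ?Fx \<oplus>\<^sub>a k)) \<bullet> (h x \<oplus>\<^sub>a ide \<zero>) = r ?Fx \<bullet> (h x \<oplus>\<^sub>a ide \<zero>)"
      using r_natural [of "h x"] by (simp add: tensa_comp)
    then show ?thesis
      by (rule right_cancel) simp_all
  qed
  have l_axiom: "ear F (l x) \<bullet> esum F \<zero> x \<bullet> (k \<oplus>\<^sub>a ide (eob F x)) = l (eob F x)"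
    if [simp]: "x \<in> Obj C" for x
  proof -
    let ?Fx = "eob F x"
    have "ear F (l x) \<bullet> esum F \<zero> x \<bullet> (k \<oplus>\<^sub>a ide ?Fx)
        = ear F (r x) \<bullet> (ear F (c \<zero> x) \<bullet> esum F \<zero> x) \<bullet> (k \<oplus>\<^sub>a ide ?Fx)"
      by (simp add: F.ear_comp flip: r_c_zero)
    also have "\<dots> = h x \<bullet> (c ?F0 ?Fx \<bullet> (k \<oplus>\<^sub>a ide ?Fx))"
      by (simp add: compat_c h_def)
    also have "\<dots> = (h x \<bullet> (ide ?Fx \<oplus>\<^sub>a k)) \<bullet> c \<zero> ?Fx"
      using c_natural [of k "ide ?Fx"] by simp
    also have "\<dots> = l ?Fx"
      by (simp only: r_axiom that) (simp add: r_c_zero)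
    finally show ?thesis .
  qed
  show ?thesis
  proof (rule ex1I)
    show "symmetric_monoidal_endofunctor (F\<lparr>ezero := k\<rparr>)"
      using iff k r_axiom l_axiom by blast
    fix k'
    assume "symmetric_monoidal_endofunctor (F\<lparr>ezero := k'\<rparr>)"
    then have k': "k' \<in> hom C \<zero> ?F0" "h \<zero> \<bullet> (ide ?F0 \<oplus>\<^sub>a k') = r ?F0"
      using iff by auto
    note [simp] = hom_arrD [OF k'(1)]
    have "ide ?F0 \<oplus>\<^sub>a k' = ide ?F0 \<oplus>\<^sub>a k"
      by (rule left_cancel [of "h \<zero>"]) (use k'(2) r_axiom [of \<zero>] in simp_all)
    then show "k' = k"
      by (rule sum_left_faithful) simp_all
  qed
qed

end

text \<open>
  The right unit axiom at the zero object, which already determines the zero isomorphism.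
\<close>

definition (in pre_two_group) zero_axiom :: "('o, 'm) endo \<Rightarrow> bool" where
  "zero_axiom F \<longleftrightarrow> eob F \<zero> \<in> Obj C \<and> ezero F \<in> hom C \<zero> (eob F \<zero>) \<and>
    esum F \<zero> \<zero> \<in> hom C (eob F \<zero> \<oplus> eob F \<zero>) (eob F (\<zero> \<oplus> \<zero>)) \<and>
    ear F (r \<zero>) \<in> hom C (eob F (\<zero> \<oplus> \<zero>)) (eob F \<zero>) \<and>
    ear F (r \<zero>) \<bullet> esum F \<zero> \<zero> \<bullet> (ide (eob F \<zero>) \<oplus>\<^sub>a ezero F) = r (eob F \<zero>)"

lemma (in sum_zero_endofunctor) zero_axiom: "zero_axiom F"
  unfolding zero_axiom_def using r_axiom [of \<zero>] by (auto intro!: homI)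

lemma (in pre_two_group) zero_axiom_endo_id: "zero_axiom endo_id"
  by (auto simp: zero_axiom_def endo_id_def)

lemma (in pre_two_group) zero_axiom_endo_comp:
  assumes "unital_endofunctor G" "unital_endofunctor F"
  shows "zero_axiom (endo_comp G F)"
proof -
  interpret F: sum_zero_endofunctor C "(\<oplus>)" "(\<oplus>\<^sub>a)" \<zero> l r F
    using assms by (simp add: unital_endofunctor_iff)
  interpret G: sum_zero_endofunctor C "(\<oplus>)" "(\<oplus>\<^sub>a)" \<zero> l r G
    using assms by (simp add: unital_endofunctor_iff)
  let ?F0 = "eob F \<zero>"
  have "ear G (ear F (r \<zero>)) \<bullet> ear G (esum F \<zero> \<zero>) \<bullet> esum G ?F0 ?F0 \<bullet>
        (ide (eob G ?F0) \<oplus>\<^sub>a (ear G (ezero F) \<bullet> ezero G))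
      = ear G (ear F (r \<zero>)) \<bullet> ear G (esum F \<zero> \<zero>) \<bullet>
        (esum G ?F0 ?F0 \<bullet> (ide (eob G ?F0) \<oplus>\<^sub>a ear G (ezero F))) \<bullet> (ide (eob G ?F0) \<oplus>\<^sub>a ezero G)"
    by (simp add: tensa_comp)
  also have "esum G ?F0 ?F0 \<bullet> (ide (eob G ?F0) \<oplus>\<^sub>a ear G (ezero F)) =
      ear G (ide ?F0 \<oplus>\<^sub>a ezero F) \<bullet> esum G ?F0 \<zero>"
    using G.esum_natural [of "ide ?F0" "ezero F"] by simp
  also have "ear G (ear F (r \<zero>)) \<bullet> ear G (esum F \<zero> \<zero>) \<bullet>
        (ear G (ide ?F0 \<oplus>\<^sub>a ezero F) \<bullet> esum G ?F0 \<zero>) \<bullet> (ide (eob G ?F0) \<oplus>\<^sub>a ezero G)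
      = ear G (ear F (r \<zero>) \<bullet> esum F \<zero> \<zero> \<bullet> (ide ?F0 \<oplus>\<^sub>a ezero F)) \<bullet> esum G ?F0 \<zero> \<bullet>
        (ide (eob G ?F0) \<oplus>\<^sub>a ezero G)"
    by (simp add: G.ear_comp)
  also have "\<dots> = r (eob G ?F0)"
    by (simp add: F.r_axiom G.r_axiom)
  finally show ?thesis
    by (auto simp: zero_axiom_def endo_comp_def intro!: homI)
qed

lemma (in ac_two_group) zero_axiom_endo_sum:
  assumes "unital_endofunctor F" "unital_endofunctor G"
  shows "zero_axiom (F \<boxplus> G)"
proof -
  interpret F: sum_zero_endofunctor C "(\<oplus>)" "(\<oplus>\<^sub>a)" \<zero> l r F
    using assms by (simp add: unital_endofunctor_iff)
  interpret G: sum_zero_endofunctor C "(\<oplus>)" "(\<oplus>\<^sub>a)" \<zero> l r G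
    using assms by (simp add: unital_endofunctor_iff)
  let ?F0 = "eob F \<zero>" and ?G0 = "eob G \<zero>"
  let ?i = "ide (?F0 \<oplus> ?G0)"
  have "(ear F (r \<zero>) \<oplus>\<^sub>a ear G (r \<zero>)) \<bullet> (esum F \<zero> \<zero> \<oplus>\<^sub>a esum G \<zero> \<zero>) \<bullet> b ?F0 ?G0 ?F0 ?G0 \<bullet>
        (?i \<oplus>\<^sub>a ((ezero F \<oplus>\<^sub>a ezero G) \<bullet> arr_inv C (l \<zero>)))
      = (ear F (r \<zero>) \<oplus>\<^sub>a ear G (r \<zero>)) \<bullet> (esum F \<zero> \<zero> \<oplus>\<^sub>a esum G \<zero> \<zero>) \<bullet>
        (b ?F0 ?G0 ?F0 ?G0 \<bullet> ((ide ?F0 \<oplus>\<^sub>a ide ?G0) \<oplus>\<^sub>a (ezero F \<oplus>\<^sub>a ezero G))) \<bullet> (?i \<oplus>\<^sub>a arr_inv C (l \<zero>))"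
    by (simp add: tensa_comp)
  also have "b ?F0 ?G0 ?F0 ?G0 \<bullet> ((ide ?F0 \<oplus>\<^sub>a ide ?G0) \<oplus>\<^sub>a (ezero F \<oplus>\<^sub>a ezero G)) =
      ((ide ?F0 \<oplus>\<^sub>a ezero F) \<oplus>\<^sub>a (ide ?G0 \<oplus>\<^sub>a ezero G)) \<bullet> b ?F0 ?G0 \<zero> \<zero>"
    using b_natural [of "ide ?F0" "ide ?G0" "ezero F" "ezero G"] by simp
  also have "(ear F (r \<zero>) \<oplus>\<^sub>a ear G (r \<zero>)) \<bullet> (esum F \<zero> \<zero> \<oplus>\<^sub>a esum G \<zero> \<zero>) \<bullet>
        (((ide ?F0 \<oplus>\<^sub>a ezero F) \<oplus>\<^sub>a (ide ?G0 \<oplus>\<^sub>a ezero G)) \<bullet> b ?F0 ?G0 \<zero> \<zero>) \<bullet> (?i \<oplus>\<^sub>a arr_inv C (l \<zero>))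
      = ((r ?F0 \<oplus>\<^sub>a r ?G0) \<bullet> b ?F0 ?G0 \<zero> \<zero>) \<bullet> (?i \<oplus>\<^sub>a arr_inv C (l \<zero>))"
    by (simp add: tensa_comp_assoc F.r_axiom G.r_axiom)
  also have "\<dots> = r (?F0 \<oplus> ?G0)"
    by (simp add: AC2_3 tensa_comp)
  finally show ?thesis
    by (auto simp: zero_axiom_def endo_sum_def intro!: homI)
qed

text \<open>
  Since \<open>\<tau>\<close> commutes with the arrows in the unit axiom, \<open>\<tau> \<zero> \<bullet> ezero F\<close> satisfies the equation that
  determines \<open>ezero G\<close>.
\<close>

lemma (in symmetric_two_group) zero_natural:
  assumes "zero_axiom F" "zero_axiom G" and \<tau>: "\<tau> \<zero> \<in> hom C (eob F \<zero>) (eob G \<zero>)"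
    "\<tau> (\<zero> \<oplus> \<zero>) \<in> hom C (eob F (\<zero> \<oplus> \<zero>)) (eob G (\<zero> \<oplus> \<zero>))"
    and natural: "\<tau> \<zero> \<bullet> ear F (r \<zero>) = ear G (r \<zero>) \<bullet> \<tau> (\<zero> \<oplus> \<zero>)"
    and sum: "\<tau> (\<zero> \<oplus> \<zero>) \<bullet> esum F \<zero> \<zero> = esum G \<zero> \<zero> \<bullet> (\<tau> \<zero> \<oplus>\<^sub>a \<tau> \<zero>)"
  shows "\<tau> \<zero> \<bullet> ezero F = ezero G"
proof -
  have [simp]: "eob F \<zero> \<in> Obj C" "eob G \<zero> \<in> Obj C"
    and F: "ezero F \<in> hom C \<zero> (eob F \<zero>)"
      "esum F \<zero> \<zero> \<in> hom C (eob F \<zero> \<oplus> eob F \<zero>) (eob F (\<zero> \<oplus> \<zero>))"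
      "ear F (r \<zero>) \<in> hom C (eob F (\<zero> \<oplus> \<zero>)) (eob F \<zero>)"
    and F_axiom: "ear F (r \<zero>) \<bullet> esum F \<zero> \<zero> \<bullet> (ide (eob F \<zero>) \<oplus>\<^sub>a ezero F) = r (eob F \<zero>)"
    and G: "ezero G \<in> hom C \<zero> (eob G \<zero>)"
      "esum G \<zero> \<zero> \<in> hom C (eob G \<zero> \<oplus> eob G \<zero>) (eob G (\<zero> \<oplus> \<zero>))"
      "ear G (r \<zero>) \<in> hom C (eob G (\<zero> \<oplus> \<zero>)) (eob G \<zero>)"
    and G_axiom: "ear G (r \<zero>) \<bullet> esum G \<zero> \<zero> \<bullet> (ide (eob G \<zero>) \<oplus>\<^sub>a ezero G) = r (eob G \<zero>)"
    using assms(1,2) by (simp_all add: zero_axiom_def)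
  note [simp] = hom_arrD [OF F(1)] hom_arrD [OF F(2)] hom_arrD [OF F(3)] hom_arrD [OF G(1)]
    hom_arrD [OF G(2)] hom_arrD [OF G(3)] hom_arrD [OF \<tau>(1)] hom_arrD [OF \<tau>(2)]
  have "(ear G (r \<zero>) \<bullet> esum G \<zero> \<zero> \<bullet> (ide (eob G \<zero>) \<oplus>\<^sub>a (\<tau> \<zero> \<bullet> ezero F))) \<bullet> (\<tau> \<zero> \<oplus>\<^sub>a ide \<zero>)
      = ear G (r \<zero>) \<bullet> (esum G \<zero> \<zero> \<bullet> (\<tau> \<zero> \<oplus>\<^sub>a \<tau> \<zero>)) \<bullet> (ide (eob F \<zero>) \<oplus>\<^sub>a ezero F)"
    by (simp add: tensa_comp)
  also have "\<dots> = (ear G (r \<zero>) \<bullet> \<tau> (\<zero> \<oplus> \<zero>)) \<bullet> esum F \<zero> \<zero> \<bullet> (ide (eob F \<zero>) \<oplus>\<^sub>a ezero F)"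
    by (simp flip: sum)
  also have "\<dots> = \<tau> \<zero> \<bullet> (ear F (r \<zero>) \<bullet> esum F \<zero> \<zero> \<bullet> (ide (eob F \<zero>) \<oplus>\<^sub>a ezero F))"
    by (simp flip: natural)
  also have "\<dots> = r (eob G \<zero>) \<bullet> (\<tau> \<zero> \<oplus>\<^sub>a ide \<zero>)"
    using r_natural [of "\<tau> \<zero>"] by (simp add: F_axiom)
  also have "\<dots> = (ear G (r \<zero>) \<bullet> esum G \<zero> \<zero> \<bullet> (ide (eob G \<zero>) \<oplus>\<^sub>a ezero G)) \<bullet> (\<tau> \<zero> \<oplus>\<^sub>a ide \<zero>)"
    by (simp only: G_axiom)
  finally have "(ear G (r \<zero>) \<bullet> esum G \<zero> \<zero> \<bullet> (ide (eob G \<zero>) \<oplus>\<^sub>a (\<tau> \<zero> \<bullet> ezero F))) \<bullet> (\<tau> \<zero> \<oplus>\<^sub>a ide \<zero>)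
      = (ear G (r \<zero>) \<bullet> esum G \<zero> \<zero> \<bullet> (ide (eob G \<zero>) \<oplus>\<^sub>a ezero G)) \<bullet> (\<tau> \<zero> \<oplus>\<^sub>a ide \<zero>)" .
  then have "ear G (r \<zero>) \<bullet> esum G \<zero> \<zero> \<bullet> (ide (eob G \<zero>) \<oplus>\<^sub>a (\<tau> \<zero> \<bullet> ezero F))
      = ear G (r \<zero>) \<bullet> esum G \<zero> \<zero> \<bullet> (ide (eob G \<zero>) \<oplus>\<^sub>a ezero G)"
    by (rule right_cancel) simp_all
  then have "(ear G (r \<zero>) \<bullet> esum G \<zero> \<zero>) \<bullet> (ide (eob G \<zero>) \<oplus>\<^sub>a (\<tau> \<zero> \<bullet> ezero F))
      = (ear G (r \<zero>) \<bullet> esum G \<zero> \<zero>) \<bullet> (ide (eob G \<zero>) \<oplus>\<^sub>a ezero G)"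
    by simp
  then have "ide (eob G \<zero>) \<oplus>\<^sub>a (\<tau> \<zero> \<bullet> ezero F) = ide (eob G \<zero>) \<oplus>\<^sub>a ezero G"
    by (rule left_cancel) simp_all
  then show ?thesis
    by (rule sum_left_faithful) simp_all
qed

section \<open>Quang 2-rings and AC 2-rings\<close>

text \<open>
  The compatibility of the two distributors is stated with \<open>b\<close> on one side for Quang 2-rings and on
  the other for AC 2-rings. The two forms agree because exchanging the middle summands twice is the
  identity.
\<close>

lemma (in symmetric_two_group) canonical_b_involution:
  assumes [simp]: "x \<in> Obj C" "y \<in> Obj C" "z \<in> Obj C" "t \<in> Obj C"
  shows "canonical_b x z y t \<bullet> canonical_b x y z t = ide ((x \<oplus> y) \<oplus> (z \<oplus> t))"
proof -
  let ?S = "Sum (Sum (At x) (At y)) (Sum (At z) (At t))"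
  have "represents ?S ?S (canonical_b x z y t \<bullet> canonical_b x y z t) ([1] @ [1])"
    by (rule represents_comp; rule represents_canonical_b_At) simp_all
  moreover have "represents ?S ?S (ide ((x \<oplus> y) \<oplus> (z \<oplus> t))) []"
    using represents_ide [of ?S] by simp
  ultimately show ?thesis
    by (rule symmetric_coherence) (use coxeter_involution [of _ 1] in simp)
qed

lemma (in ac_two_group) b_involution:
  assumes "x \<in> Obj C" "y \<in> Obj C" "z \<in> Obj C" "t \<in> Obj C"
  shows "b x z y t \<bullet> b x y z t = ide ((x \<oplus> y) \<oplus> (z \<oplus> t))"
  using symmetric_two_group.canonical_b_involution [OF symmetric_two_group_canonical assms]
  by (simp add: canonical_b_canonical)

lemma (in symmetric_two_group) ac_natural_isoI:
  assumes "zero_axiom F" "zero_axiom G"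
    and \<tau>: "\<And>x. x \<in> Obj C \<Longrightarrow> \<tau> x \<in> hom C (eob F x) (eob G x)"
    and natural: "\<And>f. f \<in> Arr C \<Longrightarrow> \<tau> (Cod C f) \<bullet> ear F f = ear G f \<bullet> \<tau> (Dom C f)"
    and sum: "\<And>x y. \<lbrakk>x \<in> Obj C; y \<in> Obj C\<rbrakk> \<Longrightarrow>
      \<tau> (x \<oplus> y) \<bullet> esum F x y = esum G x y \<bullet> (\<tau> x \<oplus>\<^sub>a \<tau> y)"
  shows "ac_two_group.ac_natural_iso C (\<oplus>) (\<oplus>\<^sub>a) \<zero> \<tau> F G"
proof -
  interpret ac: ac_two_group C "(\<oplus>)" "(\<oplus>\<^sub>a)" \<zero> l r canonical_b
    by (rule ac_two_group_canonical_b)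
  have "\<tau> \<zero> \<bullet> ezero F = ezero G"
    using natural [of "r \<zero>"] by (intro zero_natural assms(1,2) \<tau> sum) simp_all
  then show ?thesis
    using \<tau> natural sum by (simp add: ac.ac_natural_iso_def iso_hom_eq_hom)
qed

context pre_two_ring
begin

lemma d_arr [simp]:
  assumes "x \<in> Obj C" "y \<in> Obj C" "z \<in> Obj C"
  shows "d x y z \<in> Arr C" "Dom C (d x y z) = x \<otimes> y \<oplus> x \<otimes> z" "Cod C (d x y z) = x \<otimes> (y \<oplus> z)"
  using iso_hom_arrD [OF PiE_mem [OF PiE_mem [OF PiE_mem [OF d_type assms(1)] assms(2)] assms(3)]] .

lemma e_arr [simp]:
  assumes "x \<in> Obj C" "y \<in> Obj C" "z \<in> Obj C"
  shows "e x y z \<in> Arr C" "Dom C (e x y z) = x \<otimes> z \<oplus> y \<otimes> z" "Cod C (e x y z) = (x \<oplus> y) \<otimes> z"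
  using iso_hom_arrD [OF PiE_mem [OF PiE_mem [OF PiE_mem [OF e_type assms(1)] assms(2)] assms(3)]] .

lemma left_mult_simps [simp]:
  "eob (left_mult x k) y = x \<otimes> y" "ear (left_mult x k) f = ide x \<otimes>\<^sub>a f"
  "esum (left_mult x k) y z = d x y z" "ezero (left_mult x k) = k"
  "(left_mult x k)\<lparr>ezero := k'\<rparr> = left_mult x k'"
  by (simp_all add: left_mult_def)

lemma right_mult_simps [simp]:
  "eob (right_mult z k) x = x \<otimes> z" "ear (right_mult z k) f = f \<otimes>\<^sub>a ide z"
  "esum (right_mult z k) x y = e x y z" "ezero (right_mult z k) = k"
  "(right_mult z k)\<lparr>ezero := k'\<rparr> = right_mult z k'"
  by (simp_all add: right_mult_def)

lemma sum_endofunctor_left_mult: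
  assumes [simp]: "x \<in> Obj C"
  shows "sum_endofunctor C (\<oplus>) (\<oplus>\<^sub>a) \<zero> l r (left_mult x k)"
proof unfold_locales
  show "endofunctor (eob (left_mult x k)) (ear (left_mult x k))"
    by (auto simp: endofunctor_def mul.tensa_comp intro!: homI)
  fix f g
  assume [simp]: "f \<in> Arr C" "g \<in> Arr C"
  show "esum (left_mult x k) (Cod C f) (Cod C g) \<bullet> (ear (left_mult x k) f \<oplus>\<^sub>a ear (left_mult x k) g) =
      ear (left_mult x k) (f \<oplus>\<^sub>a g) \<bullet> esum (left_mult x k) (Dom C f) (Dom C g)"
    using d_natural [of "ide x" f g] by simp
qed (auto intro!: homI)

lemma sum_endofunctor_right_mult:
  assumes [simp]: "z \<in> Obj C"
  shows "sum_endofunctor C (\<oplus>) (\<oplus>\<^sub>a) \<zero> l r (right_mult z k)"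
proof unfold_locales
  show "endofunctor (eob (right_mult z k)) (ear (right_mult z k))"
    by (auto simp: endofunctor_def mul.tensa_comp intro!: homI)
  fix f g
  assume [simp]: "f \<in> Arr C" "g \<in> Arr C"
  show "esum (right_mult z k) (Cod C f) (Cod C g) \<bullet> (ear (right_mult z k) f \<oplus>\<^sub>a ear (right_mult z k) g) =
      ear (right_mult z k) (f \<oplus>\<^sub>a g) \<bullet> esum (right_mult z k) (Dom C f) (Dom C g)"
    using e_natural [of f g "ide z"] by simp
qed (auto intro!: homI)

end

context quang_structure
begin

lemma left_zero_exists_unique:
  assumes "x \<in> Obj C"
  shows "\<exists>!m0. symmetric_monoidal_endofunctor (left_mult x m0)"
  using zero_exists_unique [OF sum_endofunctor_left_mult [OF assms]] assms R1_1 R1_3 by simp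

lemma right_zero_exists_unique:
  assumes "z \<in> Obj C"
  shows "\<exists>!n0. symmetric_monoidal_endofunctor (right_mult z n0)"
  using zero_exists_unique [OF sum_endofunctor_right_mult [OF assms]] assms R1_2 R1_4 by simp

text \<open>
  Given the zero isomorphisms, every axiom on natural isomorphisms consists of naturality, of the
  compatibility with sums, which is one of the axioms on distributors, and of the compatibility with
  zeros, which is automatic.
\<close>

lemma ac_structure_canonical_b:
  assumes m: "\<And>x. x \<in> Obj C \<Longrightarrow> symmetric_monoidal_endofunctor (left_mult x (m x))"
    and n: "\<And>z. z \<in> Obj C \<Longrightarrow> symmetric_monoidal_endofunctor (right_mult z (n z))"
    and "m \<in> extensional (Obj C)" "n \<in> extensional (Obj C)"
  shows "ac_structure C (\<oplus>) (\<oplus>\<^sub>a) \<zero> l r canonical_b (\<otimes>) (\<otimes>\<^sub>a) \<one> lx rx ax d e m n"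
proof (intro ac_structure.intro ac_structure_axioms.intro)
  show "ac_two_group C (\<oplus>) (\<oplus>\<^sub>a) \<zero> l r canonical_b"
    by (rule ac_two_group_canonical_b)
  then interpret ac: ac_two_group C "(\<oplus>)" "(\<oplus>\<^sub>a)" \<zero> l r canonical_b .
  show "pre_two_ring C (\<oplus>) (\<oplus>\<^sub>a) \<zero> l r (\<otimes>) (\<otimes>\<^sub>a) \<one> lx rx ax d e"
    by (rule pre_two_ring_axioms)
  have uL: "unital_endofunctor (left_mult x (m x))" and uR: "unital_endofunctor (right_mult x (n x))"
    if "x \<in> Obj C" for x
    using m n that by (simp_all add: symmetric_monoidal_endofunctor_def)
  have zL: "zero_axiom (left_mult x (m x))" and zR: "zero_axiom (right_mult x (n x))"
    if "x \<in> Obj C" for x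
    using uL [OF that] uR [OF that] sum_zero_endofunctor.zero_axiom by (simp_all add: unital_endofunctor_iff)
  show "m \<in> (\<Pi>\<^sub>E x\<in>Obj C. iso_hom C \<zero> (x \<otimes> \<zero>))"
    using uL assms(3) by (simp add: PiE_iff unital_endofunctor_def)
  show "n \<in> (\<Pi>\<^sub>E z\<in>Obj C. iso_hom C \<zero> (\<zero> \<otimes> z))"
    using uR assms(4) by (simp add: PiE_iff unital_endofunctor_def)
  show "ac.ac_endofunctor (left_mult x (m x))" if "x \<in> Obj C" for x
    using symmetric_monoidal_endofunctor_imp_ac [OF m [OF that]] .
  show "ac.ac_endofunctor (right_mult z (n z))" if "z \<in> Obj C" for z
    using symmetric_monoidal_endofunctor_imp_ac [OF n [OF that]] .
  show "ac.ac_natural_iso (\<lambda>z. e x y z)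
      (ac.endo_sum (left_mult x (m x)) (left_mult y (m y))) (left_mult (x \<oplus> y) (m (x \<oplus> y)))"
    if [simp]: "x \<in> Obj C" "y \<in> Obj C" for x y
  proof (rule ac_natural_isoI)
    show "zero_axiom (ac.endo_sum (left_mult x (m x)) (left_mult y (m y)))"
      by (intro ac.zero_axiom_endo_sum uL) simp_all
    show "zero_axiom (left_mult (x \<oplus> y) (m (x \<oplus> y)))"
      by (rule zL) simp
    fix z
    assume [simp]: "z \<in> Obj C"
    show "e x y z \<in> hom C (eob (ac.endo_sum (left_mult x (m x)) (left_mult y (m y))) z)
        (eob (left_mult (x \<oplus> y) (m (x \<oplus> y))) z)"
      by (intro homI) (simp_all add: ac.endo_sum_def)
    fix t
    assume [simp]: "t \<in> Obj C"
    have "e x y (z \<oplus> t) \<bullet> (d x z t \<oplus>\<^sub>a d y z t) \<bullet> canonical_b (x \<otimes> z) (y \<otimes> z) (x \<otimes> t) (y \<otimes> t)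
        = (e x y (z \<oplus> t) \<bullet> (d x z t \<oplus>\<^sub>a d y z t)) \<bullet> canonical_b (x \<otimes> z) (y \<otimes> z) (x \<otimes> t) (y \<otimes> t)"
      by simp
    also have "\<dots> = d (x \<oplus> y) z t \<bullet> (e x y z \<oplus>\<^sub>a e x y t)"
      by (simp add: canonical_b_involution flip: R2)
    finally show "e x y (z \<oplus> t) \<bullet> esum (ac.endo_sum (left_mult x (m x)) (left_mult y (m y))) z t =
        esum (left_mult (x \<oplus> y) (m (x \<oplus> y))) z t \<bullet> (e x y z \<oplus>\<^sub>a e x y t)"
      by (simp add: ac.endo_sum_def)
  next
    fix f
    assume [simp]: "f \<in> Arr C"
    show "e x y (Cod C f) \<bullet> ear (ac.endo_sum (left_mult x (m x)) (left_mult y (m y))) f =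
        ear (left_mult (x \<oplus> y) (m (x \<oplus> y))) f \<bullet> e x y (Dom C f)"
      using e_natural [of "ide x" "ide y" f] by (simp add: ac.endo_sum_def)
  qed
  show "ac.ac_natural_iso (\<lambda>z. ax x y z)
      (endo_comp (left_mult x (m x)) (left_mult y (m y))) (left_mult (x \<otimes> y) (m (x \<otimes> y)))"
    if [simp]: "x \<in> Obj C" "y \<in> Obj C" for x y
  proof (rule ac_natural_isoI)
    show "zero_axiom (endo_comp (left_mult x (m x)) (left_mult y (m y)))"
      by (intro zero_axiom_endo_comp uL) simp_all
    show "zero_axiom (left_mult (x \<otimes> y) (m (x \<otimes> y)))"
      by (rule zL) simp
  next
    fix f
    assume "f \<in> Arr C"
    then show "ax x y (Cod C f) \<bullet> ear (endo_comp (left_mult x (m x)) (left_mult y (m y))) f =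
        ear (left_mult (x \<otimes> y) (m (x \<otimes> y))) f \<bullet> ax x y (Dom C f)"
      using mul.a_natural [of "ide x" "ide y" f] by (simp add: endo_comp_def)
  qed (auto simp: endo_comp_def R3 intro!: homI)
  show "ac.ac_natural_iso (\<lambda>y. ax x y z)
      (endo_comp (left_mult x (m x)) (right_mult z (n z)))
      (endo_comp (right_mult z (n z)) (left_mult x (m x)))"
    if [simp]: "x \<in> Obj C" "z \<in> Obj C" for x z
  proof (rule ac_natural_isoI)
    show "zero_axiom (endo_comp (left_mult x (m x)) (right_mult z (n z)))"
      by (intro zero_axiom_endo_comp uL uR) simp_all
    show "zero_axiom (endo_comp (right_mult z (n z)) (left_mult x (m x)))"
      by (intro zero_axiom_endo_comp uL uR) simp_all
  next
    fix f
    assume "f \<in> Arr C"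
    then show "ax x (Cod C f) z \<bullet> ear (endo_comp (left_mult x (m x)) (right_mult z (n z))) f =
        ear (endo_comp (right_mult z (n z)) (left_mult x (m x))) f \<bullet> ax x (Dom C f) z"
      using mul.a_natural [of "ide x" f "ide z"] by (simp add: endo_comp_def)
  qed (auto simp: endo_comp_def R4 intro!: homI)
  show "ac.ac_natural_iso (\<lambda>x. ax x y z)
      (right_mult (y \<otimes> z) (n (y \<otimes> z))) (endo_comp (right_mult z (n z)) (right_mult y (n y)))"
    if [simp]: "y \<in> Obj C" "z \<in> Obj C" for y z
  proof (rule ac_natural_isoI)
    show "zero_axiom (endo_comp (right_mult z (n z)) (right_mult y (n y)))"
      by (intro zero_axiom_endo_comp uR) simp_all
    show "zero_axiom (right_mult (y \<otimes> z) (n (y \<otimes> z)))"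
      by (rule zR) simp
  next
    fix f
    assume "f \<in> Arr C"
    then show "ax (Cod C f) y z \<bullet> ear (right_mult (y \<otimes> z) (n (y \<otimes> z))) f =
        ear (endo_comp (right_mult z (n z)) (right_mult y (n y))) f \<bullet> ax (Dom C f) y z"
      using mul.a_natural [of f "ide y" "ide z"] by (simp add: endo_comp_def)
  qed (auto simp: endo_comp_def R5 intro!: homI)
  show "ac.ac_natural_iso lx (left_mult \<one> (m \<one>)) endo_id"
    by (rule ac_natural_isoI [OF zL zero_axiom_endo_id])
      (auto simp: endo_id_def R6_1 mul.l_natural intro!: homI)
  show "ac.ac_natural_iso rx (right_mult \<one> (n \<one>)) endo_id"
    by (rule ac_natural_isoI [OF zR zero_axiom_endo_id])
      (auto simp: endo_id_def R6_2 mul.r_natural intro!: homI)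
qed

end

context ac_structure
begin

lemma left_mult_symmetric_monoidal:
  "x \<in> Obj C \<Longrightarrow> symmetric_two_group.symmetric_monoidal_endofunctor C (\<oplus>) (\<oplus>\<^sub>a) \<zero> l r
    canonical_a canonical_c (left_mult x (m x))"
  using ac_endofunctor_imp_symmetric_monoidal [OF left_ac] .

lemma right_mult_symmetric_monoidal:
  "z \<in> Obj C \<Longrightarrow> symmetric_two_group.symmetric_monoidal_endofunctor C (\<oplus>) (\<oplus>\<^sub>a) \<zero> l r
    canonical_a canonical_c (right_mult z (n z))"
  using ac_endofunctor_imp_symmetric_monoidal [OF right_ac] .

lemma quang_structure_canonical:
  "quang_structure C (\<oplus>) (\<oplus>\<^sub>a) \<zero> l r canonical_a canonical_c (\<otimes>) (\<otimes>\<^sub>a) \<one> lx rx ax d e"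
proof (intro quang_structure.intro quang_structure_axioms.intro)
  show "symmetric_two_group C (\<oplus>) (\<oplus>\<^sub>a) \<zero> l r canonical_a canonical_c"
    by (rule symmetric_two_group_canonical)
  then interpret sm: symmetric_two_group C "(\<oplus>)" "(\<oplus>\<^sub>a)" \<zero> l r canonical_a canonical_c .
  show "pre_two_ring C (\<oplus>) (\<oplus>\<^sub>a) \<zero> l r (\<otimes>) (\<otimes>\<^sub>a) \<one> lx rx ax d e"
    by (rule pre_two_ring_axioms)
  note L = left_mult_symmetric_monoidal [unfolded sm.symmetric_monoidal_endofunctor_def]
  note R = right_mult_symmetric_monoidal [unfolded sm.symmetric_monoidal_endofunctor_def]
  fix x y assume x [simp]: "x \<in> Obj C" and y [simp]: "y \<in> Obj C"
  show "lx (x \<oplus> y) \<bullet> d \<one> x y = lx x \<oplus>\<^sub>a lx y"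
    using R6'_1 by (simp add: ac_natural_iso_def endo_id_def)
  show "rx (x \<oplus> y) \<bullet> e x y \<one> = rx x \<oplus>\<^sub>a rx y"
    using R6'_2 by (simp add: ac_natural_iso_def endo_id_def)
  fix z assume z [simp]: "z \<in> Obj C"
  show "(ide x \<otimes>\<^sub>a canonical_c y z) \<bullet> d x y z = d x z y \<bullet> canonical_c (x \<otimes> y) (x \<otimes> z)"
    using L [OF x] by simp
  show "(canonical_c y z \<otimes>\<^sub>a ide x) \<bullet> e y z x = e z y x \<bullet> canonical_c (y \<otimes> x) (z \<otimes> x)"
    using R [OF x] by simp
  fix t assume t [simp]: "t \<in> Obj C"
  show "(ide x \<otimes>\<^sub>a canonical_a y z t) \<bullet> d x y (z \<oplus> t) \<bullet> (ide (x \<otimes> y) \<oplus>\<^sub>a d x z t) =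
      d x (y \<oplus> z) t \<bullet> (d x y z \<oplus>\<^sub>a ide (x \<otimes> t)) \<bullet> canonical_a (x \<otimes> y) (x \<otimes> z) (x \<otimes> t)"
    using L [OF x] by simp
  show "(canonical_a x y z \<otimes>\<^sub>a ide t) \<bullet> e x (y \<oplus> z) t \<bullet> (ide (x \<otimes> t) \<oplus>\<^sub>a e y z t) =
      e (x \<oplus> y) z t \<bullet> (e x y t \<oplus>\<^sub>a ide (z \<otimes> t)) \<bullet> canonical_a (x \<otimes> t) (y \<otimes> t) (z \<otimes> t)"
    using R [OF t] by simp
  have "d (x \<oplus> y) z t \<bullet> (e x y z \<oplus>\<^sub>a e x y t) =
      e x y (z \<oplus> t) \<bullet> (d x z t \<oplus>\<^sub>a d y z t) \<bullet> b (x \<otimes> z) (y \<otimes> z) (x \<otimes> t) (y \<otimes> t)"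
    using R2' [OF x y] by (simp add: ac_natural_iso_def endo_sum_def)
  then have "(d (x \<oplus> y) z t \<bullet> (e x y z \<oplus>\<^sub>a e x y t)) \<bullet> b (x \<otimes> z) (x \<otimes> t) (y \<otimes> z) (y \<otimes> t) =
      (e x y (z \<oplus> t) \<bullet> (d x z t \<oplus>\<^sub>a d y z t) \<bullet> b (x \<otimes> z) (y \<otimes> z) (x \<otimes> t) (y \<otimes> t)) \<bullet>
      b (x \<otimes> z) (x \<otimes> t) (y \<otimes> z) (y \<otimes> t)"
    by (rule arg_cong)
  then show "d (x \<oplus> y) z t \<bullet> (e x y z \<oplus>\<^sub>a e x y t) \<bullet> sm.canonical_b (x \<otimes> z) (x \<otimes> t) (y \<otimes> z) (y \<otimes> t) =
      e x y (z \<oplus> t) \<bullet> (d x z t \<oplus>\<^sub>a d y z t)"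
    by (simp add: canonical_b_canonical b_involution)
  show "d (x \<otimes> y) z t \<bullet> (ax x y z \<oplus>\<^sub>a ax x y t) =
      ax x y (z \<oplus> t) \<bullet> (ide x \<otimes>\<^sub>a d y z t) \<bullet> d x (y \<otimes> z) (y \<otimes> t)"
    using R3' [OF x y] by (simp add: ac_natural_iso_def endo_comp_def)
  show "(d x z t \<otimes>\<^sub>a ide y) \<bullet> e (x \<otimes> z) (x \<otimes> t) y \<bullet> (ax x z y \<oplus>\<^sub>a ax x t y) =
      ax x (z \<oplus> t) y \<bullet> (ide x \<otimes>\<^sub>a e z t y) \<bullet> d x (z \<otimes> y) (t \<otimes> y)"
    using R4' [OF x y] by (simp add: ac_natural_iso_def endo_comp_def)
  show "(e t z y \<otimes>\<^sub>a ide x) \<bullet> e (t \<otimes> y) (z \<otimes> y) x \<bullet> (ax t y x \<oplus>\<^sub>a ax z y x) =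
      ax (t \<oplus> z) y x \<bullet> e t z (y \<otimes> x)"
    using R5' [OF y x] by (simp add: ac_natural_iso_def endo_comp_def)
qed

end

lemma quang_zero_isos:
  assumes "quang_two_ring Q"
  shows "\<forall>x\<in>Obj (grpd Q). \<exists>!m0. left_zero_iso Q x m0"
    and "\<forall>z\<in>Obj (grpd Q). \<exists>!n0. right_zero_iso Q z n0"
  using quang_structure.left_zero_exists_unique [OF assms [unfolded quang_two_ring_def]]
    quang_structure.right_zero_exists_unique [OF assms [unfolded quang_two_ring_def]]
  unfolding left_zero_iso_def right_zero_iso_def by auto

lemma ac_two_ring_ac_of_quang:
  assumes "quang_two_ring Q"
  shows "ac_two_ring (ac_of_quang Q)"
proof -
  interpret quang_structure "grpd Q"
    "plus_ob Q" "plus_ar Q" "zero_ob Q" "plus_l Q" "plus_r Q" "plus_a Q" "plus_c Q"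
    "times_ob Q" "times_ar Q" "one_ob Q" "times_l Q" "times_r Q" "times_a Q" "dist_d Q" "dist_e Q"
    using assms by (simp add: quang_two_ring_def)
  have "symmetric_monoidal_endofunctor (left_mult x m0) \<longleftrightarrow> left_zero_iso Q x m0" for x m0
    by (simp add: left_zero_iso_def)
  then have m: "symmetric_monoidal_endofunctor (left_mult x (THE m0. left_zero_iso Q x m0))"
    if "x \<in> Obj (grpd Q)" for x
    using theI' [of "left_zero_iso Q x"] quang_zero_isos(1) [OF assms] that by blast
  have "symmetric_monoidal_endofunctor (right_mult z n0) \<longleftrightarrow> right_zero_iso Q z n0" for z n0
    by (simp add: right_zero_iso_def)
  then have n: "symmetric_monoidal_endofunctor (right_mult z (THE n0. right_zero_iso Q z n0))"
    if "z \<in> Obj (grpd Q)" for z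
    using theI' [of "right_zero_iso Q z"] quang_zero_isos(2) [OF assms] that by blast
  show ?thesis
    unfolding ac_two_ring_def ac_of_quang_def ac.simps two_ring.simps
    by (rule ac_structure_canonical_b) (simp_all add: m n)
qed

lemma quang_of_ac_ac_of_quang:
  assumes "quang_two_ring Q"
  shows "quang_of_ac (ac_of_quang Q) = Q"
proof -
  interpret quang_structure "grpd Q"
    "plus_ob Q" "plus_ar Q" "zero_ob Q" "plus_l Q" "plus_r Q" "plus_a Q" "plus_c Q"
    "times_ob Q" "times_ar Q" "one_ob Q" "times_l Q" "times_r Q" "times_a Q" "dist_d Q" "dist_e Q"
    using assms by (simp add: quang_two_ring_def)
  show ?thesis
    by (cases Q) (use canonical_a_canonical_b canonical_c_canonical_b in
      \<open>simp add: quang_of_ac_def ac_of_quang_def\<close>)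
qed

lemma quang_two_ring_quang_of_ac:
  assumes "ac_two_ring A"
  shows "quang_two_ring (quang_of_ac A)"
  using ac_structure.quang_structure_canonical [OF assms [unfolded ac_two_ring_def]]
  by (simp add: quang_two_ring_def quang_of_ac_def)

lemma ac_of_quang_quang_of_ac:
  assumes "ac_two_ring A"
  shows "ac_of_quang (quang_of_ac A) = A"
proof -
  interpret ac_structure "grpd A"
    "plus_ob A" "plus_ar A" "zero_ob A" "plus_l A" "plus_r A" "plus_b A"
    "times_ob A" "times_ar A" "one_ob A" "times_l A" "times_r A" "times_a A"
    "dist_d A" "dist_e A" "zero_m A" "zero_n A"
    using assms by (simp add: ac_two_ring_def)
  let ?Q = "quang_of_ac A"
  have Q: "quang_two_ring ?Q" by (rule quang_two_ring_quang_of_ac [OF assms])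
  have [simp]: "grpd ?Q = grpd A" by (simp add: quang_of_ac_def)
  have "left_zero_iso ?Q x (zero_m A x)" if "x \<in> Obj (grpd A)" for x
    using left_mult_symmetric_monoidal [OF that] by (simp add: left_zero_iso_def quang_of_ac_def)
  then have "(THE m0. left_zero_iso ?Q x m0) = zero_m A x" if "x \<in> Obj (grpd A)" for x
    using quang_zero_isos(1) [OF Q] that by (intro the1_equality) auto
  then have m: "(\<lambda>x\<in>Obj (grpd A). THE m0. left_zero_iso ?Q x m0) = zero_m A"
    using m_type by (intro ext) (auto simp: PiE_iff extensional_def)
  have "right_zero_iso ?Q z (zero_n A z)" if "z \<in> Obj (grpd A)" for z
    using right_mult_symmetric_monoidal [OF that] by (simp add: right_zero_iso_def quang_of_ac_def)
  then have "(THE n0. right_zero_iso ?Q z n0) = zero_n A z" if "z \<in> Obj (grpd A)" for z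
    using quang_zero_isos(2) [OF Q] that by (intro the1_equality) auto
  then have n: "(\<lambda>z\<in>Obj (grpd A). THE n0. right_zero_iso ?Q z n0) = zero_n A"
    using n_type by (intro ext) (auto simp: PiE_iff extensional_def)
  have b: "plus_b (ac_of_quang ?Q) = plus_b A"
    using canonical_b_canonical by (simp add: ac_of_quang_def quang_of_ac_def)
  show ?thesis
    by (rule ac.equality) (use m n b in \<open>simp_all add: ac_of_quang_def\<close>, simp_all add: quang_of_ac_def)
qed

theorem proposition3p8:
  shows "(\<forall>Q :: ('o, 'm) quang. quang_two_ring Q \<longrightarrow>
            (\<forall>x \<in> Obj (grpd Q). \<exists>!m0. left_zero_iso Q x m0) \<and>
            (\<forall>z \<in> Obj (grpd Q). \<exists>!n0. right_zero_iso Q z n0) \<and>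
            ac_two_ring (ac_of_quang Q) \<and>
            quang_of_ac (ac_of_quang Q) = Q) \<and>
         (\<forall>A :: ('o, 'm) ac. ac_two_ring A \<longrightarrow>
            quang_two_ring (quang_of_ac A) \<and>
            ac_of_quang (quang_of_ac A) = A) \<and>
         bij_betw ac_of_quang
           {Q :: ('o, 'm) quang. quang_two_ring Q} {A :: ('o, 'm) ac. ac_two_ring A}"
proof -
  have "bij_betw ac_of_quang
      {Q :: ('o, 'm) quang. quang_two_ring Q} {A :: ('o, 'm) ac. ac_two_ring A}"
    by (rule bij_betw_byWitness [where f' = quang_of_ac])
      (auto simp: quang_of_ac_ac_of_quang ac_of_quang_quang_of_ac
        ac_two_ring_ac_of_quang quang_two_ring_quang_of_ac)
  then show ?thesis
    by (simp add: quang_zero_isos ac_two_ring_ac_of_quang quang_of_ac_ac_of_quang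
        quang_two_ring_quang_of_ac ac_of_quang_quang_of_ac)
qed

end
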